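(* Let $N\ge2$, $p>1$, $\theta,l\in\mathbb{R}$, $R>0$, and let $v$ be a solution of $-\mathrm{div}(|x|^\theta\nabla v)=|x|^l|v|^{p-1}v$ in $B_R\setminus\{0\}$. Define $$w(y)=|x|^{N-2+\theta}v(x),\qquad y=\frac{x}{|x|^2},$$ for $y\in\mathbb{R}^N\setminus\overline{B_{1/R}}$, and put $\beta=(N-2+\theta)(p-1)-(4+l-2\theta)$. Then $v$ is stable in $B_R\setminus\{0\}$ if and only if $w$ is a stable solution of $$-\mathrm{div}(|y|^\theta\nabla w)=|y|^\beta|w|^{p-1}w\quad\text{in }\mathbb{R}^N\setminus\overline{B_{1/R}}.$$
   Context: $B_r$ is the open ball in $\mathbb{R}^N$ centered at $0$ with radius $r$. $H^{1,\theta}(\Omega)$ is the space of functions $\varphi$ with $|x|^{\theta/2}\varphi,\ |x|^{\theta/2}|\nabla\varphi|\in L^2(\Omega)$; $H^{1,\theta}_{loc}(\Omega)$ is the corresponding local space, and $H^{1,\theta}_c(\Omega)$ the subspace of functions in $H^{1,\theta}(\Omega)$ with compact support in $\Omega$. (If $0\notin\Omega$, $H^{1,\theta}_{loc}(\Omega)=H^1_{loc}(\Omega)$ and $H^{1,\theta}_c(\Omega)=H^1_c(\Omega)$.) For exponents $\theta,\lambda\in\mathbb{R}$, a function $v$ is a solution of $-\mathrm{div}(|x|^\theta\nabla v)=|x|^\lambda|v|^{p-1}v$ in $\Omega$ if $v\in H^{1,\theta}_{loc}(\Omega)\cap L^\infty_{loc}(\Omega)$ and $\int_\Omega\big(|x|^\theta\nabla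 v\cdot\nabla\phi-|x|^\lambda|v|^{p-1}v\phi\big)dx=0$ for all $\phi\in H^{1,\theta}_c(\Omega)\cap L^\infty_{loc}(\Omega)$. It is stable in $\Omega$ if $\int_\Omega\big(|x|^\theta|\nabla\psi|^2-p|x|^\lambda|v|^{p-1}\psi^2\big)dx\ge0$ for all $\psi\in H^{1,\theta}_c(\Omega)\cap L^\infty_{loc}(\Omega)$. *)

theory Defs
  imports "HOL-Analysis.Analysis"
begin

primrec C_k :: "nat \<Rightarrow> ('a::euclidean_space \<Rightarrow> real) \<Rightarrow> bool" where
  "C_k 0 f \<longleftrightarrow> continuous_on UNIV f"
| "C_k (Suc k) f \<longleftrightarrow>
     (\<forall>x. f differentiable (at x)) \<and>
     (\<forall>i\<in>Basis. C_k k (\<lambda>x. frechet_derivative f (at x) i))"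

(* The elements of C_c^infinity(Omega), extended by zero to the whole space. *)
definition test_functions :: "'a::euclidean_space set \<Rightarrow> ('a \<Rightarrow> real) set" where
  "test_functions \<Omega> =
     {\<eta>. (\<forall>k. C_k k \<eta>) \<and> compact (closure {x. \<eta> x \<noteq> 0}) \<and> closure {x. \<eta> x \<noteq> 0} \<subseteq> \<Omega>}"

(* Functions on an open set Omega are represented by total functions; only their
   values on Omega, up to Lebesgue null sets, are relevant below. *)
definition has_weak_gradient ::
  "'a::euclidean_space set \<Rightarrow> ('a \<Rightarrow> real) \<Rightarrow> ('a \<Rightarrow> 'a) \<Rightarrow> bool" where
  "has_weak_gradient \<Omega> \<phi> g \<longleftrightarrow>
     (\<forall>K. compact K \<and> K \<subseteq> \<Omega> \<longrightarrow>
        integrable (lebesgue_on K) \<phi> \<and> integrable (lebesgue_on K) g) \<and>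
     (\<forall>\<eta>\<in>test_functions \<Omega>. \<forall>i\<in>Basis.
        (LINT x|lebesgue_on \<Omega>. \<phi> x * frechet_derivative \<eta> (at x) i)
          = - (LINT x|lebesgue_on \<Omega>. (g x \<bullet> i) * \<eta> x))"

definition weakly_differentiable :: "'a::euclidean_space set \<Rightarrow> ('a \<Rightarrow> real) \<Rightarrow> bool" where
  "weakly_differentiable \<Omega> \<phi> \<longleftrightarrow> (\<exists>g. has_weak_gradient \<Omega> \<phi> g)"

(* Weak gradients are unique up to null sets, so on open sets the choice of g is immaterial. *)
definition weak_gradient :: "'a::euclidean_space set \<Rightarrow> ('a \<Rightarrow> real) \<Rightarrow> 'a \<Rightarrow> 'a" where
  "weak_gradient \<Omega> \<phi> = (SOME g. has_weak_gradient \<Omega> \<phi> g)"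

definition L2_on :: "'a::euclidean_space set \<Rightarrow> ('a \<Rightarrow> real) set" where
  "L2_on S = {f. f \<in> borel_measurable (lebesgue_on S) \<and>
                 integrable (lebesgue_on S) (\<lambda>x. (f x)\<^sup>2)}"

definition Linf_loc :: "'a::euclidean_space set \<Rightarrow> ('a \<Rightarrow> real) set" where
  "Linf_loc \<Omega> = {f. f \<in> borel_measurable (lebesgue_on \<Omega>) \<and>
     (\<forall>K. compact K \<and> K \<subseteq> \<Omega> \<longrightarrow> (\<exists>C. AE x in lebesgue_on K. \<bar>f x\<bar> \<le> C))}"

(* The weighted spaces H^{1,theta} for open sets that do not contain the origin. (If the
   origin belongs to Omega, a function with finite weighted norm need not be locally
   integrable, and weak differentiability in Omega would be an additional restriction.) *)
definition H1 :: "real \<Rightarrow> 'a::euclidean_space set \<Rightarrow> ('a \<Rightarrow> real) set" where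
  "H1 \<theta> \<Omega> = {\<phi>. weakly_differentiable \<Omega> \<phi> \<and>
     (\<lambda>x. norm x powr (\<theta> / 2) * \<phi> x) \<in> L2_on \<Omega> \<and>
     (\<lambda>x. norm x powr (\<theta> / 2) * norm (weak_gradient \<Omega> \<phi> x)) \<in> L2_on \<Omega>}"

definition H1_loc :: "real \<Rightarrow> 'a::euclidean_space set \<Rightarrow> ('a \<Rightarrow> real) set" where
  "H1_loc \<theta> \<Omega> = {\<phi>. weakly_differentiable \<Omega> \<phi> \<and>
     (\<forall>K. compact K \<and> K \<subseteq> \<Omega> \<longrightarrow>
        (\<lambda>x. norm x powr (\<theta> / 2) * \<phi> x) \<in> L2_on K \<and>
        (\<lambda>x. norm x powr (\<theta> / 2) * norm (weak_gradient \<Omega> \<phi> x)) \<in> L2_on K)}"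

definition H1_c :: "real \<Rightarrow> 'a::euclidean_space set \<Rightarrow> ('a \<Rightarrow> real) set" where
  "H1_c \<theta> \<Omega> = {\<phi> \<in> H1 \<theta> \<Omega>.
     \<exists>K. compact K \<and> K \<subseteq> \<Omega> \<and> (AE x in lebesgue_on (\<Omega> - K). \<phi> x = 0)}"

(* If the open set Omega does not contain the origin, the integrands in the next two
   definitions are integrable for all admissible test functions, so the value 0 that the
   Bochner integral assigns to non-integrable functions plays no role. *)
definition is_solution ::
  "real \<Rightarrow> real \<Rightarrow> real \<Rightarrow> 'a::euclidean_space set \<Rightarrow> ('a \<Rightarrow> real) \<Rightarrow> bool" where
  "is_solution \<theta> \<mu> p \<Omega> v \<longleftrightarrow>
     v \<in> H1_loc \<theta> \<Omega> \<inter> Linf_loc \<Omega> \<and>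
     (\<forall>\<phi> \<in> H1_c \<theta> \<Omega> \<inter> Linf_loc \<Omega>.
        (LINT x|lebesgue_on \<Omega>.
            norm x powr \<theta> * (weak_gradient \<Omega> v x \<bullet> weak_gradient \<Omega> \<phi> x)
            - norm x powr \<mu> * \<bar>v x\<bar> powr (p - 1) * v x * \<phi> x) = 0)"

definition is_stable ::
  "real \<Rightarrow> real \<Rightarrow> real \<Rightarrow> 'a::euclidean_space set \<Rightarrow> ('a \<Rightarrow> real) \<Rightarrow> bool" where
  "is_stable \<theta> \<mu> p \<Omega> v \<longleftrightarrow>
     (\<forall>\<psi> \<in> H1_c \<theta> \<Omega> \<inter> Linf_loc \<Omega>.
        (LINT x|lebesgue_on \<Omega>.
            norm x powr \<theta> * (norm (weak_gradient \<Omega> \<psi> x))\<^sup>2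
            - p * norm x powr \<mu> * \<bar>v x\<bar> powr (p - 1) * (\<psi> x)\<^sup>2) \<ge> 0)"

end

theory Submission
  imports Defs
begin

text \<open>With $m = N - 2 + \theta$, the Kelvin transform $\hat\phi(y) = |y|^{-m} \phi(y/|y|^2)$ is an
  involution that preserves admissible test functions. Since the inversion is conformal,
  the change of variables $y = x/|x|^2$ turns $\int |y|^\theta \nabla\hat u \cdot \nabla\hat\phi$ into
  $\int |x|^\theta \nabla u \cdot \nabla\phi + m \int \mathrm{div}(|x|^{\theta-2} u \phi\, x)$, and the divergence
  integrates to zero. The exponent $\beta$ is the one for which the zero-order terms correspond.
  For weak gradients, the change of variables rests on the Piola identity for the inversion; the
  product rule behind the divergence term comes from testing both functions against a mollifier
  $\rho_n(x-y)$ and applying Fubini's theorem, so that no function has to be smoothed.\<close>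

section \<open>Smooth functions and test functions\<close>

text \<open>With gu and gp the weak gradients of u and phi, differentiating the factor |y|^(-m)
  produces the cross term m |x|^(theta-2) (phi (gu . x) + u (gp . x) + m u phi). The divergence of
  |x|^(theta-2) x is (N - 2 + theta) |x|^(theta-2), so for m = N - 2 + theta this cross term is m
  times a total divergence; that is where the exponent of the transform comes from. The origin lies
  in neither domain. Powers of |x| are therefore smooth there and bounded above and below on compact
  subsets, so that locally the weighted spaces are the unweighted ones. The obstacle is regularity:
  u and phi are only locally bounded with weak gradients, and \<open>weak_gradient\<close> is some
  choice, determined up to null sets. Identities are proved for explicit weak gradients and then
  transferred by uniqueness almost everywhere. The potentials of the two quadratic forms differ by
  the factor |x|^(4 - 2 theta). This relation keeps its form when the two domains are exchanged, so
  a single implication for general domains gives both directions of the equivalence.\<close>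

primrec Ck_on :: "nat \<Rightarrow> 'a::euclidean_space set \<Rightarrow> ('a \<Rightarrow> real) \<Rightarrow> bool" where
  "Ck_on 0 S f \<longleftrightarrow> continuous_on S f"
| "Ck_on (Suc k) S f \<longleftrightarrow>
     (\<forall>x\<in>S. f differentiable (at x)) \<and>
     (\<forall>i\<in>Basis. Ck_on k S (\<lambda>x. frechet_derivative f (at x) i))"

definition smooth_on :: "'a::euclidean_space set \<Rightarrow> ('a \<Rightarrow> real) \<Rightarrow> bool" where
  "smooth_on S f \<longleftrightarrow> (\<forall>k. Ck_on k S f)"

text \<open>A version of \<open>C_k\<close> relative to a set is used because powers of the norm and
  the inversion are smooth only away from the origin, and they have to be multiplied and composed
  with test functions.\<close>

lemma C_k_eq_Ck_on: "C_k k f \<longleftrightarrow> Ck_on k UNIV f"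
  by (induction k arbitrary: f) auto

text \<open>Openness of \<open>S\<close> makes equality on \<open>S\<close> pass to the derivatives
  at points of \<open>S\<close>, hence inductively to all iterated partial derivatives.\<close>

lemma Ck_on_cong:
  assumes "open S" "\<And>x. x \<in> S \<Longrightarrow> f x = g x" "Ck_on k S f"
  shows "Ck_on k S g"
  using assms(2,3)
proof (induction k arbitrary: f g)
  case 0
  then show ?case by (simp cong: continuous_on_cong)
next
  case (Suc k)
  have der: "(g has_derivative frechet_derivative f (at x)) (at x)" if "x \<in> S" for x
  proof (rule has_derivative_transform_within_open[OF _ assms(1) that])
    show "(f has_derivative frechet_derivative f (at x)) (at x)"
      using Suc.prems that by (simp add: frechet_derivative_works[symmetric])
  qed (use Suc.prems in auto)
  then have "frechet_derivative f (at x) = frechet_derivative g (at x)" if "x \<in> S" for x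
    using frechet_derivative_at that by blast
  moreover have "Ck_on k S (\<lambda>x. frechet_derivative f (at x) i)" if "i \<in> Basis" for i
    using Suc.prems that by simp
  ultimately have "Ck_on k S (\<lambda>x. frechet_derivative g (at x) i)" if "i \<in> Basis" for i
    using Suc.IH[of "\<lambda>x. frechet_derivative f (at x) i"] that by simp
  then show ?case
    using der by (auto simp: differentiable_def)
qed

text \<open>Lets an induction step work with an explicitly computed derivative instead of
  \<open>frechet_derivative\<close>.\<close>

lemma Ck_on_SucI:
  assumes "open S" "\<And>x. x \<in> S \<Longrightarrow> (f has_derivative f' x) (at x)"
    and "\<And>i. i \<in> Basis \<Longrightarrow> Ck_on k S (\<lambda>x. f' x i)"
  shows "Ck_on (Suc k) S f"
proof -
  have "frechet_derivative f (at x) = f' x" if "x \<in> S" for x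
    using assms(2) frechet_derivative_at that by metis
  then have "Ck_on k S (\<lambda>x. frechet_derivative f (at x) i)" if "i \<in> Basis" for i
    using Ck_on_cong[OF assms(1) _ assms(3)] that by simp
  then show ?thesis
    using assms(2) by (auto simp: differentiable_def)
qed

lemma Ck_on_has_derivative:
  "Ck_on (Suc k) S f \<Longrightarrow> x \<in> S \<Longrightarrow> (f has_derivative frechet_derivative f (at x)) (at x)"
  by (simp add: frechet_derivative_works)

lemma Ck_on_imp_continuous_on: "Ck_on k S f \<Longrightarrow> continuous_on S f"
  by (cases k) (auto intro!: continuous_at_imp_continuous_on differentiable_imp_continuous_within)

lemma Ck_on_pred: "Ck_on (Suc k) S f \<Longrightarrow> Ck_on k S f"
proof (induction k arbitrary: f)
  case 0
  then show ?case using Ck_on_imp_continuous_on by fastforce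
qed auto

lemma Ck_on_subset: "Ck_on k S f \<Longrightarrow> T \<subseteq> S \<Longrightarrow> Ck_on k T f"
  by (induction k arbitrary: f) (auto intro: continuous_on_subset)

lemma Ck_on_Un:
  "open S \<Longrightarrow> open T \<Longrightarrow> Ck_on k S f \<Longrightarrow> Ck_on k T f \<Longrightarrow> Ck_on k (S \<union> T) f"
  by (induction k arbitrary: f) (auto intro: continuous_on_open_Un)

lemma Ck_on_const: "Ck_on k S (\<lambda>x. c)"
  by (induction k arbitrary: c) (auto simp: frechet_derivative_const)

lemma Ck_on_inner: 
  assumes "open S" shows "Ck_on k S (\<lambda>x. x \<bullet> c)"
proof (cases k)
  case (Suc l)
  have "((\<lambda>x. x \<bullet> c) has_derivative (\<lambda>h. h \<bullet> c)) (at x)" for x :: 'a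
    by (auto intro!: derivative_eq_intros)
  then show ?thesis
    using Ck_on_SucI[OF assms, of "\<lambda>x. x \<bullet> c" "\<lambda>x h. h \<bullet> c"] Ck_on_const Suc by metis
qed (auto intro!: continuous_intros)

lemma Ck_on_add:
  assumes "open S"
  shows "Ck_on k S f \<Longrightarrow> Ck_on k S g \<Longrightarrow> Ck_on k S (\<lambda>x. f x + g x)"
proof (induction k arbitrary: f g)
  case (Suc k)
  show ?case
    by (rule Ck_on_SucI[OF assms has_derivative_add[OF Ck_on_has_derivative[OF Suc.prems(1)]
            Ck_on_has_derivative[OF Suc.prems(2)]]])
      (use Suc in auto)
qed (auto intro!: continuous_intros)

lemma Ck_on_mult:
  assumes "open S"
  shows "Ck_on k S f \<Longrightarrow> Ck_on k S g \<Longrightarrow> Ck_on k S (\<lambda>x. f x * g x)"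
proof (induction k arbitrary: f g)
  case (Suc k)
  have "Ck_on k S f" "Ck_on k S g"
    using Suc.prems Ck_on_pred by auto
  then show ?case
    by (intro Ck_on_SucI[OF assms has_derivative_mult[OF Ck_on_has_derivative[OF Suc.prems(1)]
            Ck_on_has_derivative[OF Suc.prems(2)]]])
      (use Suc in \<open>auto intro!: Ck_on_add[OF assms]\<close>)
qed (auto intro!: continuous_intros)

lemma Ck_on_sum:
  assumes "open S" "\<And>i. i \<in> I \<Longrightarrow> Ck_on k S (f i)"
  shows "Ck_on k S (\<lambda>x. \<Sum>i\<in>I. f i x)"
  using assms(2)
  by (induction I rule: infinite_finite_induct) (auto intro!: Ck_on_const Ck_on_add[OF assms(1)])

text \<open>Induction on \<open>k\<close> with \<open>f\<close> generalised: by the chain rule a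
  partial derivative of the composition is a sum of products of partials of the components of
  \<open>G\<close> with partials of \<open>f\<close> evaluated at \<open>G x\<close>, and the
  induction hypothesis covers the latter. \<open>G\<close> enters through its components because
  \<open>Ck_on\<close> speaks of real-valued functions.\<close>

lemma Ck_on_compose:
  fixes f :: "'b::euclidean_space \<Rightarrow> real" and G :: "'a::euclidean_space \<Rightarrow> 'b"
  assumes S: "open S" and T: "open T" and GS: "\<And>x. x \<in> S \<Longrightarrow> G x \<in> T"
  shows "Ck_on k T f \<Longrightarrow> (\<And>j. j \<in> Basis \<Longrightarrow> Ck_on k S (\<lambda>x. G x \<bullet> j)) \<Longrightarrow> Ck_on k S (\<lambda>x. f (G x))"
proof (induction k arbitrary: f)
  case 0
  have "continuous_on S G"
    using 0(2) continuous_on_componentwise by fastforce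
  then show ?case
    using 0(1) continuous_on_compose2[of T f S G] GS by auto
next
  case (Suc k)
  define D where "D x h = (\<Sum>j\<in>Basis. frechet_derivative (\<lambda>x. G x \<bullet> j) (at x) h *\<^sub>R j)" for x h
  have DG: "(G has_derivative D x) (at x)" if "x \<in> S" for x
    unfolding has_derivative_componentwise_within[of G] D_def
    using Ck_on_has_derivative[OF Suc.prems(2) that] by simp
  have df: "(f has_derivative frechet_derivative f (at (G x))) (at (G x))" if "x \<in> S" for x
    using Ck_on_has_derivative[OF Suc.prems(1)] GS[OF that] by auto
  show ?case
  proof (rule Ck_on_SucI[OF S has_derivative_compose[OF DG df]])
    fix i :: 'a assume i: "i \<in> Basis"
    have "frechet_derivative f (at (G x)) (D x i) = (\<Sum>j\<in>Basis. frechet_derivative (\<lambda>x. G x \<bullet> j) (at x) i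
        * frechet_derivative f (at (G x)) j)" if "x \<in> S" for x
      by (simp add: D_def linear_sum[OF has_derivative_linear[OF df[OF that]]]
        linear_cmul[OF has_derivative_linear[OF df[OF that]]])
    moreover have "Ck_on k S (\<lambda>x. \<Sum>j\<in>Basis. frechet_derivative (\<lambda>x. G x \<bullet> j) (at x) i
        * frechet_derivative f (at (G x)) j)"
    proof (intro Ck_on_sum[OF S] Ck_on_mult[OF S])
      fix j :: 'b assume j: "j \<in> Basis"
      show "Ck_on k S (\<lambda>x. frechet_derivative (\<lambda>x. G x \<bullet> j) (at x) i)"
        using Suc.prems(2)[OF j] i by simp
      show "Ck_on k S (\<lambda>x. frechet_derivative f (at (G x)) j)"
        by (rule Suc.IH[of "\<lambda>y. frechet_derivative f (at y) j"])
          (use Suc.prems(1) j in simp, use Ck_on_pred[OF Suc.prems(2)] in blast)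
    qed
    ultimately show "Ck_on k S (\<lambda>x. frechet_derivative f (at (G x)) (D x i))"
      by (subst Ck_on_cong[OF S]) auto
  qed auto
qed

section \<open>Smoothness of powers of the norm away from the origin\<close>

lemma has_derivative_norm_powr:
  fixes x :: "'a::euclidean_space"
  assumes "x \<noteq> 0"
  shows "((\<lambda>x. norm x powr a) has_derivative (\<lambda>h. a * norm x powr (a - 2) * (x \<bullet> h))) (at x)"
proof -
  \<comment> \<open>A power of the norm is a power of the quadratic polynomial
    \<open>x \<bullet> x\<close>, whose derivative is immediate.\<close>
  have e: "norm y powr b = (y \<bullet> y) powr (b / 2)" for y :: 'a and b
    by (cases "y = 0") (simp_all add: dot_square_norm powr_powr flip: powr_numeral)
  have "((\<lambda>x. (x \<bullet> x) powr (a / 2)) has_derivative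
      (\<lambda>h. (x \<bullet> x) powr (a / 2) * (2 * (x \<bullet> h) * (a / 2) / (x \<bullet> x)))) (at x)"
    using assms by (auto intro!: derivative_eq_intros simp: inner_commute)
  moreover have "(x \<bullet> x) powr ((a - 2) / 2) = (x \<bullet> x) powr (a / 2) / (x \<bullet> x)"
    using assms by (simp add: diff_divide_distrib powr_diff)
  ultimately show ?thesis
    unfolding e by (simp add: mult_ac)
qed

text \<open>A partial derivative of a power of the norm is a coordinate times another power of the
  norm, so the induction closes once the exponent is generalised.\<close>

lemma Ck_on_norm_powr: "Ck_on k (- {0::'a::euclidean_space}) (\<lambda>x. norm x powr a)"
proof (induction k arbitrary: a)
  case (Suc k)
  have o: "open (- {0::'a})" by auto
  show ?case
    by (rule Ck_on_SucI[OF o has_derivative_norm_powr]) 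
      (auto intro!: Ck_on_mult[OF o] Suc Ck_on_const Ck_on_inner[OF o])
qed (auto intro!: continuous_intros)

lemma smooth_on_const: "smooth_on S (\<lambda>x. c)"
  by (simp add: smooth_on_def Ck_on_const)

lemma smooth_on_inner: "open S \<Longrightarrow> smooth_on S (\<lambda>x. x \<bullet> c)"
  by (simp add: smooth_on_def Ck_on_inner)

lemma smooth_on_add: "open S \<Longrightarrow> smooth_on S f \<Longrightarrow> smooth_on S g \<Longrightarrow> smooth_on S (\<lambda>x. f x + g x)"
  by (simp add: smooth_on_def Ck_on_add)

lemma smooth_on_mult: "open S \<Longrightarrow> smooth_on S f \<Longrightarrow> smooth_on S g \<Longrightarrow> smooth_on S (\<lambda>x. f x * g x)"
  by (simp add: smooth_on_def Ck_on_mult)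

lemma smooth_on_diff: "open S \<Longrightarrow> smooth_on S f \<Longrightarrow> smooth_on S g \<Longrightarrow> smooth_on S (\<lambda>x. f x - g x)"
  using smooth_on_add[of S f "\<lambda>x. (-1) * g x"] smooth_on_mult[of S "\<lambda>x. -1" g]
    smooth_on_const[of S "-1"] by simp

lemma smooth_on_norm_powr:
  fixes S :: "'a::euclidean_space set"
  shows "0 \<notin> S \<Longrightarrow> smooth_on S (\<lambda>x. norm x powr a)"
  unfolding smooth_on_def using Ck_on_subset[OF Ck_on_norm_powr] by blast

lemma smooth_on_compose:
  assumes "open S" "open T" "\<And>x. x \<in> S \<Longrightarrow> G x \<in> T" "smooth_on T f"
    and "\<And>j. j \<in> Basis \<Longrightarrow> smooth_on S (\<lambda>x. G x \<bullet> j)"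
  shows "smooth_on S (\<lambda>x. f (G x))"
proof -
  have "Ck_on k S (\<lambda>x. f (G x))" for k
    by (rule Ck_on_compose[OF assms(1,2)]) (use assms(3-5) in \<open>simp_all add: smooth_on_def\<close>)
  then show ?thesis by (simp add: smooth_on_def)
qed

lemma smooth_on_has_derivative:
  "smooth_on S f \<Longrightarrow> x \<in> S \<Longrightarrow> (f has_derivative frechet_derivative f (at x)) (at x)"
proof (rule Ck_on_has_derivative[of 0])
  assume "smooth_on S f"
  then show "Ck_on (Suc 0) S f"
    unfolding smooth_on_def by (rule spec)
qed

lemma smooth_on_partial:
  "smooth_on S f \<Longrightarrow> i \<in> Basis \<Longrightarrow> smooth_on S (\<lambda>x. frechet_derivative f (at x) i)"
  unfolding smooth_on_def using Ck_on.simps(2) by blast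

lemma smooth_on_continuous_on: "smooth_on S f \<Longrightarrow> continuous_on S f"
  unfolding smooth_on_def using Ck_on_imp_continuous_on by blast

lemma smooth_on_subset: "smooth_on S f \<Longrightarrow> T \<subseteq> S \<Longrightarrow> smooth_on T f"
  unfolding smooth_on_def using Ck_on_subset by blast

lemma smooth_on_cong:
  "open S \<Longrightarrow> (\<And>x. x \<in> S \<Longrightarrow> f x = g x) \<Longrightarrow> smooth_on S f \<Longrightarrow> smooth_on S g"
  unfolding smooth_on_def using Ck_on_cong by metis

text \<open>The powers of $t$ in the denominator make the family closed under differentiation.\<close>

definition flat_exp :: "nat \<Rightarrow> real \<Rightarrow> real" where
  "flat_exp n t = (if t > 0 then exp (- 1 / t) / t ^ n else 0)"

lemma flat_exp_tendsto_0: "(flat_exp n \<longlongrightarrow> 0) (at 0)"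
proof -
  have "(flat_exp n \<longlongrightarrow> 0) (at_right 0)"
  proof (rule Lim_transform_eventually)
    \<comment> \<open>The substitution \<open>s = 1 / t\<close> turns the limit at 0 from the right
      into the decay of \<open>s ^ n / exp s\<close> at infinity.\<close>
    have "((\<lambda>s::real. s ^ n / exp s) \<longlongrightarrow> 0) at_top"
      by (rule tendsto_power_div_exp_0)
    then have "((\<lambda>t::real. inverse t ^ n / exp (inverse t)) \<longlongrightarrow> 0) (at_right 0)"
      using filterlim_compose filterlim_inverse_at_top_right by blast
    then show "((\<lambda>t::real. exp (- 1 / t) / t ^ n) \<longlongrightarrow> 0) (at_right 0)"
      by (simp add: exp_minus divide_simps power_inverse mult.commute)
    show "\<forall>\<^sub>F x in at_right 0. exp (- 1 / x) / x ^ n = flat_exp n x"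
      by (auto simp: flat_exp_def eventually_at_right_less intro: eventually_at_rightI[of 0 1])
  qed
  moreover have "(flat_exp n \<longlongrightarrow> 0) (at_left 0)"
    by (rule Lim_transform_eventually[OF tendsto_const])
      (auto simp: flat_exp_def eventually_at_filter)
  ultimately show ?thesis
    by (simp add: filterlim_split_at)
qed

lemma flat_exp_has_derivative:
  "(flat_exp n has_real_derivative (flat_exp (n + 2) t - real n * flat_exp (n + 1) t)) (at t)"
proof -
  consider "t > 0" | "t = 0" | "t < 0" by linarith
  then show ?thesis
  proof cases
    case 1
    have "((\<lambda>t. exp (- 1 / t) / t ^ n) has_real_derivative
        (exp (- 1 / t) * (1 / (t * t)) * t ^ n - exp (- 1 / t) * (real n * t ^ (n - 1))) / (t ^ n * t ^ n)) (at t)"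
      using 1 by (auto intro!: derivative_eq_intros)
    moreover have "(exp (- 1 / t) * (1 / (t * t)) * t ^ n - exp (- 1 / t) * (real n * t ^ (n - 1))) / (t ^ n * t ^ n)
        = flat_exp (n + 2) t - real n * flat_exp (n + 1) t"
      using 1 by (cases n) (simp_all add: flat_exp_def field_simps)
    ultimately have "((\<lambda>t. exp (- 1 / t) / t ^ n) has_real_derivative
        (flat_exp (n + 2) t - real n * flat_exp (n + 1) t)) (at t)"
      by simp
    then show ?thesis
      by (rule has_field_derivative_transform_within_open[of _ _ _ "{0<..}"])
        (use 1 in \<open>auto simp: flat_exp_def\<close>)
  next
    case 2
    \<comment> \<open>The difference quotient of \<open>flat_exp n\<close> at 0 is
      \<open>flat_exp (Suc n)\<close>, whose limit is 0.\<close>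
    have "((\<lambda>h. (flat_exp n (0 + h) - flat_exp n 0) / h) \<longlongrightarrow> 0) (at 0)"
      by (rule Lim_transform_eventually[OF flat_exp_tendsto_0[of "Suc n"]])
        (auto simp: flat_exp_def eventually_at_filter)
    then show ?thesis
      using 2 by (simp add: DERIV_def flat_exp_def)
  next
    case 3
    have "(flat_exp n has_real_derivative 0) (at t)"
      by (rule has_field_derivative_transform_within_open[of "\<lambda>t. 0" 0 _ "{..<0}"])
        (use 3 in \<open>auto simp: flat_exp_def\<close>)
    then show ?thesis
      using 3 by (simp add: flat_exp_def)
  qed
qed

lemma smooth_on_flat_exp: "smooth_on UNIV (flat_exp n)"
proof -
  have "Ck_on k UNIV (flat_exp n)" for k
  proof (induction k arbitrary: n)
    case 0
    then show ?case
      using DERIV_isCont[OF flat_exp_has_derivative] by (auto intro!: continuous_at_imp_continuous_on)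
  next
    case (Suc k)
    have "Ck_on k UNIV (\<lambda>t. flat_exp (n + 2) t + (- real n) * flat_exp (n + 1) t)"
      by (intro Ck_on_add Ck_on_mult Ck_on_const Suc) auto
    then show ?case
      by (intro Ck_on_SucI[OF _ flat_exp_has_derivative[of n, unfolded has_field_derivative_def]]) auto
  qed
  then show ?thesis by (simp add: smooth_on_def)
qed

section \<open>Test functions\<close>

lemma test_functionsI:
  assumes "open \<Omega>" "compact K" "K \<subseteq> \<Omega>" "smooth_on \<Omega> f" "\<And>x. x \<notin> K \<Longrightarrow> f x = 0"
  shows "f \<in> test_functions \<Omega>"
proof -
  have cl: "closure {x. f x \<noteq> 0} \<subseteq> K"
    using assms compact_imp_closed by (intro closure_minimal) auto
  \<comment> \<open>Extension by zero: \<open>\<Omega>\<close> and the complement of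
    \<open>K\<close> are open and cover the space, and \<open>f\<close> is smooth on the first and
    zero on the second.\<close>
  have "Ck_on k (\<Omega> \<union> (- K)) f" for k
  proof (rule Ck_on_Un)
    show o: "open (- K)"
      using assms compact_imp_closed by blast
    show "Ck_on k (- K) f"
      by (rule Ck_on_cong[OF o _ Ck_on_const[of _ _ 0]]) (use assms in auto)
  qed (use assms in \<open>auto simp: smooth_on_def\<close>)
  moreover have "\<Omega> \<union> (- K) = UNIV"
    using assms by auto
  ultimately show ?thesis
    using cl assms(2,3) compact_Int_closed[of K "closure {x. f x \<noteq> 0}"] Int_absorb2[OF cl]
    unfolding test_functions_def C_k_eq_Ck_on by (auto simp: inf_commute)
qed

lemma test_functions_smooth: "\<eta> \<in> test_functions \<Omega> \<Longrightarrow> smooth_on UNIV \<eta>"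
  unfolding test_functions_def smooth_on_def by (auto simp: C_k_eq_Ck_on)

lemma test_functions_support:
  assumes "\<eta> \<in> test_functions \<Omega>"
  obtains K where "compact K" "K \<subseteq> \<Omega>" "\<And>x. x \<notin> K \<Longrightarrow> \<eta> x = 0"
    "\<And>x. x \<notin> K \<Longrightarrow> frechet_derivative \<eta> (at x) = (\<lambda>h. 0)"
proof
  let ?K = "closure {x. \<eta> x \<noteq> 0}"
  show "compact ?K" "?K \<subseteq> \<Omega>" using assms by (auto simp: test_functions_def)
  show z: "\<eta> x = 0" if "x \<notin> ?K" for x
    using that closure_subset[of "{x. \<eta> x \<noteq> 0}"] by auto
  show "frechet_derivative \<eta> (at x) = (\<lambda>h. 0)" if "x \<notin> ?K" for x
  proof -
    have "(\<eta> has_derivative (\<lambda>h. 0)) (at x)"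
    proof (rule has_derivative_transform_within_open[OF has_derivative_const[of 0]])
      show "open (- ?K)" "x \<in> - ?K" using that by auto
    qed (metis z Compl_iff)
    then show ?thesis
      using frechet_derivative_at by metis
  qed
qed

lemma test_functions_mult:
  assumes "open \<Omega>" "\<eta> \<in> test_functions \<Omega>" "smooth_on \<Omega> f"
  shows "(\<lambda>x. f x * \<eta> x) \<in> test_functions \<Omega>"
proof -
  obtain K where K: "compact K" "K \<subseteq> \<Omega>" "\<And>x. x \<notin> K \<Longrightarrow> \<eta> x = 0"
    using test_functions_support[OF assms(2)] by metis
  then show ?thesis
    using smooth_on_subset[OF test_functions_smooth[OF assms(2)]] assms
    by (intro test_functionsI[OF _ K(1,2)] smooth_on_mult) auto
qed

lemma test_functions_subset: "\<eta> \<in> test_functions S \<Longrightarrow> S \<subseteq> T \<Longrightarrow> \<eta> \<in> test_functions T"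
  by (auto simp: test_functions_def)

section \<open>Mollifiers\<close>

text \<open>Fubini's theorem is applied to the completed measure \<open>lebesgue\<close> itself,
  because weak gradients are only Lebesgue measurable.\<close>

lemma sigma_finite_lebesgue: "sigma_finite_measure (lebesgue :: 'a::euclidean_space measure)"
proof
  show "\<exists>A::'a set set. countable A \<and> A \<subseteq> sets lebesgue \<and> \<Union> A = space lebesgue \<and> (\<forall>a\<in>A. emeasure lebesgue a \<noteq> \<infinity>)"
  proof (intro exI conjI ballI)
    show "\<Union> (range (\<lambda>n::nat. ball (0::'a) (real n))) = space lebesgue"
      using reals_Archimedean2 by (auto simp: mem_ball_0)
    show "emeasure lebesgue a \<noteq> \<infinity>" if "a \<in> range (\<lambda>n::nat. ball (0::'a) (real n))" for a
      using that emeasure_bounded_finite[OF bounded_ball, of "0::'a"] by (auto simp: less_top[symmetric])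
  qed auto
qed

lemma integral_abs_le_AE:
  fixes f g :: "'a \<Rightarrow> real"
  assumes "integrable M g" "AE x in M. \<bar>f x\<bar> \<le> g x"
  shows "\<bar>integral\<^sup>L M f\<bar> \<le> integral\<^sup>L M g"
proof -
  have "AE x in M. 0 \<le> g x"
    using assms(2) by eventually_elim linarith
  then have "(LINT x|M. \<bar>f x\<bar>) \<le> integral\<^sup>L M g"
    by (rule integral_mono_AE'[OF assms])
  then show ?thesis
    using integral_abs_bound[of M f] by linarith
qed

section \<open>Density of bounded continuous functions in L1\<close>

lemma L1_dense_indicator:
  fixes A :: "'a::euclidean_space set"
  assumes A: "A \<in> sets lebesgue" "emeasure lebesgue A < \<infinity>" and e: "e > 0"
  shows "\<exists>g. continuous_on UNIV g \<and> bounded (range g) \<and> integrable lebesgue g \<and>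
    (LINT x|lebesgue. \<bar>indicator A x - g x\<bar>) < (e::real)"
proof -
  obtain T where T: "open T" "A \<subseteq> T" "T - A \<in> lmeasurable" "emeasure lebesgue (T - A) < ennreal (e / 2)"
    using sets_lebesgue_outer_open[OF A(1), of "e / 2"] e by auto
  have Al: "A \<in> lmeasurable" using A by (simp add: fmeasurable_def)
  have "T = A \<union> (T - A)" using T by auto
  then have Tl: "T \<in> lmeasurable" using Al T(3) fmeasurable.Un by metis
  \<comment> \<open>The value of \<open>infdist\<close> at the empty set is 0 by convention, which
    would make the approximants below vanish; finite measure of \<open>T\<close> rules this case
    out.\<close>
  have ne: "- T \<noteq> {}"
  proof
    assume "- T = {}"
    then have "T = UNIV" by auto
    then show False using Tl by (simp add: fmeasurable_def)
  qed
  have intT: "integrable lebesgue (indicat_real T)" and intTA: "integrable lebesgue (indicat_real (T - A))"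
    using Tl T(3) by (auto simp: fmeasurable_def integrable_indicator_iff)
  \<comment> \<open>Continuous functions between 0 and the indicator of the open set
    \<open>T\<close>. They reach the value 1 at every point of \<open>T\<close> once
    \<open>n\<close> is large, so dominated convergence gives convergence in L1.\<close>
  define g :: "nat \<Rightarrow> 'a \<Rightarrow> real" where "g n x = min 1 (real n * infdist x (- T))" for n x
  have gc: "continuous_on UNIV (g n)" for n
    unfolding g_def by (intro continuous_intros)
  have g01: "0 \<le> g n x" "g n x \<le> 1" for n x
    unfolding g_def by (auto simp: infdist_nonneg)
  have gT: "g n x \<le> indicator T x" for n x
    using g01[of n x] by (cases "x \<in> T") (auto simp: g_def)
  have gm: "g n \<in> borel_measurable lebesgue" for n
    using borel_measurable_continuous_onI[OF gc] by (simp add: measurable_completion)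
  have gi: "integrable lebesgue (g n)" for n
    by (rule Bochner_Integration.integrable_bound[OF intT gm]) (use gT g01 in auto)
  have lim: "(\<lambda>n. LINT x|lebesgue. \<bar>indicat_real T x - g n x\<bar>) \<longlonglongrightarrow> (LINT x::'a|lebesgue. 0)"
  proof (rule integral_dominated_convergence[where w = "indicat_real T"])
    show "AE x in lebesgue. (\<lambda>n. \<bar>indicat_real T x - g n x\<bar>) \<longlonglongrightarrow> 0"
    proof (rule AE_I2)
      fix x
      have "\<forall>\<^sub>F n in sequentially. \<bar>indicat_real T x - g n x\<bar> = 0"
      proof (cases "x \<in> T")
        case True
        then have "infdist x (- T) > 0"
          using ne T(1) in_closed_iff_infdist_zero[of "- T" x] infdist_nonneg[of x "- T"]
          by (auto simp: closed_def less_le)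
        then obtain N where "real N * infdist x (- T) > 1"
          using reals_Archimedean3 by blast
        then have "real n * infdist x (- T) > 1" if "n \<ge> N" for n
          using that \<open>infdist x (- T) > 0\<close> by (smt (verit) mult_right_mono of_nat_le_iff)
        then show ?thesis
          using True by (auto simp: g_def eventually_sequentially intro!: exI[of _ N] min.absorb1 less_imp_le)
      next
        case False
        then show ?thesis using gT g01 by (auto simp: g_def)
      qed
      then show "(\<lambda>n. \<bar>indicat_real T x - g n x\<bar>) \<longlonglongrightarrow> 0"
        by (rule tendsto_eventually)
    qed
    show "AE x in lebesgue. norm \<bar>indicat_real T x - g n x\<bar> \<le> indicat_real T x" for n
    proof (rule AE_I2)
      show "norm \<bar>indicat_real T x - g n x\<bar> \<le> indicat_real T x" for x
        using gT[of n x] g01[of n x] by simp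
    qed
  qed (use intT gi in auto)
  then obtain n where n: "(LINT x|lebesgue. \<bar>indicat_real T x - g n x\<bar>) < e / 2"
    using order_tendstoD(2)[OF lim, of "e / 2"] e by (auto simp: eventually_sequentially)
  have "(LINT x|lebesgue. \<bar>indicat_real A x - g n x\<bar>)
    \<le> (LINT x|lebesgue. indicat_real (T - A) x + \<bar>indicat_real T x - g n x\<bar>)"
  proof (rule integral_mono)
    show "integrable lebesgue (\<lambda>x. \<bar>indicat_real A x - g n x\<bar>)"
      using Al gi by (intro integrable_abs Bochner_Integration.integrable_diff)
        (auto simp: fmeasurable_def integrable_indicator_iff simp del: emeasure_completion)
    show "integrable lebesgue (\<lambda>x. indicat_real (T - A) x + \<bar>indicat_real T x - g n x\<bar>)"
      using intT intTA gi by (intro integrable_abs Bochner_Integration.integrable_diff Bochner_Integration.integrable_add)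
    show "\<bar>indicat_real A x - g n x\<bar> \<le> indicat_real (T - A) x + \<bar>indicat_real T x - g n x\<bar>" for x
      using T(2) by (auto simp: indicator_def)
  qed
  also have "\<dots> = measure lebesgue (T - A) + (LINT x|lebesgue. \<bar>indicat_real T x - g n x\<bar>)"
    using intT intTA gi by (subst Bochner_Integration.integral_add) auto
  also have "measure lebesgue (T - A) < e / 2"
    using T(4) emeasure_eq_measure2[OF T(3)] e by (simp add: ennreal_less_iff del: emeasure_completion)
  also note n
  finally have "(LINT x|lebesgue. \<bar>indicat_real A x - g n x\<bar>) < e"
    by simp
  then show ?thesis
    using gc gi g01 by (intro exI[of _ "g n"]) (auto simp: bounded_iff intro!: exI[of _ 1])
qed

lemma L1_dense_continuous:
  fixes f :: "'a::euclidean_space \<Rightarrow> real"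
  assumes "integrable lebesgue f" "e > 0"
  shows "\<exists>g. continuous_on UNIV g \<and> bounded (range g) \<and> integrable lebesgue g \<and>
    (LINT x|lebesgue. \<bar>f x - g x\<bar>) < e"
  using assms
proof (induction f arbitrary: e rule: integrable_induct)
  case (base A c)
  \<comment> \<open>Dividing by \<open>\<bar>c\<bar> + 1\<close> rather than by
    \<open>\<bar>c\<bar>\<close> covers the case \<open>c = 0\<close>.\<close>
  obtain g where g: "continuous_on UNIV g" "bounded (range g)" "integrable lebesgue g"
    "(LINT x|lebesgue. \<bar>indicator A x - g x\<bar>) < e / (\<bar>c\<bar> + 1)"
    using L1_dense_indicator[OF base(1,2), of "e / (\<bar>c\<bar> + 1)"] base(3) by auto
  have "(LINT x|lebesgue. \<bar>indicator A x *\<^sub>R c - c * g x\<bar>) = (LINT x|lebesgue. \<bar>c\<bar> * \<bar>indicator A x - g x\<bar>)"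
    by (intro Bochner_Integration.integral_cong) (auto simp: algebra_simps simp flip: abs_mult)
  also have "\<dots> = \<bar>c\<bar> * (LINT x|lebesgue. \<bar>indicator A x - g x\<bar>)"
    by simp
  also have "\<dots> \<le> \<bar>c\<bar> * (e / (\<bar>c\<bar> + 1))"
    using g(4) by (intro mult_left_mono) auto
  also have "\<dots> < e"
    using base(3) by (simp add: field_simps add_nonneg_pos)
  finally show ?case
    using g by (intro exI[of _ "\<lambda>x. c * g x"])
      (auto intro!: continuous_intros bounded_scaleR_comp[of g UNIV, unfolded real_scaleR_def])
next
  case (add f g)
  obtain f' where f: "continuous_on UNIV f'" "bounded (range f')" "integrable lebesgue f'"
    "(LINT x|lebesgue. \<bar>f x - f' x\<bar>) < e / 2" using add(3)[of "e / 2"] add.prems by auto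
  obtain g' where g: "continuous_on UNIV g'" "bounded (range g')" "integrable lebesgue g'"
    "(LINT x|lebesgue. \<bar>g x - g' x\<bar>) < e / 2" using add(4)[of "e / 2"] add.prems by auto
  have "(LINT x|lebesgue. \<bar>(f x + g x) - (f' x + g' x)\<bar>)
     \<le> (LINT x|lebesgue. \<bar>f x - f' x\<bar> + \<bar>g x - g' x\<bar>)"
    using add(1,2) f(3) g(3) by (intro integral_mono) auto
  also have "\<dots> < e"
    using add(1,2) f(3,4) g(3,4) by (subst Bochner_Integration.integral_add) auto
  finally show ?case
    using f g by (intro exI[of _ "\<lambda>x. f' x + g' x"]) (auto intro!: continuous_intros bounded_plus_comp)
next
  case (lim f s)
  have "(\<lambda>i. LINT x|lebesgue. \<bar>s i x - f x\<bar>) \<longlonglongrightarrow> (LINT x::'a|lebesgue. 0)"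
  \<comment> \<open>The induction rule supplies approximants \<open>s i\<close> bounded by twice
    \<open>\<bar>f\<bar>\<close>; the difference to \<open>f\<close> accounts for the third
    multiple.\<close>
  proof (rule integral_dominated_convergence[where w = "\<lambda>x. 3 * \<bar>f x\<bar>"])
    show "AE x in lebesgue. (\<lambda>i. \<bar>s i x - f x\<bar>) \<longlonglongrightarrow> 0"
      using lim(2) by (intro AE_I2) (simp add: LIM_zero tendsto_rabs_zero)
    show "AE x in lebesgue. norm \<bar>s i x - f x\<bar> \<le> 3 * \<bar>f x\<bar>" for i
      using lim(3)[of _ i] by (intro AE_I2) (force simp: abs_real_def split: if_splits)
  qed (use lim in auto)
  then have "\<forall>\<^sub>F i in sequentially. (LINT x|lebesgue. \<bar>s i x - f x\<bar>) < e / 2"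
    using order_tendstoD(2)[of _ _ sequentially "e / 2"] lim.prems by auto
  then obtain i where i: "(LINT x|lebesgue. \<bar>s i x - f x\<bar>) < e / 2"
    by (auto simp: eventually_sequentially)
  obtain g where g: "continuous_on UNIV g" "bounded (range g)" "integrable lebesgue g"
    "(LINT x|lebesgue. \<bar>s i x - g x\<bar>) < e / 2" using lim(5)[of "e / 2" i] lim.prems by auto
  have "(LINT x|lebesgue. \<bar>f x - g x\<bar>) \<le> (LINT x|lebesgue. \<bar>s i x - f x\<bar> + \<bar>s i x - g x\<bar>)"
    using lim(1,4) g(3) by (intro integral_mono) auto
  also have "\<dots> < e"
    using lim(1,4) g(3,4) i by (subst Bochner_Integration.integral_add) auto
  finally show ?case using g by blast
qed

section \<open>Convolution with a bounded continuous kernel\<close>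

lemma integrable_convolution_kernel:
  fixes f g k :: "'a::euclidean_space \<Rightarrow> real"
  assumes f: "integrable lebesgue f" and g: "integrable lebesgue g"
    and k: "continuous_on UNIV k" and C: "\<And>x. \<bar>k x\<bar> \<le> C"
  shows "integrable (lebesgue \<Otimes>\<^sub>M lebesgue) (\<lambda>(x, y). f x * (k (x - y) * g y))"
proof -
  interpret L: sigma_finite_measure "lebesgue :: 'a measure" by (rule sigma_finite_lebesgue)
  interpret P: pair_sigma_finite "lebesgue :: 'a measure" "lebesgue :: 'a measure" ..
  have [measurable]: "f \<in> borel_measurable lebesgue" "g \<in> borel_measurable lebesgue" "k \<in> borel_measurable borel"
    using f g k by (auto intro: borel_measurable_continuous_onI)
  have [measurable]: "(\<lambda>x. x) \<in> lebesgue \<rightarrow>\<^sub>M (borel :: 'a measure)"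
    by (simp add: measurable_completion)
  have 1: "integrable (lebesgue \<Otimes>\<^sub>M lebesgue) (\<lambda>(x, y). f x * g y)"
    by (rule P.Fubini_integrable) (use f g in \<open>auto simp: abs_mult\<close>)
  have [measurable]: "(\<lambda>(x, y). f x * (k (x - y) * g y)) \<in> borel_measurable (lebesgue \<Otimes>\<^sub>M lebesgue)"
    by measurable
  have "C \<ge> 0" using C[of 0] by linarith
  then have "\<bar>f x * (k (x - y) * g y)\<bar> \<le> C * \<bar>f x * g y\<bar>" for x y
    using mult_right_mono[OF C[of "x - y"], of "\<bar>f x * g y\<bar>"] by (simp add: abs_mult mult_ac)
  then show ?thesis
    using 1 \<open>C \<ge> 0\<close>
    by (intro Bochner_Integration.integrable_bound[OF integrable_mult_right[OF 1, of C]]) (auto simp: abs_mult)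
qed

text \<open>The kernel is a general one because the rule is applied to the mollifier as well as to
  its partial derivatives.\<close>

lemma Fubini_convolution:
  fixes f g k :: "'a::euclidean_space \<Rightarrow> real"
  assumes f: "integrable lebesgue f" and g: "integrable lebesgue g"
    and k: "continuous_on UNIV k" and C: "\<And>x. \<bar>k x\<bar> \<le> C"
  shows "(LINT x|lebesgue. f x * (LINT y|lebesgue. k (x - y) * g y))
      = (LINT y|lebesgue. g y * (LINT x|lebesgue. k (x - y) * f x))"
    and "integrable lebesgue (\<lambda>x. f x * (LINT y|lebesgue. k (x - y) * g y))"
    and "integrable lebesgue (\<lambda>y. g y * (LINT x|lebesgue. k (x - y) * f x))"
proof -
  interpret L: sigma_finite_measure "lebesgue :: 'a measure" by (rule sigma_finite_lebesgue)
  interpret P: pair_sigma_finite "lebesgue :: 'a measure" "lebesgue :: 'a measure" ..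
  note i = integrable_convolution_kernel[OF assms]
  have 1: "(LINT x|lebesgue. f x * (k (x - y) * g y)) = g y * (LINT x|lebesgue. k (x - y) * f x)" for y
    by (subst Bochner_Integration.integral_mult_right_zero[symmetric]) (simp add: mult_ac)
  show "(LINT x|lebesgue. f x * (LINT y|lebesgue. k (x - y) * g y))
      = (LINT y|lebesgue. g y * (LINT x|lebesgue. k (x - y) * f x))"
    using P.Fubini_integral[OF i] by (simp add: 1)
  show "integrable lebesgue (\<lambda>x. f x * (LINT y|lebesgue. k (x - y) * g y))"
    using P.integrable_fst[OF i] by simp
  show "integrable lebesgue (\<lambda>y. g y * (LINT x|lebesgue. k (x - y) * f x))"
    using P.integrable_snd[OF i] by (simp add: 1)
qed

section \<open>Compactly supported kernels and the standard mollifier\<close>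

lemma integrable_continuous_compact_support:
  fixes f :: "'a::euclidean_space \<Rightarrow> real"
  assumes "continuous_on UNIV f" "compact K" "\<And>x. x \<notin> K \<Longrightarrow> f x = 0"
  shows "integrable lebesgue f"
proof -
  have "integrable lborel (\<lambda>x. indicator K x *\<^sub>R f x)"
    using assms continuous_on_subset by (intro borel_integrable_compact) blast+
  also have "(\<lambda>x. indicator K x *\<^sub>R f x) = f"
    using assms(3) by (auto simp: indicator_def fun_eq_iff)
  finally show ?thesis
    using assms(1) by (simp add: integrable_completion borel_measurable_continuous_onI)
qed

lemma bounded_continuous_compact_support:
  fixes f :: "'a::euclidean_space \<Rightarrow> real"
  assumes "continuous_on UNIV f" "compact K" "\<And>x. x \<notin> K \<Longrightarrow> f x = 0"
  shows "\<exists>C. \<forall>x. \<bar>f x\<bar> \<le> C"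
proof -
  have "compact (f ` K)"
    using assms(1,2) continuous_on_subset by (intro compact_continuous_image) blast+
  then obtain C where "\<And>x. x \<in> K \<Longrightarrow> \<bar>f x\<bar> \<le> C"
    using compact_imp_bounded[of "f ` K"] unfolding bounded_iff by auto
  then show ?thesis
    using assms(3) by (intro exI[of _ "max C 0"]) (metis abs_zero max.cobounded2 max.coboundedI1)
qed

lemma lebesgue_integral_translation:
  fixes f :: "'a::euclidean_space \<Rightarrow> real"
  assumes "f \<in> borel_measurable borel"
  shows "(LINT x|lebesgue. f (x - y)) = (LINT x|lebesgue. f x)"
proof -
  have [measurable]: "f \<in> borel_measurable borel" by fact
  have "(LINT x|lborel. f x) = (LINT x|distr lborel borel ((+) (- y)). f x)"
    by (simp add: lborel_distr_plus)
  also have "\<dots> = (LINT x|lborel. f (- y + x))"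
    by (rule integral_distr) auto
  finally have "(LINT x|lborel. f x) = (LINT x|lborel. f (x - y))"
    by simp
  then show ?thesis
    by (subst (1 2) integral_completion) auto
qed

text \<open>The squared norm keeps the argument polynomial, so no smoothness is lost at the origin;
  outside the ball of radius \<open>r\<close> the argument is at most 0, where
  \<open>flat_exp\<close> vanishes to infinite order.\<close>

definition bump :: "real \<Rightarrow> 'a::euclidean_space \<Rightarrow> real" where
  "bump r z = flat_exp 0 (r\<^sup>2 - z \<bullet> z)"

definition mollifier :: "real \<Rightarrow> 'a::euclidean_space \<Rightarrow> real" where
  "mollifier r z = bump r z / (LINT z::'a|lebesgue. bump r z)"

lemma smooth_on_bump: "smooth_on UNIV (bump r :: 'a::euclidean_space \<Rightarrow> real)"
proof -
  have "smooth_on UNIV (\<lambda>z::'a. r\<^sup>2 - z \<bullet> z)"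
    unfolding smooth_on_def
  proof
    fix k
    have "Ck_on k UNIV (\<lambda>z::'a. r\<^sup>2 + (-1) * (\<Sum>b\<in>Basis. (z \<bullet> b) * (z \<bullet> b)))"
      by (intro Ck_on_add Ck_on_mult Ck_on_sum Ck_on_const Ck_on_inner) auto
    then show "Ck_on k UNIV (\<lambda>z::'a. r\<^sup>2 - z \<bullet> z)"
      by (subst euclidean_inner) simp
  qed
  then show ?thesis
    unfolding bump_def by (intro smooth_on_compose[OF _ _ _ smooth_on_flat_exp]) auto
qed

lemma bump_nonneg: "0 \<le> bump r z"
  by (auto simp: bump_def flat_exp_def)

lemma bump_eq_0: "r > 0 \<Longrightarrow> norm z \<ge> r \<Longrightarrow> bump r z = 0"
  using power_mono[of r "norm z" 2] by (simp add: bump_def flat_exp_def dot_square_norm not_less)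

lemma integrable_bump:
  fixes r :: real
  assumes "r > 0"
  shows "integrable lebesgue (bump r :: 'a::euclidean_space \<Rightarrow> real)"
  by (rule integrable_continuous_compact_support[OF smooth_on_continuous_on[OF smooth_on_bump] compact_cball[of 0 r]])
    (simp add: bump_eq_0[OF assms])

lemma integral_bump_pos:
  assumes "r > 0"
  shows "0 < (LINT z::'a::euclidean_space|lebesgue. bump r z)"
proof -
  \<comment> \<open>On the ball of radius \<open>r / 2\<close> the argument
    \<open>r\<^sup>2 - z \<bullet> z\<close> is at least \<open>3 / 4 * r\<^sup>2\<close>, so
    \<open>c\<close> bounds the bump from below there.\<close>
  define c where "c = exp (- 1 / (3 / 4 * r\<^sup>2))"
  have "0 < c * measure lebesgue (ball (0::'a) (r / 2))"
    using content_ball_pos[of "r / 2" "0::'a"] assms by (simp add: c_def)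
  also have "\<dots> = (LINT z::'a|lebesgue. c * indicator (ball 0 (r / 2)) z)"
    by simp
  also have "\<dots> \<le> (LINT z::'a|lebesgue. bump r z)"
  proof (rule integral_mono)
    show "integrable lebesgue (\<lambda>z. c * indicator (ball (0::'a) (r / 2)) z)"
      using lmeasurable_ball[of "0::'a" "r / 2"]
      by (intro integrable_mult_right) (auto simp: fmeasurable_def integrable_indicator_iff simp del: emeasure_completion)
    show "c * indicator (ball 0 (r / 2)) z \<le> bump r z" for z :: 'a
    proof (cases "z \<in> ball 0 (r / 2)")
      case True
      then have "(norm z)\<^sup>2 \<le> (r / 2)\<^sup>2"
        by (intro power_mono) auto
      then have le: "3 / 4 * r\<^sup>2 \<le> r\<^sup>2 - z \<bullet> z"
        by (simp add: dot_square_norm power_divide)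
      have p: "0 < 3 / 4 * r\<^sup>2" using assms by simp
      have "1 / (r\<^sup>2 - z \<bullet> z) \<le> 1 / (3 / 4 * r\<^sup>2)" "0 < r\<^sup>2 - z \<bullet> z"
        using frac_le[OF _ order_refl p le, of 1] less_le_trans[OF p le] by simp_all
      then have "c \<le> exp (- 1 / (r\<^sup>2 - z \<bullet> z))" "0 < r\<^sup>2 - z \<bullet> z"
        unfolding c_def by auto
      then show ?thesis
        using True by (simp add: bump_def flat_exp_def)
    qed (simp add: bump_nonneg)
  qed (rule integrable_bump[OF assms])
  finally show ?thesis .
qed

lemma smooth_on_mollifier: "smooth_on UNIV (mollifier r :: 'a::euclidean_space \<Rightarrow> real)"
  using smooth_on_mult[OF open_UNIV smooth_on_bump smooth_on_const, of r "1 / (LINT z::'a|lebesgue. bump r z)"]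
  unfolding mollifier_def[abs_def] by simp

lemma continuous_on_mollifier: "continuous_on UNIV (mollifier r :: 'a::euclidean_space \<Rightarrow> real)"
  using smooth_on_continuous_on[OF smooth_on_mollifier] .

lemma mollifier_nonneg: "r > 0 \<Longrightarrow> 0 \<le> mollifier r z"
  using bump_nonneg integral_bump_pos less_imp_le unfolding mollifier_def by (metis divide_nonneg_pos)

lemma mollifier_eq_0: "r > 0 \<Longrightarrow> norm z \<ge> r \<Longrightarrow> mollifier r z = 0"
  by (simp add: mollifier_def bump_eq_0)

lemma mollifier_minus: "mollifier r (- z) = mollifier r z"
  by (simp add: mollifier_def bump_def)

lemma integral_mollifier: "r > 0 \<Longrightarrow> (LINT z::'a::euclidean_space|lebesgue. mollifier r z) = 1"
  using integral_bump_pos[of r, where ?'a = 'a] by (simp add: mollifier_def)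

lemma mollifier_bounded:
  assumes "r > 0"
  shows "\<exists>C. \<forall>z::'a::euclidean_space. \<bar>mollifier r z\<bar> \<le> C"
  by (rule bounded_continuous_compact_support[OF continuous_on_mollifier compact_cball[of 0 r]])
    (simp add: mollifier_eq_0[OF assms])

text \<open>Both signs of the difference occur, since either variable may be the one integrated
  over; evenness of the mollifier identifies them.\<close>

lemma mollifier_translate:
  fixes y :: "'a::euclidean_space"
  assumes "r > 0"
  shows "integrable lebesgue (\<lambda>x. mollifier r (x - y))" "(LINT x|lebesgue. mollifier r (x - y)) = 1"
    "integrable lebesgue (\<lambda>x. mollifier r (y - x))" "(LINT x|lebesgue. mollifier r (y - x)) = 1"
proof -
  show 1: "integrable lebesgue (\<lambda>x. mollifier r (x - y))"
  proof (rule integrable_continuous_compact_support[OF _ compact_cball[of y r]])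
    show "continuous_on UNIV (\<lambda>x. mollifier r (x - y))"
      by (intro continuous_on_compose2[OF continuous_on_mollifier] continuous_intros) auto
    show "mollifier r (x - y) = 0" if "x \<notin> cball y r" for x
      using that mollifier_eq_0[OF assms, of "x - y"] by (simp add: dist_norm norm_minus_commute)
  qed
  show 2: "(LINT x|lebesgue. mollifier r (x - y)) = 1"
    using lebesgue_integral_translation[of "mollifier r" y] integral_mollifier[OF assms]
    by (simp add: borel_measurable_continuous_onI[OF continuous_on_mollifier])
  have "mollifier r (y - x) = mollifier r (x - y)" for x
    using mollifier_minus[of r "x - y"] by simp
  then show "integrable lebesgue (\<lambda>x. mollifier r (y - x))" "(LINT x|lebesgue. mollifier r (y - x)) = 1"
    using 1 2 by simp_all
qed

section \<open>Convergence of mollifications\<close>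

lemma mollify_bound:
  fixes a :: "'a::euclidean_space \<Rightarrow> real"
  assumes r: "r > 0" and a: "AE x in lebesgue. \<bar>a x\<bar> \<le> C"
  shows "\<bar>LINT x|lebesgue. mollifier r (x - y) * a x\<bar> \<le> C"
proof -
  have m: "integrable lebesgue (\<lambda>x. mollifier r (x - y) * C)"
    by (intro integrable_mult_left mollifier_translate r)
  have "\<bar>LINT x|lebesgue. mollifier r (x - y) * a x\<bar> \<le> (LINT x|lebesgue. mollifier r (x - y) * C)"
  proof (rule integral_abs_le_AE[OF m])
    show "AE x in lebesgue. \<bar>mollifier r (x - y) * a x\<bar> \<le> mollifier r (x - y) * C"
      using a by eventually_elim (simp add: abs_mult mollifier_nonneg[OF r] mult_left_mono)
  qed
  also have "\<dots> = C"
    using mollifier_translate(2)[OF r, of y] by simp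
  finally show ?thesis .
qed

lemma mollify_continuous_tendsto:
  fixes g :: "'a::euclidean_space \<Rightarrow> real"
  assumes g: "continuous_on UNIV g" "\<And>x. \<bar>g x\<bar> \<le> G"
  shows "(\<lambda>n. LINT y|lebesgue. mollifier (inverse (Suc n)) (x - y) * g y) \<longlonglongrightarrow> g x"
proof (rule LIMSEQ_I)
  fix e :: real assume e: "e > 0"
  have "isCont g x" using g by (simp add: continuous_on_eq_continuous_at)
  then obtain d where d: "d > 0" "\<And>y. dist y x < d \<Longrightarrow> dist (g y) (g x) < e / 2"
    using e unfolding continuous_at_eps_delta by (metis half_gt_zero)
  obtain N where N: "inverse (Suc N) < d" using d reals_Archimedean by blast
  have gm: "g \<in> borel_measurable lebesgue"
    using borel_measurable_continuous_onI[OF g(1)] by (simp add: measurable_completion)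
  show "\<exists>no. \<forall>n\<ge>no. norm ((LINT y|lebesgue. mollifier (inverse (Suc n)) (x - y) * g y) - g x) < e"
  proof (intro exI[of _ N] allI impI)
    fix n assume n: "n \<ge> N"
    define r where "r = inverse (real (Suc n))"
    have "inverse (real (Suc n)) \<le> inverse (real (Suc N))"
      using n by (intro le_imp_inverse_le) auto
    then have "r < d"
      using N unfolding r_def by (rule le_less_trans)
    then have r: "r > 0" "r < d"
      by (simp_all add: r_def)
    note m = mollifier_translate(3,4)[OF r(1), of x]
    have i: "integrable lebesgue (\<lambda>y. mollifier r (x - y) * g y)"
    proof (rule Bochner_Integration.integrable_bound[OF integrable_mult_left[OF m(1), of G]])
      show "AE y in lebesgue. norm (mollifier r (x - y) * g y) \<le> norm (mollifier r (x - y) * G)"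
        using g(2) abs_ge_self order_trans by (intro AE_I2) (fastforce simp: abs_mult intro!: mult_left_mono)
    qed (use m(1) gm in auto)
    \<comment> \<open>The kernel has mass 1, so \<open>g x\<close> can be taken under the integral;
      then only points closer to \<open>x\<close> than \<open>r < d\<close> contribute.\<close>
    have "\<bar>(LINT y|lebesgue. mollifier r (x - y) * g y) - g x\<bar>
      = \<bar>LINT y|lebesgue. mollifier r (x - y) * g y - mollifier r (x - y) * g x\<bar>"
      using m i by (subst Bochner_Integration.integral_diff) auto
    also have "\<dots> \<le> (LINT y|lebesgue. mollifier r (x - y) * (e / 2))"
    proof (rule integral_abs_le_AE[OF _ AE_I2])
      show "\<bar>mollifier r (x - y) * g y - mollifier r (x - y) * g x\<bar> \<le> mollifier r (x - y) * (e / 2)" for y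
      proof (cases "norm (x - y) \<ge> r")
        case False
        then have "\<bar>g y - g x\<bar> < e / 2" using d(2)[of y] r by (simp add: dist_norm norm_minus_commute)
        then show ?thesis
          using mollifier_nonneg[OF r(1), of "x - y"] mult_left_mono[of "\<bar>g y - g x\<bar>" "e / 2" "mollifier r (x - y)"]
          by (simp add: abs_mult flip: right_diff_distrib)
      qed (simp add: mollifier_eq_0 r)
    qed (use m i in auto)
    also have "\<dots> = e / 2" using m by simp
    finally show "norm ((LINT y|lebesgue. mollifier (inverse (Suc n)) (x - y) * g y) - g x) < e"
      using e by (simp add: r_def)
  qed
qed

text \<open>A three-epsilon argument. \<open>b\<close> is replaced by a bounded continuous
  \<open>g\<close> close to it in L1. For \<open>g\<close> the mollifications converge pointwise and
  boundedly. The error caused by \<open>b - g\<close> is uniform in \<open>n\<close>, because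
  Fubini's theorem moves the mollifier onto the bounded factor \<open>a\<close>, whose bound it
  preserves. The pairing of a bounded function with an integrable one is exactly that of a locally
  bounded function with a weak gradient.\<close>

lemma mollify_tendsto:
  fixes a b :: "'a::euclidean_space \<Rightarrow> real"
  assumes a: "integrable lebesgue a" "AE x in lebesgue. \<bar>a x\<bar> \<le> C" and b: "integrable lebesgue b"
  shows "(\<lambda>n. LINT x|lebesgue. a x * (LINT y|lebesgue. mollifier (inverse (Suc n)) (x - y) * b y))
    \<longlonglongrightarrow> (LINT x|lebesgue. a x * b x)"
proof (rule LIMSEQ_I)
  fix e :: real assume e: "e > 0"
  \<comment> \<open>A strictly positive bound, so that it can appear in a denominator even if
    \<open>C\<close> is 0.\<close>
  define C' where "C' = \<bar>C\<bar> + 1"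
  have C': "C' > 0" and aC: "AE x in lebesgue. \<bar>a x\<bar> \<le> C'"
    using a(2) unfolding C'_def by (auto elim!: eventually_mono)
  have am: "a \<in> borel_measurable lebesgue" using a by auto
  obtain g where g: "continuous_on UNIV g" "bounded (range g)" "integrable lebesgue g"
    "(LINT x|lebesgue. \<bar>b x - g x\<bar>) < e / (3 * C')"
    using L1_dense_continuous[OF b, of "e / (3 * C')"] e C' by auto
  obtain G where G: "\<And>x. \<bar>g x\<bar> \<le> G" using g(2) by (auto simp: bounded_iff)
  have gm: "g \<in> borel_measurable lebesgue" using g(3) by auto
  define m where "m n = (mollifier (inverse (real (Suc n))) :: 'a \<Rightarrow> real)" for n
  have pos: "inverse (real (Suc n)) > 0" for n by simp
  have mc: "continuous_on UNIV (m n)" for n unfolding m_def by (rule continuous_on_mollifier)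
  have mb: "\<exists>M. \<forall>x. \<bar>m n x\<bar> \<le> M" for n unfolding m_def by (rule mollifier_bounded[OF pos])
  have bg: "integrable lebesgue (\<lambda>y. b y - g y)" using b g by auto
  have intag: "integrable lebesgue (\<lambda>x. a x * g x)"
  proof (rule Bochner_Integration.integrable_bound[OF integrable_mult_left[OF a(1), of G]])
    show "AE x in lebesgue. norm (a x * g x) \<le> norm (a x * G)"
    proof (rule AE_I2)
      show "norm (a x * g x) \<le> norm (a x * G)" for x
        using G[of x] by (auto simp: abs_mult intro!: mult_left_mono)
    qed
  qed (use am gm in auto)
  have intab: "integrable lebesgue (\<lambda>x. a x * f x)" if "integrable lebesgue f" for f
  proof (rule Bochner_Integration.integrable_bound[OF integrable_mult_right[OF that, of C']])
    show "AE x in lebesgue. norm (a x * f x) \<le> norm (C' * f x)"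
      using aC by eventually_elim (use C' in \<open>auto simp: abs_mult intro!: mult_right_mono\<close>)
  qed (use am that in auto)
  have lim: "(\<lambda>n. LINT x|lebesgue. a x * (LINT y|lebesgue. m n (x - y) * g y)) \<longlonglongrightarrow> (LINT x|lebesgue. a x * g x)"
  proof (rule integral_dominated_convergence[where w = "\<lambda>x. \<bar>a x\<bar> * G"])
    show "AE x in lebesgue. (\<lambda>n. a x * (LINT y|lebesgue. m n (x - y) * g y)) \<longlonglongrightarrow> a x * g x"
      unfolding m_def by (intro AE_I2 tendsto_mult tendsto_const mollify_continuous_tendsto[where G = G] g G)
    show "(\<lambda>x. a x * (LINT y|lebesgue. m n (x - y) * g y)) \<in> borel_measurable lebesgue" for n
      using Fubini_convolution(2)[OF a(1) g(3) mc] mb by blast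
    have "\<bar>LINT y|lebesgue. m n (x - y) * g y\<bar> \<le> G" for n x
    proof -
      have "m n (x - y) = m n (y - x)" for y
        using mollifier_minus[of _ "x - y"] by (simp add: m_def)
      then show ?thesis
        using mollify_bound[OF pos, of g G n x] G by (simp add: m_def)
    qed
    then show "AE x in lebesgue. norm (a x * (LINT y|lebesgue. m n (x - y) * g y)) \<le> \<bar>a x\<bar> * G" for n
      by (auto simp: abs_mult intro!: mult_left_mono)
  qed (use intag a in auto)
  obtain N where N: "\<And>n. n \<ge> N \<Longrightarrow>
      norm ((LINT x|lebesgue. a x * (LINT y|lebesgue. m n (x - y) * g y)) - (LINT x|lebesgue. a x * g x)) < e / 3"
    using LIMSEQ_D[OF lim, of "e / 3"] e by auto
  show "\<exists>no. \<forall>n\<ge>no. norm ((LINT x|lebesgue. a x * (LINT y|lebesgue. mollifier (inverse (Suc n)) (x - y) * b y))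
      - (LINT x|lebesgue. a x * b x)) < e"
  proof (intro exI[of _ N] allI impI)
    fix n assume n: "n \<ge> N"
    obtain M where M: "\<And>x. \<bar>m n x\<bar> \<le> M" using mb by blast
    define T where "T f = (LINT x|lebesgue. a x * (LINT y|lebesgue. m n (x - y) * f y))" for f
    \<comment> \<open>Used twice: for \<open>a\<close> itself and for its mollification, which obeys
      the same bound.\<close>
    have small: "\<bar>LINT x|lebesgue. f x * (b x - g x)\<bar> < e / 3"
      if f: "AE x in lebesgue. \<bar>f x\<bar> \<le> C'" for f
    proof -
      have "\<bar>LINT x|lebesgue. f x * (b x - g x)\<bar> \<le> (LINT x|lebesgue. C' * \<bar>b x - g x\<bar>)"
        using f bg by (intro integral_abs_le_AE integrable_mult_right integrable_abs)
          (auto simp: abs_mult mult_right_mono elim!: eventually_mono)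
      also have "\<dots> < C' * (e / (3 * C'))"
        using mult_strict_left_mono[OF g(4) C'] by simp
      also have "\<dots> = e / 3" using C' by simp
      finally show ?thesis .
    qed
    have sw: "T f = (LINT y|lebesgue. f y * (LINT x|lebesgue. m n (x - y) * a x))" if "integrable lebesgue f" for f
      unfolding T_def by (rule Fubini_convolution(1)[OF a(1) that mc M])
    have swi: "integrable lebesgue (\<lambda>y. f y * (LINT x|lebesgue. m n (x - y) * a x))" if "integrable lebesgue f" for f
      by (rule Fubini_convolution(3)[OF a(1) that mc M])
    have "T b - T g = (LINT y|lebesgue. (LINT x|lebesgue. m n (x - y) * a x) * (b y - g y))"
      using swi[OF b] swi[OF g(3)] unfolding sw[OF b] sw[OF g(3)]
      by (subst Bochner_Integration.integral_diff[symmetric]) (simp_all add: algebra_simps)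
    moreover have "\<bar>LINT y|lebesgue. (LINT x|lebesgue. m n (x - y) * a x) * (b y - g y)\<bar> < e / 3"
      using mollify_bound[OF pos aC] unfolding m_def
      by (intro small AE_I2) auto
    ultimately have 1: "\<bar>T b - T g\<bar> < e / 3" by simp
    have 2: "\<bar>T g - (LINT x|lebesgue. a x * g x)\<bar> < e / 3"
      using N[OF n] by (simp add: T_def)
    have "(LINT x|lebesgue. a x * b x) - (LINT x|lebesgue. a x * g x) = (LINT x|lebesgue. a x * (b x - g x))"
      using intab[OF b] intab[OF g(3)] by (simp add: right_diff_distrib)
    moreover have "\<bar>LINT x|lebesgue. a x * (b x - g x)\<bar> < e / 3"
      by (rule small[OF aC])
    ultimately have "\<bar>T b - (LINT x|lebesgue. a x * b x)\<bar> < e"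
      using 1 2 by linarith
    then show "norm ((LINT x|lebesgue. a x * (LINT y|lebesgue. mollifier (inverse (Suc n)) (x - y) * b y))
      - (LINT x|lebesgue. a x * b x)) < e"
      by (simp add: T_def m_def)
  qed
qed

section \<open>Weak gradients\<close>

definition loc_integrable :: "'a::euclidean_space set \<Rightarrow> ('a \<Rightarrow> 'b::euclidean_space) \<Rightarrow> bool" where
  "loc_integrable \<Omega> f \<longleftrightarrow> (\<forall>K. compact K \<and> K \<subseteq> \<Omega> \<longrightarrow> integrable (lebesgue_on K) f)"

lemma integrable_mult_AE_bounded:
  fixes f h :: "'a \<Rightarrow> real"
  assumes "integrable M f" "h \<in> borel_measurable M" "AE x in M. \<bar>h x\<bar> \<le> C"
  shows "integrable M (\<lambda>x. f x * h x)"
proof (rule Bochner_Integration.integrable_bound[OF integrable_mult_left[OF assms(1), of C]])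
  show "AE x in M. norm (f x * h x) \<le> norm (f x * C)"
    using assms(3) by eventually_elim (auto simp: abs_mult intro!: mult_left_mono)
qed (use assms in auto)

lemma compact_lebesgue: "compact K \<Longrightarrow> K \<in> sets (lebesgue :: 'a::euclidean_space measure)"
  using lmeasurable_compact by blast

lemma integrable_lebesgue_on_iff:
  fixes f :: "'a::euclidean_space \<Rightarrow> 'b::euclidean_space"
  shows "S \<in> sets lebesgue \<Longrightarrow> integrable (lebesgue_on S) f \<longleftrightarrow> integrable lebesgue (\<lambda>x. indicator S x *\<^sub>R f x)"
  by (simp add: integrable_restrict_space)

lemma integral_lebesgue_on_eq:
  fixes f :: "'a::euclidean_space \<Rightarrow> 'b::euclidean_space"
  shows "S \<in> sets lebesgue \<Longrightarrow> integral\<^sup>L (lebesgue_on S) f = integral\<^sup>L lebesgue (\<lambda>x. indicator S x *\<^sub>R f x)"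
  by (simp add: integral_restrict_space)

lemma AE_lebesgue_on_iff:
  "S \<in> sets lebesgue \<Longrightarrow> (AE x in lebesgue_on S. P x) \<longleftrightarrow> (AE x in lebesgue. x \<in> S \<longrightarrow> P x)"
  by (simp add: AE_restrict_space_iff)

lemma AE_lebesgue_on_subset:
  assumes "AE x in lebesgue_on S. P x" "S \<in> sets lebesgue" "T \<in> sets lebesgue" "T \<subseteq> S"
  shows "AE x in lebesgue_on T. P x"
  using assms(1) unfolding AE_lebesgue_on_iff[OF assms(2)] AE_lebesgue_on_iff[OF assms(3)]
  by eventually_elim (use assms(4) in auto)

lemma integrable_lebesgue_on_extend:
  fixes f :: "'a::euclidean_space \<Rightarrow> 'b::euclidean_space"
  assumes "integrable (lebesgue_on K) f" "K \<in> sets lebesgue" "S \<in> sets lebesgue" "K \<subseteq> S"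
    and "\<And>x. x \<in> S - K \<Longrightarrow> f x = 0"
  shows "integrable (lebesgue_on S) f"
proof -
  have "(\<lambda>x. indicator S x *\<^sub>R f x) = (\<lambda>x. indicator K x *\<^sub>R f x)"
    using assms(4,5) by (auto simp: indicator_def fun_eq_iff)
  then show ?thesis
    using assms by (simp add: integrable_lebesgue_on_iff)
qed

lemma loc_integrable_mult:
  fixes f h :: "'a::euclidean_space \<Rightarrow> real"
  assumes f: "loc_integrable \<Omega> f" and h: "continuous_on \<Omega> h"
  shows "loc_integrable \<Omega> (\<lambda>x. f x * h x)"
  unfolding loc_integrable_def
proof (intro allI impI)
  fix K assume K: "compact K \<and> K \<subseteq> \<Omega>"
  then have c: "continuous_on K h" using h continuous_on_subset by blast
  then have "bounded (h ` K)" using K compact_continuous_image compact_imp_bounded by blast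
  then obtain C where C: "\<And>x. x \<in> K \<Longrightarrow> \<bar>h x\<bar> \<le> C" by (auto simp: bounded_iff)
  show "integrable (lebesgue_on K) (\<lambda>x. f x * h x)"
  proof (rule integrable_mult_AE_bounded)
    show "integrable (lebesgue_on K) f" using f K by (simp add: loc_integrable_def)
    show "h \<in> borel_measurable (lebesgue_on K)"
      using c K by (intro continuous_imp_measurable_on_sets_lebesgue compact_lebesgue) auto
    show "AE x in lebesgue_on K. \<bar>h x\<bar> \<le> C" using C by (intro AE_I2) auto
  qed
qed

lemma loc_integrable_add:
  "loc_integrable \<Omega> f \<Longrightarrow> loc_integrable \<Omega> g \<Longrightarrow> loc_integrable \<Omega> (\<lambda>x. f x + g x)"
  by (auto simp: loc_integrable_def)

lemma loc_integrable_inner: "loc_integrable \<Omega> g \<Longrightarrow> loc_integrable \<Omega> (\<lambda>x. g x \<bullet> i)"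
  by (auto simp: loc_integrable_def)

lemma loc_integrable_componentwise:
  fixes g :: "'a::euclidean_space \<Rightarrow> 'b::euclidean_space"
  assumes "\<And>i. i \<in> Basis \<Longrightarrow> loc_integrable \<Omega> (\<lambda>x. g x \<bullet> i)"
  shows "loc_integrable \<Omega> g"
proof -
  have "integrable (lebesgue_on K) (\<lambda>x. \<Sum>i\<in>Basis. (g x \<bullet> i) *\<^sub>R i)" if "compact K" "K \<subseteq> \<Omega>" for K
    using assms that by (auto simp: loc_integrable_def)
  then show ?thesis by (simp add: loc_integrable_def euclidean_representation)
qed

text \<open>A test function and its partial derivatives are continuous and vanish off one compact
  \<open>K\<close>, so everything happens on \<open>K\<close>, where \<open>f\<close> is
  integrable.\<close>

lemma integrable_test_mult:
  fixes f :: "'a::euclidean_space \<Rightarrow> real"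
  assumes \<Omega>: "open \<Omega>" and f: "loc_integrable \<Omega> f" and \<eta>: "\<eta> \<in> test_functions \<Omega>"
  shows "integrable (lebesgue_on \<Omega>) (\<lambda>x. f x * \<eta> x)"
    and "i \<in> Basis \<Longrightarrow> integrable (lebesgue_on \<Omega>) (\<lambda>x. f x * frechet_derivative \<eta> (at x) i)"
proof -
  obtain K where K: "compact K" "K \<subseteq> \<Omega>" "\<And>x. x \<notin> K \<Longrightarrow> \<eta> x = 0"
    "\<And>x. x \<notin> K \<Longrightarrow> frechet_derivative \<eta> (at x) = (\<lambda>h. 0)"
    using test_functions_support[OF \<eta>] by metis
  have *: "integrable (lebesgue_on \<Omega>) (\<lambda>x. f x * h x)"
    if "continuous_on UNIV h" "\<And>x. x \<notin> K \<Longrightarrow> h x = 0" for h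
  proof (rule integrable_lebesgue_on_extend[OF _ _ _ K(2)])
    show "integrable (lebesgue_on K) (\<lambda>x. f x * h x)"
      using loc_integrable_mult[OF f continuous_on_subset[OF that(1)]] K(1,2)
      by (auto simp: loc_integrable_def)
  qed (use K \<Omega> that in \<open>auto intro: compact_lebesgue\<close>)
  show "integrable (lebesgue_on \<Omega>) (\<lambda>x. f x * \<eta> x)"
    using * smooth_on_continuous_on test_functions_smooth[OF \<eta>] K by blast
  show "integrable (lebesgue_on \<Omega>) (\<lambda>x. f x * frechet_derivative \<eta> (at x) i)" if "i \<in> Basis"
    using K by (intro * smooth_on_continuous_on smooth_on_partial test_functions_smooth[OF \<eta>] that) auto
qed

lemma has_weak_gradient_iff:
  "has_weak_gradient \<Omega> \<phi> g \<longleftrightarrow> loc_integrable \<Omega> \<phi> \<and> loc_integrable \<Omega> g \<and>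
    (\<forall>\<eta>\<in>test_functions \<Omega>. \<forall>i\<in>Basis.
        (LINT x|lebesgue_on \<Omega>. \<phi> x * frechet_derivative \<eta> (at x) i)
          = - (LINT x|lebesgue_on \<Omega>. (g x \<bullet> i) * \<eta> x))"
  unfolding has_weak_gradient_def loc_integrable_def by blast

text \<open>The union of the closed balls is the Minkowski sum of two compact sets, hence compact.
  It provides the margin within which mollifiers centred in \<open>K\<close> are supported inside
  \<open>\<Omega>\<close>.\<close>

lemma compact_neighbourhood:
  fixes K :: "'a::euclidean_space set"
  assumes "compact K" "open \<Omega>" "K \<subseteq> \<Omega>"
  obtains d K' where "d > 0" "compact K'" "K' \<subseteq> \<Omega>" "K \<subseteq> K'" "\<And>x. x \<in> K \<Longrightarrow> cball x d \<subseteq> K'"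
proof -
  obtain d where d: "d > 0" "(\<Union>x\<in>K. cball x d) \<subseteq> \<Omega>"
    using compact_subset_open_imp_cball_epsilon_subset[OF assms] .
  have "(\<Union>x\<in>K. cball x d) = {x + y | x y. x \<in> K \<and> y \<in> cball 0 d}"
  proof (intro set_eqI iffI)
    fix z assume "z \<in> {x + y | x y. x \<in> K \<and> y \<in> cball 0 d}"
    then show "z \<in> (\<Union>x\<in>K. cball x d)"
      by (force simp: dist_norm)
  next
    fix z assume "z \<in> (\<Union>x\<in>K. cball x d)"
    then obtain x where "x \<in> K" "dist x z \<le> d" by auto
    then show "z \<in> {x + y | x y. x \<in> K \<and> y \<in> cball 0 d}"
      by (intro CollectI exI[of _ x] exI[of _ "z - x"]) (auto simp: dist_norm norm_minus_commute)
  qed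
  then have "compact (\<Union>x\<in>K. cball x d)"
    using compact_sums[OF assms(1) compact_cball[of 0 d]] by simp
  then show thesis
    using d by (intro that[of d "\<Union>x\<in>K. cball x d"]) (auto intro: less_imp_le)
qed

section \<open>Mollifiers as test functions and the fundamental lemma\<close>

lemma mollifier_test_function:
  assumes "r > 0" "open \<Omega>" "cball x r \<subseteq> \<Omega>"
  shows "(\<lambda>y. mollifier r (x - y)) \<in> test_functions \<Omega>"
proof (rule test_functionsI[OF assms(2) compact_cball assms(3)])
  show "smooth_on \<Omega> (\<lambda>y. mollifier r (x - y))"
  proof (rule smooth_on_compose[OF assms(2) open_UNIV _ smooth_on_mollifier])
    show "smooth_on \<Omega> (\<lambda>y. (x - y) \<bullet> j)" for j
      unfolding inner_diff_left by (intro smooth_on_diff smooth_on_const smooth_on_inner assms)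
  qed auto
  show "mollifier r (x - y) = 0" if "y \<notin> cball x r" for y
    using that mollifier_eq_0[OF assms(1), of "x - y"] by (simp add: dist_norm)
qed

lemma mollifier_derivative_reflect:
  "frechet_derivative (\<lambda>y. mollifier r (x - y)) (at y) i = - frechet_derivative (mollifier r) (at (x - y)) i"
proof -
  have "(mollifier r has_derivative frechet_derivative (mollifier r) (at (x - y))) (at (x - y))"
    using smooth_on_has_derivative[OF smooth_on_mollifier] by simp
  moreover have "((\<lambda>y. x - y) has_derivative uminus) (at y)"
    by (auto intro!: derivative_eq_intros)
  ultimately have "((\<lambda>y. mollifier r (x - y)) has_derivative (\<lambda>h. frechet_derivative (mollifier r) (at (x - y)) (- h))) (at y)"
    by (rule has_derivative_compose[rotated])
  then show ?thesis
    using frechet_derivative_at[of "\<lambda>y. mollifier r (x - y)"] 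
      linear_neg[OF linear_frechet_derivative[of "mollifier r" "at (x - y)"]]
      smooth_on_has_derivative[OF smooth_on_mollifier, of "x - y"]
    by (metis UNIV_I differentiable_def)
qed

text \<open>This is the reflection rule at \<open>x = 0\<close>, combined with evenness of the
  mollifier.\<close>

lemma mollifier_derivative_odd:
  "frechet_derivative (mollifier r) (at (- z)) i = - frechet_derivative (mollifier r) (at z) i"
  using mollifier_derivative_reflect[of r 0 z i] by (simp add: mollifier_minus)

text \<open>Translated mollifiers are test functions, so the mollifications of \<open>g\<close>
  vanish on \<open>K\<close> once the radius is small. Pairing them with the bounded function
  \<open>sgn g\<close> on \<open>K\<close> and letting the radius tend to 0 shows that the integral
  of \<open>\<bar>g\<bar>\<close> over \<open>K\<close> is 0.\<close>

lemma fundamental_lemma_compact: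
  fixes g :: "'a::euclidean_space \<Rightarrow> real"
  assumes \<Omega>: "open \<Omega>" and g: "loc_integrable \<Omega> g"
    and test: "\<And>\<eta>. \<eta> \<in> test_functions \<Omega> \<Longrightarrow> (LINT x|lebesgue_on \<Omega>. g x * \<eta> x) = 0"
    and K: "compact K" "K \<subseteq> \<Omega>"
  shows "AE x in lebesgue. x \<in> K \<longrightarrow> g x = 0"
proof -
  obtain d K' where d: "d > 0" "compact K'" "K' \<subseteq> \<Omega>" "K \<subseteq> K'" "\<And>x. x \<in> K \<Longrightarrow> cball x d \<subseteq> K'"
    using compact_neighbourhood[OF K(1) \<Omega> K(2)] by metis
  \<comment> \<open>The cut-off on the larger set makes \<open>g\<close> globally integrable and is
    invisible to small mollifiers centred in \<open>K\<close>.\<close>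
  define b where "b x = indicator K' x * g x" for x
  define a where "a x = indicator K x * sgn (b x)" for x
  have b: "integrable lebesgue b"
    using g d(2,3) unfolding b_def loc_integrable_def
    by (simp add: integrable_lebesgue_on_iff compact_lebesgue)
  have Km: "K \<in> lmeasurable" using K(1) by (rule lmeasurable_compact)
  have a: "integrable lebesgue a"
    unfolding a_def
    by (rule integrable_mult_AE_bounded[where C = 1])
      (use Km b in \<open>auto simp: fmeasurable_def integrable_indicator_iff sgn_real_def simp del: emeasure_completion\<close>)
  obtain N where N: "inverse (real (Suc N)) < d" using d(1) reals_Archimedean by blast
  have "(LINT x|lebesgue. a x * (LINT y|lebesgue. mollifier (inverse (Suc n)) (x - y) * b y)) = 0" if "n \<ge> N" for n
  proof -
    define r where "r = inverse (real (Suc n))"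
    have "r \<le> inverse (real (Suc N))"
      unfolding r_def using that by (intro le_imp_inverse_le) auto
    then have "r < d" using N by (rule le_less_trans)
    then have r: "r > 0" "r < d" by (simp_all add: r_def)
    have "a x * (LINT y|lebesgue. mollifier r (x - y) * b y) = 0" for x
    proof (cases "x \<in> K")
      case True
      then have c: "cball x r \<subseteq> K'"
        using d(5)[OF True] r by (meson less_imp_le order_trans subset_cball)
      have "(\<lambda>y. mollifier r (x - y) * b y) = (\<lambda>y. indicator \<Omega> y *\<^sub>R (g y * mollifier r (x - y)))"
      proof
        show "mollifier r (x - y) * b y = indicator \<Omega> y *\<^sub>R (g y * mollifier r (x - y))" for y
          using c d(3) mollifier_eq_0[OF r(1), of "x - y"] unfolding b_def
          by (cases "y \<in> cball x r") (auto simp: dist_norm indicator_def)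
      qed
      then have "(LINT y|lebesgue. mollifier r (x - y) * b y) = 0"
        using test[OF mollifier_test_function[OF r(1) \<Omega>], of x] c d(3) \<Omega> by (simp add: integral_lebesgue_on_eq)
      then show ?thesis by simp
    qed (simp add: a_def)
    then show ?thesis by (simp only: r_def[symmetric] Bochner_Integration.integral_zero)
  qed
  then have ev: "\<forall>\<^sub>F n in sequentially.
      (LINT x|lebesgue. a x * (LINT y|lebesgue. mollifier (inverse (Suc n)) (x - y) * b y)) = 0"
    by (auto simp: eventually_sequentially)
  have "(\<lambda>n. LINT x|lebesgue. a x * (LINT y|lebesgue. mollifier (inverse (Suc n)) (x - y) * b y))
      \<longlonglongrightarrow> (LINT x|lebesgue. a x * b x)"
    by (rule mollify_tendsto[OF a _ b, of 1]) (auto simp: a_def indicator_def sgn_real_def)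
  then have "(LINT x|lebesgue. a x * b x) = 0"
    using LIMSEQ_unique[OF _ tendsto_eventually[OF ev]] by simp
  moreover have ab: "a x * b x = indicator K x * \<bar>b x\<bar>" for x
    unfolding a_def by (simp add: abs_sgn mult.commute)
  moreover have "integrable lebesgue (\<lambda>x. indicator K x * \<bar>b x\<bar>)"
    using integrable_mult_indicator[OF compact_lebesgue[OF K(1)] integrable_abs[OF b]] by simp
  ultimately have "AE x in lebesgue. indicator K x * \<bar>b x\<bar> = 0"
    by (subst (asm) ab, subst (asm) integral_nonneg_eq_0_iff_AE) auto
  then show ?thesis
    by eventually_elim (use d(4) in \<open>auto simp: b_def indicator_def\<close>)
qed

lemma fundamental_lemma:
  fixes g :: "'a::euclidean_space \<Rightarrow> real"
  assumes \<Omega>: "open \<Omega>" and g: "loc_integrable \<Omega> g"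
    and test: "\<And>\<eta>. \<eta> \<in> test_functions \<Omega> \<Longrightarrow> (LINT x|lebesgue_on \<Omega>. g x * \<eta> x) = 0"
  shows "AE x in lebesgue_on \<Omega>. g x = 0"
proof -
  obtain F :: "nat \<Rightarrow> 'a set" where F: "\<And>n. compact (F n)" "\<And>n. F n \<subseteq> \<Omega>" "\<Union>(range F) = \<Omega>"
    using open_Union_compact_subsets[OF \<Omega>] by metis
  have "AE x in lebesgue. \<forall>n. x \<in> F n \<longrightarrow> g x = 0"
    unfolding AE_all_countable using fundamental_lemma_compact[OF \<Omega> g test] F by blast
  then have "AE x in lebesgue. x \<in> \<Omega> \<longrightarrow> g x = 0"
    by eventually_elim (use F(3) in blast)
  then show ?thesis using \<Omega> by (simp add: AE_lebesgue_on_iff)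
qed

section \<open>Uniqueness, locality and the smooth product rule for weak gradients\<close>

lemma has_weak_gradient_unique:
  fixes \<Omega> :: "'a::euclidean_space set"
  assumes \<Omega>: "open \<Omega>" and 1: "has_weak_gradient \<Omega> \<phi> g" and 2: "has_weak_gradient \<Omega> \<psi> h"
    and eq: "AE x in lebesgue_on \<Omega>. \<phi> x = \<psi> x"
  shows "AE x in lebesgue_on \<Omega>. g x = h x"
proof -
  have loc: "loc_integrable \<Omega> \<phi>" "loc_integrable \<Omega> \<psi>" "loc_integrable \<Omega> g" "loc_integrable \<Omega> h"
    using 1 2 by (auto simp: has_weak_gradient_iff)
  have "AE x in lebesgue_on \<Omega>. g x \<bullet> i - h x \<bullet> i = 0" if i: "i \<in> Basis" for i
  proof (rule fundamental_lemma[OF \<Omega>])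
    show "loc_integrable \<Omega> (\<lambda>x. g x \<bullet> i - h x \<bullet> i)"
      using loc by (auto simp: loc_integrable_def)
    fix \<eta> assume \<eta>: "\<eta> \<in> test_functions \<Omega>"
    note i1 = integrable_test_mult[OF \<Omega> loc_integrable_inner \<eta>]
    note i2 = integrable_test_mult(2)[OF \<Omega> _ \<eta> i]
    have "(LINT x|lebesgue_on \<Omega>. (g x \<bullet> i - h x \<bullet> i) * \<eta> x)
      = (LINT x|lebesgue_on \<Omega>. (g x \<bullet> i) * \<eta> x) - (LINT x|lebesgue_on \<Omega>. (h x \<bullet> i) * \<eta> x)"
      using i1[OF loc(3)] i1[OF loc(4)] by (simp add: left_diff_distrib)
    also have "\<dots> = (LINT x|lebesgue_on \<Omega>. \<psi> x * frechet_derivative \<eta> (at x) i)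
        - (LINT x|lebesgue_on \<Omega>. \<phi> x * frechet_derivative \<eta> (at x) i)"
      using 1 2 \<eta> i by (simp add: has_weak_gradient_iff)
    also have "(LINT x|lebesgue_on \<Omega>. \<psi> x * frechet_derivative \<eta> (at x) i)
        = (LINT x|lebesgue_on \<Omega>. \<phi> x * frechet_derivative \<eta> (at x) i)"
      by (rule integral_cong_AE) (use i2[OF loc(1)] i2[OF loc(2)] eq in auto)
    finally show "(LINT x|lebesgue_on \<Omega>. (g x \<bullet> i - h x \<bullet> i) * \<eta> x) = 0" by simp
  qed
  then have "AE x in lebesgue_on \<Omega>. \<forall>i\<in>Basis. g x \<bullet> i - h x \<bullet> i = 0"
    by (subst AE_finite_all) auto
  then show ?thesis
    by eventually_elim (auto intro: euclidean_eqI)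
qed

text \<open>A test function of \<open>S\<close> is also one of \<open>\<Omega>\<close>, and the
  integrals over both sets agree because it vanishes off a compact subset of
  \<open>S\<close>.\<close>

lemma has_weak_gradient_subset:
  fixes \<Omega> :: "'a::euclidean_space set"
  assumes \<Omega>: "open \<Omega>" and S: "open S" "S \<subseteq> \<Omega>" and g: "has_weak_gradient \<Omega> \<phi> g"
  shows "has_weak_gradient S \<phi> g"
  unfolding has_weak_gradient_iff
proof (intro conjI ballI)
  show "loc_integrable S \<phi>" "loc_integrable S g"
    using g S by (auto simp: has_weak_gradient_iff loc_integrable_def)
  fix \<eta> :: "'a \<Rightarrow> real" and i :: 'a assume \<eta>: "\<eta> \<in> test_functions S" and i: "i \<in> Basis"
  obtain K where K: "K \<subseteq> S" "\<And>x. x \<notin> K \<Longrightarrow> \<eta> x = 0"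
    "\<And>x. x \<notin> K \<Longrightarrow> frechet_derivative \<eta> (at x) = (\<lambda>h. 0)"
    using test_functions_support[OF \<eta>] by metis
  have *: "(LINT x|lebesgue_on S. f x * k x) = (LINT x|lebesgue_on \<Omega>. f x * k x)"
    if "\<And>x. x \<notin> K \<Longrightarrow> k x = 0" for f k :: "'a \<Rightarrow> real"
  proof -
    have "(\<lambda>x. indicator S x *\<^sub>R (f x * k x)) = (\<lambda>x. indicator \<Omega> x *\<^sub>R (f x * k x))"
      using that K(1) S by (auto simp: indicator_def fun_eq_iff)
    then show ?thesis using S(1) \<Omega> by (simp add: integral_lebesgue_on_eq)
  qed
  show "(LINT x|lebesgue_on S. \<phi> x * frechet_derivative \<eta> (at x) i)
          = - (LINT x|lebesgue_on S. (g x \<bullet> i) * \<eta> x)"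
    using K g test_functions_subset[OF \<eta> S(2)] i by (simp add: * has_weak_gradient_iff)
qed

text \<open>Comparison with the zero function on \<open>S\<close>; for this the uniqueness lemma
  admits two functions that agree only almost everywhere.\<close>

lemma weak_gradient_vanishes:
  fixes \<Omega> :: "'a::euclidean_space set"
  assumes \<Omega>: "open \<Omega>" and S: "open S" "S \<subseteq> \<Omega>" and g: "has_weak_gradient \<Omega> \<phi> g"
    and "AE x in lebesgue_on S. \<phi> x = 0"
  shows "AE x in lebesgue_on S. g x = 0"
proof (rule has_weak_gradient_unique[OF S(1) has_weak_gradient_subset[OF \<Omega> S g]])
  show "has_weak_gradient S (\<lambda>_. 0) (\<lambda>_. 0)"
    by (simp add: has_weak_gradient_iff loc_integrable_def)
qed fact

lemma has_weak_gradient_cong: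
  assumes "\<And>x. x \<in> \<Omega> \<Longrightarrow> \<phi> x = \<psi> x"
  shows "has_weak_gradient \<Omega> \<phi> g \<longleftrightarrow> has_weak_gradient \<Omega> \<psi> g"
proof -
  have "integrable (lebesgue_on K) \<phi> \<longleftrightarrow> integrable (lebesgue_on K) \<psi>" if "K \<subseteq> \<Omega>" for K
    using assms that by (intro Bochner_Integration.integrable_cong) auto
  moreover have "(LINT x|lebesgue_on \<Omega>. \<phi> x * k x) = (LINT x|lebesgue_on \<Omega>. \<psi> x * k x)" for k :: "'a \<Rightarrow> real"
    using assms by (intro Bochner_Integration.integral_cong) auto
  ultimately show ?thesis unfolding has_weak_gradient_def by auto
qed

text \<open>The product \<open>f x * \<eta> x\<close> is again a test function. Testing
  \<open>\<phi>\<close> against it and expanding its derivative by the classical product rule gives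
  the weak product rule after rearrangement.\<close>

lemma has_weak_gradient_smooth_mult:
  fixes \<Omega> :: "'a::euclidean_space set"
  assumes \<Omega>: "open \<Omega>" and g: "has_weak_gradient \<Omega> \<phi> g" and f: "smooth_on \<Omega> f"
    and f': "\<And>x i. x \<in> \<Omega> \<Longrightarrow> i \<in> Basis \<Longrightarrow> f' x \<bullet> i = frechet_derivative f (at x) i"
  shows "has_weak_gradient \<Omega> (\<lambda>x. f x * \<phi> x) (\<lambda>x. f x *\<^sub>R g x + \<phi> x *\<^sub>R f' x)"
  unfolding has_weak_gradient_iff
proof (intro conjI ballI)
  have l: "loc_integrable \<Omega> \<phi>" "loc_integrable \<Omega> g"
    using g by (auto simp: has_weak_gradient_iff)
  have pc: "continuous_on \<Omega> (\<lambda>x. frechet_derivative f (at x) i)" if "i \<in> Basis" for i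
    using smooth_on_continuous_on[OF smooth_on_partial[OF f that]] .
  have f'c: "continuous_on \<Omega> (\<lambda>x. f' x \<bullet> i)" if "i \<in> Basis" for i
    using pc[OF that] f' that by (simp cong: continuous_on_cong)
  show l1: "loc_integrable \<Omega> (\<lambda>x. f x * \<phi> x)"
    using loc_integrable_mult[OF l(1) smooth_on_continuous_on[OF f]] by (simp add: mult.commute)
  have l2: "loc_integrable \<Omega> (\<lambda>x. f x * (g x \<bullet> i))" for i
    using loc_integrable_mult[OF loc_integrable_inner[OF l(2)] smooth_on_continuous_on[OF f], of i]
    by (simp add: mult.commute)
  have l3: "loc_integrable \<Omega> (\<lambda>x. \<phi> x * (f' x \<bullet> i))" if "i \<in> Basis" for i
    using loc_integrable_mult[OF l(1) f'c[OF that]] .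
  show "loc_integrable \<Omega> (\<lambda>x. f x *\<^sub>R g x + \<phi> x *\<^sub>R f' x)"
    by (rule loc_integrable_componentwise) (auto simp: inner_add_left intro!: loc_integrable_add l2 l3)
  fix \<eta> :: "'a \<Rightarrow> real" and i :: 'a assume \<eta>: "\<eta> \<in> test_functions \<Omega>" and i: "i \<in> Basis"
  have f\<eta>: "(\<lambda>x. f x * \<eta> x) \<in> test_functions \<Omega>"
    by (rule test_functions_mult[OF \<Omega> \<eta> f])
  have d: "frechet_derivative (\<lambda>x. f x * \<eta> x) (at x) i
      = f x * frechet_derivative \<eta> (at x) i + (f' x \<bullet> i) * \<eta> x" if "x \<in> \<Omega>" for x
    using frechet_derivative_at[OF has_derivative_mult[OF smooth_on_has_derivative[OF f that]
      smooth_on_has_derivative[OF test_functions_smooth[OF \<eta>] UNIV_I]]] f'[OF that i] 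
    by (metis (no_types, lifting))
  note T = integrable_test_mult[OF \<Omega>]
  have "(LINT x|lebesgue_on \<Omega>. f x * \<phi> x * frechet_derivative \<eta> (at x) i)
     = (LINT x|lebesgue_on \<Omega>. \<phi> x * frechet_derivative (\<lambda>x. f x * \<eta> x) (at x) i - \<phi> x * (f' x \<bullet> i) * \<eta> x)"
    using d by (intro Bochner_Integration.integral_cong) (auto simp: algebra_simps)
  also have "\<dots> = (LINT x|lebesgue_on \<Omega>. \<phi> x * frechet_derivative (\<lambda>x. f x * \<eta> x) (at x) i)
      - (LINT x|lebesgue_on \<Omega>. \<phi> x * (f' x \<bullet> i) * \<eta> x)"
    by (intro Bochner_Integration.integral_diff T(2)[OF l(1) f\<eta> i] T(1)[OF l3[OF i] \<eta>])
  also have "(LINT x|lebesgue_on \<Omega>. \<phi> x * frechet_derivative (\<lambda>x. f x * \<eta> x) (at x) i)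
      = - (LINT x|lebesgue_on \<Omega>. f x * (g x \<bullet> i) * \<eta> x)"
    using g f\<eta> i by (simp add: has_weak_gradient_iff mult_ac)
  finally show "(LINT x|lebesgue_on \<Omega>. f x * \<phi> x * frechet_derivative \<eta> (at x) i)
      = - (LINT x|lebesgue_on \<Omega>. ((f x *\<^sub>R g x + \<phi> x *\<^sub>R f' x) \<bullet> i) * \<eta> x)"
    using T(1)[OF l2 \<eta>, of i] T(1)[OF l3[OF i] \<eta>] by (simp add: inner_add_left distrib_right)
qed

text \<open>\<open>S1\<close> and \<open>S2\<close> are the two halves of the claim, smeared with the mollifier. Moving the derivative
  onto the mollifier makes them cancel, because its gradient is odd.\<close>

lemma weak_integration_by_parts:
  fixes \<Omega> :: "'a::euclidean_space set"
  assumes \<Omega>: "open \<Omega>" and u: "has_weak_gradient \<Omega> u gu" "u \<in> Linf_loc \<Omega>"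
    and p: "has_weak_gradient \<Omega> \<phi> gp" "\<phi> \<in> Linf_loc \<Omega>"
    and K: "compact K" "K \<subseteq> \<Omega>" "AE x in lebesgue_on (\<Omega> - K). \<phi> x = 0" and i: "i \<in> Basis"
  shows "integrable (lebesgue_on \<Omega>) (\<lambda>x. \<phi> x * (gu x \<bullet> i) + u x * (gp x \<bullet> i))" (is ?I)
    and "(LINT x|lebesgue_on \<Omega>. \<phi> x * (gu x \<bullet> i) + u x * (gp x \<bullet> i)) = 0" (is ?E)
proof -
  obtain d K' where d: "d > 0" "compact K'" "K' \<subseteq> \<Omega>" "K \<subseteq> K'" "\<And>x. x \<in> K \<Longrightarrow> cball x d \<subseteq> K'"
    using compact_neighbourhood[OF K(1) \<Omega> K(2)] by metis
  \<comment> \<open>A second margin: in \<open>S2\<close> the mollifier is centred at points of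
    \<open>K'\<close>, where it must still be a test function of \<open>\<Omega>\<close>.\<close>
  obtain d' K'' where d': "d' > 0" "K'' \<subseteq> \<Omega>" "\<And>x. x \<in> K' \<Longrightarrow> cball x d' \<subseteq> K''"
    using compact_neighbourhood[OF d(2) \<Omega> d(3)] by metis
  have S: "\<Omega> \<in> sets lebesgue" "K \<in> sets lebesgue" "K' \<in> sets lebesgue" "\<Omega> - K \<in> sets lebesgue"
    using \<Omega> compact_lebesgue[OF K(1)] compact_lebesgue[OF d(2)] by auto
  have oK: "open (\<Omega> - K)" using \<Omega> K(1) by (intro open_Diff compact_imp_closed)
  have z: "AE x in lebesgue. x \<in> \<Omega> - K \<longrightarrow> \<phi> x = 0 \<and> gp x = 0"
    using K(3) weak_gradient_vanishes[OF \<Omega> oK Diff_subset p(1) K(3)]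
    unfolding AE_lebesgue_on_iff[OF S(4)] by eventually_elim auto
  have loc: "loc_integrable \<Omega> u" "loc_integrable \<Omega> gu" "loc_integrable \<Omega> \<phi>" "loc_integrable \<Omega> gp"
    using u p by (auto simp: has_weak_gradient_iff)
  \<comment> \<open>The cut-offs differ. \<open>u\<close> is truncated on the larger
    \<open>K'\<close>, so that small balls around points of \<open>K\<close> do not meet the cut;
    \<open>\<phi>\<close> can be truncated on \<open>K\<close> itself, since it and its gradient
    vanish almost everywhere outside.\<close>
  define u' where "u' x = indicator K' x * u x" for x
  define du where "du x = indicator K' x * (gu x \<bullet> i)" for x
  define p' where "p' x = indicator K x * \<phi> x" for x
  define dp where "dp x = indicator K x * (gp x \<bullet> i)" for x
  have int: "integrable lebesgue u'" "integrable lebesgue du" "integrable lebesgue p'" "integrable lebesgue dp"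
    using loc(1,3) loc_integrable_inner[OF loc(2)] loc_integrable_inner[OF loc(4)] K(1,2) d(2,3)
    unfolding u'_def du_def p'_def dp_def loc_integrable_def
    by (simp_all add: integrable_lebesgue_on_iff compact_lebesgue)
  obtain Cu where "AE x in lebesgue_on K'. \<bar>u x\<bar> \<le> Cu" using u(2) d by (auto simp: Linf_loc_def)
  then have Cu: "AE x in lebesgue. \<bar>u' x\<bar> \<le> max Cu 0"
    unfolding AE_lebesgue_on_iff[OF S(3)] by eventually_elim (auto simp: u'_def indicator_def)
  obtain Cp where "AE x in lebesgue_on K. \<bar>\<phi> x\<bar> \<le> Cp" using p(2) K by (auto simp: Linf_loc_def)
  then have Cp: "AE x in lebesgue. \<bar>p' x\<bar> \<le> max Cp 0"
    unfolding AE_lebesgue_on_iff[OF S(2)] by eventually_elim (auto simp: p'_def indicator_def)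
  define S1 where "S1 n = (LINT x|lebesgue. p' x * (LINT y|lebesgue. mollifier (inverse (Suc n)) (x - y) * du y))" for n
  define S2 where "S2 n = (LINT x|lebesgue. u' x * (LINT y|lebesgue. mollifier (inverse (Suc n)) (x - y) * dp y))" for n
  have lim: "S1 \<longlonglongrightarrow> (LINT x|lebesgue. p' x * du x)" "S2 \<longlonglongrightarrow> (LINT x|lebesgue. u' x * dp x)"
    unfolding S1_def[abs_def] S2_def[abs_def] by (rule mollify_tendsto int Cu Cp)+
  obtain N where N: "inverse (real (Suc N)) < min d d'" using d(1) d'(1) reals_Archimedean[of "min d d'"] by auto
  have "S1 n + S2 n = 0" if "n \<ge> N" for n
  proof -
    define r where "r = inverse (real (Suc n))"
    have "r \<le> inverse (real (Suc N))"
      unfolding r_def using that by (intro le_imp_inverse_le) auto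
    then have "r < min d d'" using N by (rule le_less_trans)
    then have r: "r > 0" "r < d" "r < d'" by (simp_all add: r_def)
    define D where "D z = frechet_derivative (mollifier r) (at z) i" for z :: 'a
    have Dc: "continuous_on UNIV D"
      unfolding D_def by (intro smooth_on_continuous_on smooth_on_partial smooth_on_mollifier i)
    \<comment> \<open>The strict inequality places \<open>z\<close> in an open set on which the
      mollifier is identically zero, so its derivative vanishes too.\<close>
    have D0: "D z = 0" if z: "norm z > r" for z :: 'a
    proof -
      have "(mollifier r has_derivative (\<lambda>h. 0)) (at z)"
      proof (rule has_derivative_transform_within_open[OF has_derivative_const[of 0]])
        show "open (- cball 0 r)" "z \<in> - cball (0::'a) r" using z by auto
        show "0 = mollifier r w" if "w \<in> - cball 0 r" for w :: 'a
          using that mollifier_eq_0[OF r(1), of w] by simp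
      qed
      then show ?thesis using frechet_derivative_at unfolding D_def by metis
    qed
    \<comment> \<open>Boundedness makes \<open>D\<close> an admissible kernel for
      \<open>Fubini_convolution\<close>.\<close>
    obtain C where C: "\<And>x. \<bar>D x\<bar> \<le> C"
      using bounded_continuous_compact_support[OF Dc compact_cball[of 0 r]] D0 by auto
    have m0: "mollifier r (x - y) = 0" "D (x - y) = 0" if "y \<notin> cball x r" for x y :: 'a
      using that mollifier_eq_0[OF r(1), of "x - y"] D0[of "x - y"] by (auto simp: dist_norm)
    have parts: "(LINT y|lebesgue_on \<Omega>. (gq y \<bullet> i) * mollifier r (x - y)) = (LINT y|lebesgue_on \<Omega>. q y * D (x - y))"
      if "has_weak_gradient \<Omega> q gq" "cball x r \<subseteq> \<Omega>" for q gq x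
    proof -
      have "(LINT y|lebesgue_on \<Omega>. q y * frechet_derivative (\<lambda>y. mollifier r (x - y)) (at y) i)
          = - (LINT y|lebesgue_on \<Omega>. (gq y \<bullet> i) * mollifier r (x - y))"
        using that mollifier_test_function[OF r(1) \<Omega> that(2)] i unfolding has_weak_gradient_iff by blast
      then show ?thesis
        unfolding mollifier_derivative_reflect by (simp add: D_def)
    qed
    have 1: "p' x * (LINT y|lebesgue. mollifier r (x - y) * du y) = p' x * (LINT y|lebesgue. D (x - y) * u' y)" for x
    proof (cases "x \<in> K")
      case True
      then have c: "cball x r \<subseteq> K'"
        using d(5)[OF True] r by (meson less_imp_le order_trans subset_cball)
      have "(\<lambda>y. mollifier r (x - y) * du y) = (\<lambda>y. indicator \<Omega> y *\<^sub>R ((gu y \<bullet> i) * mollifier r (x - y)))"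
      proof
        show "mollifier r (x - y) * du y = indicator \<Omega> y *\<^sub>R ((gu y \<bullet> i) * mollifier r (x - y))" for y
          using c d(3) m0[of y x] by (cases "y \<in> cball x r") (auto simp: du_def indicator_def)
      qed
      moreover have "(\<lambda>y. D (x - y) * u' y) = (\<lambda>y. indicator \<Omega> y *\<^sub>R (u y * D (x - y)))"
      proof
        show "D (x - y) * u' y = indicator \<Omega> y *\<^sub>R (u y * D (x - y))" for y
          using c d(3) m0[of y x] by (cases "y \<in> cball x r") (auto simp: u'_def indicator_def)
      qed
      ultimately show ?thesis
        using parts[OF u(1), of x] c d(3) by (simp add: integral_lebesgue_on_eq[OF S(1)])
    qed (simp add: p'_def)
    \<comment> \<open>Unlike in fact \<open>1\<close>, truncated and original integrands agree only
      almost everywhere, because \<open>\<phi>\<close> vanishes off \<open>K\<close> only almost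
      everywhere; this is why measurability has to be checked here.\<close>
    have 2: "u' x * (LINT y|lebesgue. mollifier r (x - y) * dp y) = u' x * (LINT y|lebesgue. D (x - y) * p' y)" for x
    proof (cases "x \<in> K'")
      case True
      then have c: "cball x r \<subseteq> \<Omega>"
        using d'(3)[OF True] d'(2) r by (meson less_imp_le order_trans subset_cball)
      have mt: "(\<lambda>y. mollifier r (x - y)) \<in> test_functions \<Omega>"
        by (rule mollifier_test_function[OF r(1) \<Omega> c])
      have [measurable]: "dp \<in> borel_measurable lebesgue" "p' \<in> borel_measurable lebesgue" using int by auto
      have mm: "(\<lambda>y. k (x - y)) \<in> borel_measurable lebesgue" if "continuous_on UNIV k" for k :: "'a \<Rightarrow> real"
      proof -
        have "continuous_on UNIV (\<lambda>y. k (x - y))"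
          by (intro continuous_on_compose2[OF that] continuous_intros) auto
        then show ?thesis
          using borel_measurable_continuous_onI[of "\<lambda>y. k (x - y)"] by (simp add: measurable_completion)
      qed
      have "(LINT y|lebesgue. mollifier r (x - y) * dp y) = (LINT y|lebesgue. indicator \<Omega> y *\<^sub>R ((gp y \<bullet> i) * mollifier r (x - y)))"
      proof (rule integral_cong_AE)
        show "AE y in lebesgue. mollifier r (x - y) * dp y = indicator \<Omega> y *\<^sub>R ((gp y \<bullet> i) * mollifier r (x - y))"
          using z by eventually_elim (use K(2) in \<open>auto simp: dp_def indicator_def\<close>)
        show "(\<lambda>y. mollifier r (x - y) * dp y) \<in> borel_measurable lebesgue"
          using mm[OF continuous_on_mollifier] by simp
        show "(\<lambda>y. indicator \<Omega> y *\<^sub>R ((gp y \<bullet> i) * mollifier r (x - y))) \<in> borel_measurable lebesgue"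
          using integrable_test_mult(1)[OF \<Omega> loc_integrable_inner[OF loc(4)] mt] 
          unfolding integrable_lebesgue_on_iff[OF S(1)] by blast
      qed
      moreover have "(LINT y|lebesgue. D (x - y) * p' y) = (LINT y|lebesgue. indicator \<Omega> y *\<^sub>R (\<phi> y * D (x - y)))"
      proof (rule integral_cong_AE)
        show "AE y in lebesgue. D (x - y) * p' y = indicator \<Omega> y *\<^sub>R (\<phi> y * D (x - y))"
          using z by eventually_elim (use K(2) in \<open>auto simp: p'_def indicator_def\<close>)
        show "(\<lambda>y. D (x - y) * p' y) \<in> borel_measurable lebesgue"
          using mm[OF Dc] by simp
        have "integrable (lebesgue_on \<Omega>) (\<lambda>y. - (\<phi> y * frechet_derivative (\<lambda>y. mollifier r (x - y)) (at y) i))"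
          by (intro integrable_minus integrable_test_mult(2)[OF \<Omega> loc(3) mt i])
        then show "(\<lambda>y. indicator \<Omega> y *\<^sub>R (\<phi> y * D (x - y))) \<in> borel_measurable lebesgue"
          unfolding integrable_lebesgue_on_iff[OF S(1)] mollifier_derivative_reflect D_def by auto
      qed
      ultimately show ?thesis
        using parts[OF p(1), of x] c by (simp add: integral_lebesgue_on_eq[OF S(1)])
    qed (simp add: u'_def)
    have odd: "D (x - y) = - D (y - x)" for x y
      using mollifier_derivative_odd[of r "y - x" i] by (simp add: D_def)
    have "S2 n = (LINT x|lebesgue. u' x * (LINT y|lebesgue. D (x - y) * p' y))"
      by (simp only: S2_def r_def[symmetric] 2)
    also have "\<dots> = (LINT y|lebesgue. p' y * (LINT x|lebesgue. D (x - y) * u' x))"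
      by (rule Fubini_convolution(1)[OF int(1,3) Dc C])
    also have "\<dots> = - (LINT y|lebesgue. p' y * (LINT x|lebesgue. D (y - x) * u' x))"
      by (subst odd) simp
    also have "\<dots> = - S1 n"
      by (simp only: S1_def r_def[symmetric] 1)
    finally show ?thesis by simp
  qed
  then have "\<forall>\<^sub>F n in sequentially. S1 n + S2 n = 0"
    by (auto simp: eventually_sequentially)
  then have sum0: "(LINT x|lebesgue. p' x * du x) + (LINT x|lebesgue. u' x * dp x) = 0"
    using tendsto_unique[OF trivial_limit_sequentially tendsto_add[OF lim] tendsto_eventually] by blast
  have ip: "integrable lebesgue (\<lambda>x. p' x * du x)" "integrable lebesgue (\<lambda>x. u' x * dp x)"
    using integrable_mult_AE_bounded[OF int(2) _ Cp] integrable_mult_AE_bounded[OF int(4) _ Cu] int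
    by (auto simp: mult.commute)
  have ae: "AE x in lebesgue. indicator \<Omega> x *\<^sub>R (\<phi> x * (gu x \<bullet> i) + u x * (gp x \<bullet> i)) = p' x * du x + u' x * dp x"
    using z by eventually_elim (use K(2) d(3,4) in \<open>auto simp: p'_def u'_def dp_def du_def indicator_def\<close>)
  \<comment> \<open>Measurability is inherited from the truncated integrand, which agrees almost
    everywhere, by completeness of Lebesgue measure.\<close>
  have m: "(\<lambda>x. indicator \<Omega> x *\<^sub>R (\<phi> x * (gu x \<bullet> i) + u x * (gp x \<bullet> i))) \<in> borel_measurable lebesgue"
    by (rule borel_measurable_AE[where f = "\<lambda>x. p' x * du x + u' x * dp x"]) (use ip ae in auto)
  show ?I
    unfolding integrable_lebesgue_on_iff[OF S(1)]
    using integrable_cong_AE[OF m _ ae] ip by auto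
  show ?E
    unfolding integral_lebesgue_on_eq[OF S(1)]
    using integral_cong_AE[OF m _ ae] ip sum0 by auto
qed

section \<open>Inversion in the unit sphere\<close>

text \<open>Since $0/0 = 0$, this is a total involution fixing the origin.\<close>

definition inversion :: "'a::euclidean_space \<Rightarrow> 'a" where
  "inversion x = x /\<^sub>R (norm x)\<^sup>2"

text \<open>For nonzero \<open>x\<close> this is the reflection in the hyperplane orthogonal to
  \<open>x\<close>. Up to the factor \<open>|x|^(-2)\<close> it is the derivative of the inversion,
  which is the source of conformality.\<close>

definition reflect :: "'a::euclidean_space \<Rightarrow> 'a \<Rightarrow> 'a" where
  "reflect x h = h - (2 * (x \<bullet> h) / (x \<bullet> x)) *\<^sub>R x"

lemma inversion_inversion [simp]: "inversion (inversion x) = x"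
  by (cases "x = 0") (simp_all add: inversion_def power2_eq_square field_simps)

lemma inversion_eq_0_iff [simp]: "inversion x = 0 \<longleftrightarrow> x = 0"
  by (simp add: inversion_def)

lemma norm_inversion: "norm (inversion x) = inverse (norm x)"
  by (cases "x = 0") (simp_all add: inversion_def power2_eq_square field_simps)

lemma norm_inversion_powr: "norm (inversion x) powr a = norm x powr (- a)"
  by (simp add: norm_inversion powr_minus inverse_powr)

lemma inj_inversion: "inj inversion"
  by (metis injI inversion_inversion)

lemma mem_inversion_image: "y \<in> inversion ` S \<longleftrightarrow> inversion y \<in> S"
  by (metis image_iff inversion_inversion)

lemma inversion_image_image: "inversion ` inversion ` S = S"
  by (simp add: image_image)

lemma continuous_on_inversion: "0 \<notin> S \<Longrightarrow> continuous_on S inversion"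
  unfolding inversion_def[abs_def] by (intro continuous_intros) auto

lemma open_inversion_image:
  assumes "open S" "0 \<notin> S"
  shows "open (inversion ` S)"
proof -
  have "inversion ` S = - {0} \<inter> inversion -` S"
    using assms(2) by (auto simp: mem_inversion_image)
  then show ?thesis
    using continuous_open_preimage[OF continuous_on_inversion[of "- {0}"] _ assms(1)] by auto
qed

lemma compact_inversion_image: "compact S \<Longrightarrow> 0 \<notin> S \<Longrightarrow> compact (inversion ` S)"
  by (intro compact_continuous_image continuous_on_inversion)

lemma reflect_inner: "reflect x u \<bullet> v = u \<bullet> v - 2 * (x \<bullet> u) * (x \<bullet> v) / (x \<bullet> x)"
  by (simp add: reflect_def inner_diff_left)

lemma reflect_adjoint: "reflect x u \<bullet> v = u \<bullet> reflect x v"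
  by (simp add: reflect_def inner_diff_left inner_diff_right inner_commute)

lemma reflect_reflect [simp]: "reflect x (reflect x h) = h"
  by (cases "x = 0") (simp_all add: reflect_def inner_diff_right algebra_simps flip: scaleR_add_left add_divide_distrib)

lemma reflect_isometry: "reflect x u \<bullet> reflect x v = u \<bullet> v"
  by (simp add: reflect_adjoint)

lemma reflect_self: "x \<noteq> 0 \<Longrightarrow> reflect x x = - x"
  by (simp add: reflect_def algebra_simps scaleR_2)

text \<open>The reflection depends only on the line spanned by \<open>x\<close>, and the inversion
  preserves that line.\<close>

lemma reflect_inversion: "reflect (inversion x) = reflect x"
proof (cases "x = 0")
  case False
  then show ?thesis
    by (auto simp: fun_eq_iff reflect_def inversion_def dot_square_norm power2_eq_square divide_simps)
qed (simp add: inversion_def)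

lemma norm_reflect: "norm (reflect x h) = norm h"
  by (simp add: norm_eq_sqrt_inner reflect_isometry)

lemma linear_reflect: "linear (reflect x)"
  by (rule linearI) (auto simp: reflect_def algebra_simps add_divide_distrib)

lemma reflect_scaleR: "reflect x (c *\<^sub>R h) = c *\<^sub>R reflect x h"
  by (rule linear_cmul[OF linear_reflect])

lemma inversion_has_derivative:
  assumes "x \<noteq> 0"
  shows "(inversion has_derivative (\<lambda>h. reflect x h /\<^sub>R (norm x)\<^sup>2)) (at x within S)"
proof -
  have e: "inversion x = x /\<^sub>R (x \<bullet> x)" for x :: 'a
    by (simp add: inversion_def dot_square_norm)
  have "((\<lambda>x. x /\<^sub>R (x \<bullet> x)) has_derivative
      (\<lambda>h. inverse (x \<bullet> x) *\<^sub>R h - (inverse (x \<bullet> x) * (2 * (x \<bullet> h)) * inverse (x \<bullet> x)) *\<^sub>R x)) (at x within S)"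
    using assms by (auto intro!: derivative_eq_intros simp: fun_eq_iff inner_commute algebra_simps)
  moreover have "inverse (x \<bullet> x) *\<^sub>R h - (inverse (x \<bullet> x) * (2 * (x \<bullet> h)) * inverse (x \<bullet> x)) *\<^sub>R x
      = reflect x h /\<^sub>R (norm x)\<^sup>2" for h
    unfolding reflect_def dot_square_norm[symmetric] by (simp add: scaleR_diff_right divide_inverse mult_ac)
  ultimately show ?thesis
    by (simp add: e[abs_def])
qed

lemma smooth_on_inversion:
  assumes "open S" "0 \<notin> S" 
  shows "smooth_on S (\<lambda>x. inversion x \<bullet> j)"
proof (rule smooth_on_cong[OF assms(1)])
  show "smooth_on S (\<lambda>x. norm x powr (- 2) * (x \<bullet> j))"
    by (intro smooth_on_mult smooth_on_norm_powr smooth_on_inner assms)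
  show "norm x powr (- 2) * (x \<bullet> j) = inversion x \<bullet> j" if "x \<in> S" for x
  proof -
    have "norm x > 0" using that assms(2) by auto
    then show ?thesis by (simp add: inversion_def powr_minus powr_numeral)
  qed
qed

lemma test_functions_inversion:
  assumes \<Omega>: "open \<Omega>" "0 \<notin> \<Omega>" and \<eta>: "\<eta> \<in> test_functions (inversion ` \<Omega>)"
  shows "(\<lambda>x. \<eta> (inversion x)) \<in> test_functions \<Omega>"
proof -
  obtain K where K: "compact K" "K \<subseteq> inversion ` \<Omega>" "\<And>x. x \<notin> K \<Longrightarrow> \<eta> x = 0"
    using test_functions_support[OF \<eta>] by metis
  show ?thesis
  proof (rule test_functionsI[OF \<Omega>(1), of "inversion ` K"])
    show "compact (inversion ` K)"
      using K(1,2) \<Omega>(2) by (intro compact_inversion_image) (auto simp: mem_inversion_image inversion_def)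
    show "inversion ` K \<subseteq> \<Omega>"
      using K(2) by (auto simp: mem_inversion_image)
    show "smooth_on \<Omega> (\<lambda>x. \<eta> (inversion x))"
      by (rule smooth_on_compose[OF \<Omega>(1) open_UNIV _ test_functions_smooth[OF \<eta>] smooth_on_inversion[OF \<Omega>]]) auto
    show "\<eta> (inversion x) = 0" if "x \<notin> inversion ` K" for x
      using that K(3) by (simp add: mem_inversion_image)
  qed
qed

section \<open>Change of variables under the inversion\<close>

lemma det_inversion_derivative:
  fixes x :: "real ^ 'n::{finite,wellorder}"
  assumes "x \<noteq> 0"
  shows "\<bar>det (matrix (\<lambda>h. reflect x h /\<^sub>R (norm x)\<^sup>2))\<bar> = norm x powr (- 2 * real CARD('n))"
proof -
  let ?D = "\<lambda>h. reflect x h /\<^sub>R (norm x)\<^sup>2"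
  have lin: "linear ?D"
    by (rule linear_compose_scale_right[OF linear_reflect])
  \<comment> \<open>The derivative is a scalar multiple of an involution. Its square is a multiple
    of the identity, which yields the square of the determinant without expanding any determinant;
    the absolute value is all that the change of variables uses.\<close>
  have "?D \<circ> ?D = (*\<^sub>R) (inverse (norm x ^ 4))"
    by (auto simp: fun_eq_iff reflect_scaleR power2_eq_square power4_eq_xxxx)
  then have "det (matrix ?D) * det (matrix ?D) = inverse (norm x ^ 4) ^ CARD('n)"
    using matrix_compose[OF lin lin] by (metis det_mul det_matrix_scaleR)
  also have "\<dots> = (norm x powr (- 2 * real CARD('n)))\<^sup>2"
  proof -
    have "(norm x powr (- 2 * real CARD('n)))\<^sup>2 = norm x powr (- 4 * real CARD('n))"
      by (simp add: power2_eq_square flip: powr_add)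
    also have "\<dots> = inverse (norm x powr (real (4 * CARD('n))))"
      by (simp add: powr_minus)
    also have "\<dots> = inverse (norm x ^ 4) ^ CARD('n)"
      using assms by (subst powr_realpow) (simp_all add: power_mult power_inverse)
    finally show ?thesis by simp
  qed
  finally have "(det (matrix ?D))\<^sup>2 = (norm x powr (- 2 * real CARD('n)))\<^sup>2"
    by (simp add: power2_eq_square)
  then show ?thesis
    using power2_eq_iff_nonneg[of "\<bar>det (matrix ?D)\<bar>" "norm x powr (- 2 * real CARD('n))"] by simp
qed

lemma sets_lebesgue_inversion_image:
  fixes S :: "'a::euclidean_space set"
  assumes "S \<in> sets lebesgue" "0 \<notin> S"
  shows "inversion ` S \<in> sets lebesgue"
proof (rule differentiable_image_in_sets_lebesgue[OF assms(1) order_refl])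
  show "inversion differentiable_on S"
    unfolding differentiable_on_def differentiable_def using inversion_has_derivative assms(2) by metis
qed

text \<open>Both claims follow from one equivalence of the form "integrable with integral
  \<open>b\<close>", quantified over \<open>b\<close>. As it transfers integrability in both
  directions, the identity of integrals also holds in the degenerate case, where both sides are 0 by
  convention.\<close>

lemma
  fixes f :: "real ^ 'n::{finite,wellorder} \<Rightarrow> real"
  assumes S: "S \<in> sets lebesgue" "0 \<notin> S"
  shows integrable_inversion: "integrable (lebesgue_on (inversion ` S)) f \<longleftrightarrow>
      integrable (lebesgue_on S) (\<lambda>x. norm x powr (- 2 * real CARD('n)) * f (inversion x))" (is ?I)
    and integral_inversion: "(LINT y|lebesgue_on (inversion ` S). f y) =
      (LINT x|lebesgue_on S. norm x powr (- 2 * real CARD('n)) * f (inversion x))" (is ?E)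
proof -
  let ?T = "inversion ` S"
  let ?F = "\<lambda>x. \<bar>det (matrix (\<lambda>h. reflect x h /\<^sub>R (norm x)\<^sup>2))\<bar> * f (inversion x)"
  let ?G = "\<lambda>x. norm x powr (- 2 * real CARD('n)) * f (inversion x)"
  have T: "?T \<in> sets lebesgue" "0 \<notin> ?T"
    using sets_lebesgue_inversion_image[OF S] S(2) by (auto simp: mem_inversion_image inversion_def)
  have ai: "g absolutely_integrable_on U \<longleftrightarrow> integrable (lebesgue_on U) g"
    if "U \<in> sets lebesgue" for g :: "(real, 'n) vec \<Rightarrow> real" and U
    using that by (simp add: set_integrable_def integrable_restrict_space)
  have FG: "integrable (lebesgue_on S) ?F \<longleftrightarrow> integrable (lebesgue_on S) ?G"
    "integral S ?F = integral S ?G"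
  proof -
    have eq: "?F x = ?G x" if "x \<in> S" for x
      using that S(2) by (subst det_inversion_derivative) auto
    show "integrable (lebesgue_on S) ?F \<longleftrightarrow> integrable (lebesgue_on S) ?G"
      by (rule Bochner_Integration.integrable_cong[OF refl]) (use eq in simp)
    show "integral S ?F = integral S ?G"
      by (rule Henstock_Kurzweil_Integration.integral_cong) (rule eq)
  qed
  have cov: "(?F absolutely_integrable_on S \<and> integral S ?F = b) \<longleftrightarrow>
      (f absolutely_integrable_on ?T \<and> integral ?T f = b)" for b
  proof (rule cov_invertible_real[where h = inversion and h' = "\<lambda>y h. reflect y h /\<^sub>R (norm y)\<^sup>2"])
    show "(inversion has_derivative (\<lambda>h. reflect x h /\<^sub>R (norm x)\<^sup>2)) (at x within S)" if "x \<in> S" for x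
      using that S(2) by (intro inversion_has_derivative) auto
    show "(inversion has_derivative (\<lambda>h. reflect x h /\<^sub>R (norm x)\<^sup>2)) (at x within ?T)" if "x \<in> ?T" for x
      using that T(2) by (intro inversion_has_derivative) auto
    show "(\<lambda>h. reflect y h /\<^sub>R (norm y)\<^sup>2) \<circ> (\<lambda>h. reflect (inversion y) h /\<^sub>R (norm (inversion y))\<^sup>2) = id"
      if "y \<in> ?T" for y
    proof -
      have "y \<noteq> 0" using that T(2) by auto
      then show ?thesis
        by (auto simp: fun_eq_iff reflect_scaleR reflect_inversion norm_inversion power_inverse)
    qed
  qed (auto simp: mem_inversion_image)
  have *: "(integrable (lebesgue_on S) ?G \<and> integral S ?G = b) \<longleftrightarrow>
      (integrable (lebesgue_on ?T) f \<and> integral ?T f = b)" for b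
    using cov[of b] unfolding ai[OF S(1)] ai[OF T(1)] FG .
  then show ?I by blast
  show ?E
  proof (cases "integrable (lebesgue_on S) ?G")
    case True
    then have "integrable (lebesgue_on ?T) f" "integral S ?G = integral ?T f"
      using * by blast+
    then show ?thesis
      using lebesgue_integral_eq_integral[OF True S(1)] lebesgue_integral_eq_integral[OF _ T(1), of f] by simp
  next
    case False
    then have "\<not> integrable (lebesgue_on ?T) f" using * by blast
    then show ?thesis using False by (simp add: not_integrable_integral_eq)
  qed
qed

text \<open>Differentiable maps send negligible sets to negligible sets. The exceptional set
  inherits negligibility from a null set that contains it.\<close>

lemma AE_inversion:
  fixes S :: "'a::euclidean_space set"
  assumes S: "S \<in> sets lebesgue" "0 \<notin> S" and P: "AE x in lebesgue_on S. P x"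
  shows "AE y in lebesgue_on (inversion ` S). P (inversion y)"
proof -
  let ?N = "{x \<in> S. \<not> P x}"
  have "AE x in lebesgue. x \<notin> ?N"
    using P unfolding AE_lebesgue_on_iff[OF S(1)] by eventually_elim auto
  then obtain N where N: "N \<in> null_sets lebesgue" "\<And>x. x \<in> space lebesgue - N \<Longrightarrow> x \<notin> ?N"
    by (rule AE_E3) metis
  have "negligible N" "?N \<subseteq> N"
    using N by (auto simp: negligible_iff_null_sets)
  then have "negligible ?N"
    by (rule negligible_subset)
  then have "negligible (inversion ` ?N)"
  proof (rule negligible_differentiable_image_negligible[OF order_refl])
    show "inversion differentiable_on ?N"
      unfolding differentiable_on_def differentiable_def using inversion_has_derivative S(2) by (metis (mono_tags) mem_Collect_eq)
  qed
  then have "AE y in lebesgue. y \<notin> inversion ` ?N"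
    by (simp add: negligible_iff_null_sets AE_not_in)
  then have "AE y in lebesgue. y \<in> inversion ` S \<longrightarrow> P (inversion y)"
    by eventually_elim (auto simp: mem_inversion_image)
  then show ?thesis
    by (simp add: AE_lebesgue_on_iff sets_lebesgue_inversion_image S)
qed

text \<open>Composition with a continuous map need not preserve Lebesgue measurability. Here each
  preimage is the image of a measurable set under the inversion, and differentiable images of this
  kind stay Lebesgue measurable.\<close>

lemma measurable_inversion:
  fixes S :: "'a::euclidean_space set" and f :: "'a \<Rightarrow> real"
  assumes S: "S \<in> sets lebesgue" "0 \<notin> S" and f: "f \<in> borel_measurable (lebesgue_on S)"
  shows "(\<lambda>y. f (inversion y)) \<in> borel_measurable (lebesgue_on (inversion ` S))"
  unfolding borel_measurable_lebesgue_on_preimage_borel[OF sets_lebesgue_inversion_image[OF S]]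
proof (intro allI impI)
  fix T :: "real set" assume "T \<in> sets borel"
  then have "{x \<in> S. f x \<in> T} \<in> sets lebesgue"
    using f unfolding borel_measurable_lebesgue_on_preimage_borel[OF S(1)] by blast
  then have "inversion ` {x \<in> S. f x \<in> T} \<in> sets lebesgue"
    using S(2) by (intro sets_lebesgue_inversion_image) auto
  also have "inversion ` {x \<in> S. f x \<in> T} = {y \<in> inversion ` S. f (inversion y) \<in> T}"
    by (auto simp: mem_inversion_image)
  finally show "{y \<in> inversion ` S. f (inversion y) \<in> T} \<in> sets lebesgue" .
qed

section \<open>Weak gradients under the inversion\<close>

lemma has_weak_gradient_measurable_on:
  "has_weak_gradient \<Omega> \<phi> g \<Longrightarrow> compact K \<Longrightarrow> K \<subseteq> \<Omega> \<Longrightarrow> g \<in> borel_measurable (lebesgue_on K)"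
  by (auto simp: has_weak_gradient_def)

lemma loc_integrable_inner_mult:
  fixes g X :: "'a::euclidean_space \<Rightarrow> 'a"
  assumes "loc_integrable \<Omega> g" "continuous_on \<Omega> X"
  shows "loc_integrable \<Omega> (\<lambda>x. g x \<bullet> X x)"
proof -
  have "loc_integrable \<Omega> (\<lambda>x. (g x \<bullet> i) * (X x \<bullet> i))" for i
    by (intro loc_integrable_mult loc_integrable_inner assms continuous_intros)
  then have "loc_integrable \<Omega> (\<lambda>x. \<Sum>i\<in>Basis. (g x \<bullet> i) * (X x \<bullet> i))"
    unfolding loc_integrable_def by auto
  then show ?thesis by (simp add: euclidean_inner[symmetric])
qed

lemma continuous_on_reflect:
  "0 \<notin> S \<Longrightarrow> continuous_on S (\<lambda>x. reflect x h)"
  unfolding reflect_def by (intro continuous_intros) auto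

lemma loc_integrable_inversion:
  fixes f :: "real ^ 'n::{finite,wellorder} \<Rightarrow> real"
  assumes \<Omega>: "0 \<notin> \<Omega>" and f: "loc_integrable \<Omega> (\<lambda>x. f (inversion x))"
  shows "loc_integrable (inversion ` \<Omega>) f"
  unfolding loc_integrable_def
proof (intro allI impI)
  fix K :: "(real, 'n) vec set" assume K: "compact K \<and> K \<subseteq> inversion ` \<Omega>"
  define L where "L = inversion ` K"
  have KL: "K = inversion ` L" by (simp add: L_def inversion_image_image)
  have L\<Omega>: "L \<subseteq> \<Omega>" using K by (auto simp: L_def mem_inversion_image)
  have "0 \<notin> K" using K \<Omega> by (auto simp: mem_inversion_image inversion_def)
  then have L: "compact L" using K by (auto simp: L_def compact_inversion_image)
  have "loc_integrable \<Omega> (\<lambda>x. f (inversion x) * norm x powr (- 2 * real CARD('n)))"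
    using \<Omega> by (intro loc_integrable_mult[OF f] continuous_intros) auto
  then have "integrable (lebesgue_on L) (\<lambda>x. norm x powr (- 2 * real CARD('n)) * f (inversion x))"
    using L L\<Omega> by (simp add: loc_integrable_def mult.commute)
  then show "integrable (lebesgue_on K) f"
    unfolding KL using integrable_inversion[of L f] compact_lebesgue[OF L] L\<Omega> \<Omega> by auto
qed

text \<open>Up to sign, \<open>a j x\<close> are the entries of row \<open>i\<close> of the cofactor matrix of the derivative of the
  inversion, so this is the Piola identity.\<close>

lemma inversion_cofactor_divergence:
  fixes x :: "'a::euclidean_space"
  assumes "x \<noteq> 0" "i \<in> Basis"
  defines "a \<equiv> \<lambda>j x. norm x powr (2 - 2 * real DIM('a)) * (i \<bullet> j) - norm x powr (- 2 * real DIM('a)) * (2 * (x \<bullet> i) * (x \<bullet> j))"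
  shows "(\<Sum>j\<in>Basis. frechet_derivative (a j) (at x) j) = 0"
proof -
  define n where "n = real DIM('a)"
  define P where "P = norm x powr (- 2 * n)"
  have P2: "norm x powr (- 2 * n - 2) * (x \<bullet> x) = P"
    using assms(1) by (simp add: P_def dot_square_norm powr_diff powr_numeral)
  have product_rule: "((\<lambda>x. p x * c - q x * (2 * (x \<bullet> i) * (x \<bullet> j))) has_derivative (\<lambda>h. p' h * c -
      (q x * (2 * (h \<bullet> i) * (x \<bullet> j) + 2 * (x \<bullet> i) * (h \<bullet> j)) + q' h * (2 * (x \<bullet> i) * (x \<bullet> j))))) (at x)"
    if "(p has_derivative p') (at x)" "(q has_derivative q') (at x)" for p q :: "'a \<Rightarrow> real" and p' q' c j
    using that by (auto intro!: derivative_eq_intros simp: algebra_simps)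
  have d: "frechet_derivative (a j) (at x) j = (2 - 2 * n) * P * (x \<bullet> j) * (i \<bullet> j)
      + 4 * n * norm x powr (- 2 * n - 2) * (x \<bullet> i) * (x \<bullet> j)\<^sup>2 - 2 * P * (i \<bullet> j) * (x \<bullet> j) - 2 * P * (x \<bullet> i)"
    if j: "j \<in> Basis" for j
  proof -
    have "(a j has_derivative (\<lambda>h. (2 - 2 * n) * norm x powr (2 - 2 * n - 2) * (x \<bullet> h) * (i \<bullet> j)
       - (norm x powr (- 2 * n) * (2 * (h \<bullet> i) * (x \<bullet> j) + 2 * (x \<bullet> i) * (h \<bullet> j))
          + (- 2 * n) * norm x powr (- 2 * n - 2) * (x \<bullet> h) * (2 * (x \<bullet> i) * (x \<bullet> j))))) (at x)"
      unfolding a_def n_def[symmetric]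
      by (rule product_rule[OF has_derivative_norm_powr[OF assms(1)] has_derivative_norm_powr[OF assms(1)]])
    from frechet_derivative_at[OF this, symmetric] show ?thesis
      using j by (simp add: P_def algebra_simps power2_eq_square inner_commute)
  qed
  have s1: "(\<Sum>j\<in>Basis. (x \<bullet> j) * (i \<bullet> j)) = x \<bullet> i"
    by (simp add: euclidean_inner[symmetric])
  have s2: "(\<Sum>j\<in>Basis. (x \<bullet> j)\<^sup>2) = x \<bullet> x"
    by (subst euclidean_inner) (simp add: power2_eq_square)
  have "(\<Sum>j\<in>Basis. frechet_derivative (a j) (at x) j)
    = (\<Sum>j\<in>Basis. (2 - 2 * n) * P * ((x \<bullet> j) * (i \<bullet> j))
      + 4 * n * norm x powr (- 2 * n - 2) * (x \<bullet> i) * (x \<bullet> j)\<^sup>2 - 2 * P * ((x \<bullet> j) * (i \<bullet> j)) - 2 * P * (x \<bullet> i))"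
    by (intro sum.cong) (simp_all add: d mult_ac)
  also have "\<dots> = (2 - 2 * n) * P * (\<Sum>j\<in>Basis. (x \<bullet> j) * (i \<bullet> j))
      + 4 * n * norm x powr (- 2 * n - 2) * (x \<bullet> i) * (\<Sum>j\<in>Basis. (x \<bullet> j)\<^sup>2)
      - 2 * P * (\<Sum>j\<in>Basis. (x \<bullet> j) * (i \<bullet> j)) - 2 * P * (x \<bullet> i) * n"
    by (simp only: sum.distrib sum_subtractf sum_distrib_left sum_constant) (simp add: n_def)
  also have "\<dots> = (2 - 2 * n) * P * (x \<bullet> i) + 4 * n * (norm x powr (- 2 * n - 2) * (x \<bullet> x)) * (x \<bullet> i)
      - 2 * P * (x \<bullet> i) - 2 * P * (x \<bullet> i) * n"
    unfolding s1 s2 by simp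
  \<comment> \<open>After \<open>P2\<close> the coefficients of \<open>P * (x \<bullet> i)\<close>
    are \<open>2 - 2 * n\<close>, \<open>4 * n\<close>, \<open>- 2\<close> and
    \<open>- 2 * n\<close>, which add up to 0.\<close>
  also have "\<dots> = 0"
    unfolding P2 by (simp add: algebra_simps)
  finally show ?thesis .
qed

text \<open>The change of variables turns a partial derivative of \<open>\<eta>\<close>, multiplied
  by the Jacobian, into the divergence of the field with components
  \<open>a j x * \<zeta> x\<close>. Each component is a test function on \<open>\<Omega>\<close>, so
  the definition of the weak gradient of \<open>\<phi>\<close> applies to it.\<close>

lemma has_weak_gradient_inversion:
  fixes \<phi> :: "real ^ 'n::{finite,wellorder} \<Rightarrow> real"
  assumes \<Omega>: "open \<Omega>" "0 \<notin> \<Omega>" and g: "has_weak_gradient \<Omega> \<phi> g"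
  shows "has_weak_gradient (inversion ` \<Omega>) (\<lambda>y. \<phi> (inversion y))
    (\<lambda>y. norm y powr (- 2) *\<^sub>R reflect y (g (inversion y)))"
  unfolding has_weak_gradient_iff
proof (intro conjI ballI)
  have l: "loc_integrable \<Omega> \<phi>" "loc_integrable \<Omega> g"
    using g by (auto simp: has_weak_gradient_iff)
  have S: "\<Omega> \<in> sets lebesgue" using \<Omega> by auto
  show "loc_integrable (inversion ` \<Omega>) (\<lambda>y. \<phi> (inversion y))"
    using l(1) by (intro loc_integrable_inversion[OF \<Omega>(2)]) simp
  have cN: "continuous_on \<Omega> (\<lambda>x. norm x powr a)" for a
    using \<Omega>(2) by (intro continuous_intros) auto
  show "loc_integrable (inversion ` \<Omega>) (\<lambda>y. norm y powr (- 2) *\<^sub>R reflect y (g (inversion y)))"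
  proof (rule loc_integrable_componentwise, rule loc_integrable_inversion[OF \<Omega>(2)])
    fix i :: "(real, 'n) vec"
    \<comment> \<open>Being self-adjoint, the reflection moves onto the constant vector
      \<open>i\<close>, which leaves \<open>g\<close> paired with a continuous vector field.\<close>
    have "loc_integrable \<Omega> (\<lambda>x. (g x \<bullet> reflect x i) * norm x powr 2)"
      by (intro loc_integrable_mult loc_integrable_inner_mult l(2) continuous_on_reflect \<Omega>(2) cN)
    then show "loc_integrable \<Omega> (\<lambda>x. (norm (inversion x) powr (- 2) *\<^sub>R
          reflect (inversion x) (g (inversion (inversion x)))) \<bullet> i)"
      by (simp add: reflect_inversion reflect_adjoint norm_inversion_powr mult.commute)
  qed
  fix \<eta> :: "(real, 'n) vec \<Rightarrow> real" and i :: "(real, 'n) vec"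
  assume \<eta>: "\<eta> \<in> test_functions (inversion ` \<Omega>)" and i: "i \<in> Basis"
  define \<zeta> where "\<zeta> x = \<eta> (inversion x)" for x
  define n where "n = real CARD('n)"
  have nD: "real DIM((real, 'n) vec) = n" by (simp add: n_def)
  have \<zeta>: "\<zeta> \<in> test_functions \<Omega>"
    unfolding \<zeta>_def[abs_def] by (rule test_functions_inversion[OF \<Omega> \<eta>])
  \<comment> \<open>This expanded form makes smoothness evident; fact \<open>a\<close> below
    recovers the geometric form, the components of \<open>reflect x i\<close> times
    \<open>|x|^(2 - 2n)\<close>.\<close>
  define a where "a j x = norm x powr (2 - 2 * n) * (i \<bullet> j) - norm x powr (- 2 * n) * (2 * (x \<bullet> i) * (x \<bullet> j))" for j x
  have sa: "smooth_on \<Omega> (a j)" for j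
    unfolding a_def[abs_def]
    by (intro smooth_on_diff smooth_on_mult smooth_on_norm_powr smooth_on_inner smooth_on_const \<Omega>)
  have a: "a j x = norm x powr (2 - 2 * n) * (reflect x i \<bullet> j)" if "x \<in> \<Omega>" for j x
  proof -
    have x: "x \<noteq> 0" using that \<Omega> by auto
    have "norm x powr (2 - 2 * n) / (x \<bullet> x) = norm x powr (- 2 * n)"
      using powr_diff[of "norm x" "2 - 2 * n" 2] x by (simp add: dot_square_norm powr_numeral)
    then show ?thesis
      unfolding a_def reflect_inner by (simp add: right_diff_distrib flip: times_divide_eq_left)
  qed
  have a\<zeta>: "(\<lambda>x. a j x * \<zeta> x) \<in> test_functions \<Omega>" for j
    by (rule test_functions_mult[OF \<Omega>(1) \<zeta> sa])
  \<comment> \<open>The terms that differentiate \<open>a j\<close> cancel by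
    \<open>inversion_cofactor_divergence\<close>. In the others \<open>reflect x\<close> occurs
    twice and, being an involution, leaves the derivative of \<open>\<eta>\<close> in direction
    \<open>i\<close>.\<close>
  have d\<eta>: "norm x powr (- 2 * n) * frechet_derivative \<eta> (at (inversion x)) i
      = (\<Sum>j\<in>Basis. frechet_derivative (\<lambda>x. a j x * \<zeta> x) (at x) j)" if x: "x \<in> \<Omega>" for x
  proof -
    have x0: "x \<noteq> 0" using x \<Omega> by auto
    let ?D = "frechet_derivative \<eta> (at (inversion x))"
    have "(\<eta> has_derivative ?D) (at (inversion x))"
      using smooth_on_has_derivative[OF test_functions_smooth[OF \<eta>]] by simp
    note D = this and lD = has_derivative_linear[OF this]
    have \<zeta>': "(\<zeta> has_derivative (\<lambda>h. ?D (reflect x h /\<^sub>R (norm x)\<^sup>2))) (at x)"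
      unfolding \<zeta>_def[abs_def] by (rule has_derivative_compose[OF inversion_has_derivative[OF x0] D])
    have "(\<Sum>j\<in>Basis. (reflect x i \<bullet> j) * ?D (reflect x j /\<^sub>R (norm x)\<^sup>2))
        = ?D (\<Sum>j\<in>Basis. (reflect x i \<bullet> j) *\<^sub>R (reflect x j /\<^sub>R (norm x)\<^sup>2))"
      by (simp add: linear_sum[OF lD] linear_cmul[OF lD] mult.assoc)
    also have "(\<Sum>j\<in>Basis. (reflect x i \<bullet> j) *\<^sub>R (reflect x j /\<^sub>R (norm x)\<^sup>2))
        = reflect x (\<Sum>j\<in>Basis. (reflect x i \<bullet> j) *\<^sub>R j) /\<^sub>R (norm x)\<^sup>2"
      by (simp add: linear_sum[OF linear_reflect] reflect_scaleR scaleR_sum_right mult.commute)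
    also have "\<dots> = i /\<^sub>R (norm x)\<^sup>2"
      by (simp add: euclidean_representation)
    finally have e1: "(\<Sum>j\<in>Basis. (reflect x i \<bullet> j) * ?D (reflect x j /\<^sub>R (norm x)\<^sup>2)) = ?D i / (norm x)\<^sup>2"
      by (simp add: linear_cmul[OF lD] divide_inverse mult.commute)
    have "frechet_derivative (\<lambda>x. a j x * \<zeta> x) (at x) j
        = a j x * ?D (reflect x j /\<^sub>R (norm x)\<^sup>2) + frechet_derivative (a j) (at x) j * \<zeta> x" for j
      using frechet_derivative_at[OF has_derivative_mult[OF smooth_on_has_derivative[OF sa x] \<zeta>'], of j]
      by (metis (no_types, lifting))
    then have "(\<Sum>j\<in>Basis. frechet_derivative (\<lambda>x. a j x * \<zeta> x) (at x) j)
      = (\<Sum>j\<in>Basis. a j x * ?D (reflect x j /\<^sub>R (norm x)\<^sup>2)) + (\<Sum>j\<in>Basis. frechet_derivative (a j) (at x) j) * \<zeta> x"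
      by (simp add: sum.distrib sum_distrib_right)
    also have "(\<Sum>j\<in>Basis. frechet_derivative (a j) (at x) j) = 0"
      using inversion_cofactor_divergence[OF x0 i] unfolding nD a_def[abs_def] .
    also have "(\<Sum>j\<in>Basis. a j x * ?D (reflect x j /\<^sub>R (norm x)\<^sup>2))
        = norm x powr (2 - 2 * n) * (\<Sum>j\<in>Basis. (reflect x i \<bullet> j) * ?D (reflect x j /\<^sub>R (norm x)\<^sup>2))"
      by (simp add: a[OF x] sum_distrib_left mult.assoc)
    also have "\<dots> = norm x powr (- 2 * n) * ?D i"
      unfolding e1 using powr_diff[of "norm x" "2 - 2 * n" 2] x0 by (simp add: powr_numeral)
    finally show ?thesis by simp
  qed
  note T = integrable_test_mult[OF \<Omega>(1)]
  have "(LINT y|lebesgue_on (inversion ` \<Omega>). \<phi> (inversion y) * frechet_derivative \<eta> (at y) i)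
    = (LINT x|lebesgue_on \<Omega>. norm x powr (- 2 * n) * (\<phi> x * frechet_derivative \<eta> (at (inversion x)) i))"
    by (subst integral_inversion[OF S \<Omega>(2)]) (simp add: n_def)
  also have "\<dots> = (LINT x|lebesgue_on \<Omega>. (\<Sum>j\<in>Basis. \<phi> x * frechet_derivative (\<lambda>x. a j x * \<zeta> x) (at x) j))"
    using d\<eta> by (intro Bochner_Integration.integral_cong) (auto simp: sum_distrib_left[symmetric] mult.left_commute)
  also have "\<dots> = (\<Sum>j\<in>Basis. (LINT x|lebesgue_on \<Omega>. \<phi> x * frechet_derivative (\<lambda>x. a j x * \<zeta> x) (at x) j))"
    by (intro Bochner_Integration.integral_sum T(2)[OF l(1) a\<zeta>])
  also have "\<dots> = (\<Sum>j\<in>Basis. - (LINT x|lebesgue_on \<Omega>. (g x \<bullet> j) * (a j x * \<zeta> x)))"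
    using g a\<zeta> by (intro sum.cong) (auto simp: has_weak_gradient_iff)
  also have "\<dots> = - (\<Sum>j\<in>Basis. (LINT x|lebesgue_on \<Omega>. (g x \<bullet> j) * (a j x * \<zeta> x)))"
    by (simp add: sum_negf)
  also have "(\<Sum>j\<in>Basis. (LINT x|lebesgue_on \<Omega>. (g x \<bullet> j) * (a j x * \<zeta> x)))
      = (LINT x|lebesgue_on \<Omega>. (\<Sum>j\<in>Basis. (g x \<bullet> j) * (a j x * \<zeta> x)))"
    by (intro Bochner_Integration.integral_sum[symmetric] T(1)[OF loc_integrable_inner[OF l(2)] a\<zeta>])
  also have "\<dots> = (LINT x|lebesgue_on \<Omega>. norm x powr (- 2 * n) *
      (((norm (inversion x) powr (- 2) *\<^sub>R reflect (inversion x) (g (inversion (inversion x)))) \<bullet> i) * \<eta> (inversion x)))"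
  proof (rule Bochner_Integration.integral_cong[OF refl])
    fix x assume "x \<in> space (lebesgue_on \<Omega>)"
    then have x: "x \<in> \<Omega>" by simp
    have "(\<Sum>j\<in>Basis. (g x \<bullet> j) * (a j x * \<zeta> x))
        = norm x powr (2 - 2 * n) * (\<Sum>j\<in>Basis. (g x \<bullet> j) * (reflect x i \<bullet> j)) * \<zeta> x"
      by (simp add: a[OF x] sum_distrib_left sum_distrib_right mult_ac)
    also have "(\<Sum>j\<in>Basis. (g x \<bullet> j) * (reflect x i \<bullet> j)) = reflect x (g x) \<bullet> i"
      by (subst euclidean_inner[symmetric]) (simp add: reflect_adjoint)
    also have "norm x powr (2 - 2 * n) = norm x powr (- 2 * n) * norm x powr 2"
      by (subst powr_add[symmetric]) (simp add: algebra_simps)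
    finally show "(\<Sum>j\<in>Basis. (g x \<bullet> j) * (a j x * \<zeta> x)) = norm x powr (- 2 * n) *
      (((norm (inversion x) powr (- 2) *\<^sub>R reflect (inversion x) (g (inversion (inversion x)))) \<bullet> i) * \<eta> (inversion x))"
      by (simp add: reflect_inversion norm_inversion_powr \<zeta>_def)
  qed
  also have "\<dots> = (LINT y|lebesgue_on (inversion ` \<Omega>). ((norm y powr (- 2) *\<^sub>R reflect y (g (inversion y))) \<bullet> i) * \<eta> y)"
    by (subst integral_inversion[OF S \<Omega>(2)]) (simp add: n_def)
  finally show "(LINT y|lebesgue_on (inversion ` \<Omega>). \<phi> (inversion y) * frechet_derivative \<eta> (at y) i)
    = - (LINT y|lebesgue_on (inversion ` \<Omega>). ((norm y powr (- 2) *\<^sub>R reflect y (g (inversion y))) \<bullet> i) * \<eta> y)" .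
qed

section \<open>The Kelvin transform\<close>

definition kelvin :: "real \<Rightarrow> ('a::euclidean_space \<Rightarrow> real) \<Rightarrow> 'a \<Rightarrow> real" where
  "kelvin m \<phi> y = norm y powr (- m) * \<phi> (inversion y)"

text \<open>The product rule for \<open>norm y powr (- m)\<close> and the inverted function, left
  unsimplified so that it matches the shape of \<open>has_weak_gradient_smooth_mult\<close>.\<close>

definition kelvin_gradient ::
  "real \<Rightarrow> ('a::euclidean_space \<Rightarrow> real) \<Rightarrow> ('a \<Rightarrow> 'a) \<Rightarrow> 'a \<Rightarrow> 'a" where
  "kelvin_gradient m \<phi> g y = norm y powr (- m) *\<^sub>R (norm y powr (- 2) *\<^sub>R reflect y (g (inversion y)))
      + \<phi> (inversion y) *\<^sub>R ((- m * norm y powr (- m - 2)) *\<^sub>R y)"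

lemma kelvin_kelvin: "x \<noteq> 0 \<Longrightarrow> kelvin m (kelvin m \<phi>) x = \<phi> x"
  by (simp add: kelvin_def norm_inversion_powr powr_minus field_simps)

lemma has_weak_gradient_kelvin:
  fixes \<phi> :: "real ^ 'n::{finite,wellorder} \<Rightarrow> real"
  assumes \<Omega>: "open \<Omega>" "0 \<notin> \<Omega>" and g: "has_weak_gradient \<Omega> \<phi> g"
  shows "has_weak_gradient (inversion ` \<Omega>) (kelvin m \<phi>) (kelvin_gradient m \<phi> g)"
proof -
  have 0: "0 \<notin> inversion ` \<Omega>" using \<Omega> by (auto simp: mem_inversion_image inversion_def)
  show ?thesis
    unfolding kelvin_def[abs_def] kelvin_gradient_def[abs_def]
  proof (rule has_weak_gradient_smooth_mult[OF open_inversion_image[OF \<Omega>] has_weak_gradient_inversion[OF assms]])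
    show "smooth_on (inversion ` \<Omega>) (\<lambda>y. norm y powr (- m))"
      by (rule smooth_on_norm_powr[OF 0])
    fix y i assume "y \<in> inversion ` \<Omega>" "i \<in> (Basis :: (real, 'n) vec set)"
    then have "y \<noteq> 0" using 0 by auto
    from frechet_derivative_at[OF has_derivative_norm_powr[OF this, of "- m"], symmetric]
    show "((- m * norm y powr (- m - 2)) *\<^sub>R y) \<bullet> i = frechet_derivative (\<lambda>y. norm y powr (- m)) (at y) i"
      by simp
  qed
qed

section \<open>Square-integrable functions and weights on compact sets\<close>

lemma measurable_lebesgue_on_iff:
  fixes f :: "'a::euclidean_space \<Rightarrow> real"
  shows "S \<in> sets lebesgue \<Longrightarrow>
    f \<in> borel_measurable (lebesgue_on S) \<longleftrightarrow> (\<lambda>x. indicator S x * f x) \<in> borel_measurable lebesgue"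
  using borel_measurable_restrict_space_iff[of S lebesgue f] by simp

lemma L2_on_UNIV_cong_AE:
  assumes "f \<in> L2_on UNIV" "AE x in lebesgue. f x = g x"
  shows "g \<in> L2_on UNIV"
proof -
  have f: "f \<in> borel_measurable lebesgue" "integrable lebesgue (\<lambda>x. (f x)\<^sup>2)"
    using assms(1) by (auto simp: L2_on_def lebesgue_on_UNIV_eq)
  have g: "g \<in> borel_measurable lebesgue"
    by (rule borel_measurable_AE[OF f(1) assms(2)])
  have "integrable lebesgue (\<lambda>x. (g x)\<^sup>2)"
    by (rule integrable_cong_AE_imp[OF f(2)]) (use g assms(2) in \<open>auto elim!: eventually_mono\<close>)
  then show ?thesis using g by (simp add: L2_on_def lebesgue_on_UNIV_eq)
qed

lemma L2_on_iff:
  fixes f :: "'a::euclidean_space \<Rightarrow> real"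
  assumes "S \<in> sets lebesgue"
  shows "f \<in> L2_on S \<longleftrightarrow> (\<lambda>x. indicator S x * f x) \<in> L2_on UNIV"
proof -
  have "(\<lambda>x. (indicator S x * f x)\<^sup>2) = (\<lambda>x. indicator S x *\<^sub>R (f x)\<^sup>2)"
    by (auto simp: indicator_def fun_eq_iff)
  then show ?thesis
    unfolding L2_on_def
    by (simp add: measurable_lebesgue_on_iff[OF assms] integrable_lebesgue_on_iff[OF assms] lebesgue_on_UNIV_eq)
qed

lemma L2_on_bound:
  fixes f h :: "'a::euclidean_space \<Rightarrow> real"
  assumes "f \<in> L2_on S" "h \<in> borel_measurable (lebesgue_on S)" "AE x in lebesgue_on S. \<bar>h x\<bar> \<le> \<bar>f x\<bar>"
  shows "h \<in> L2_on S"
proof -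
  have "integrable (lebesgue_on S) (\<lambda>x. (h x)\<^sup>2)"
  proof (rule Bochner_Integration.integrable_bound)
    show "integrable (lebesgue_on S) (\<lambda>x. (f x)\<^sup>2)" using assms by (simp add: L2_on_def)
    show "AE x in lebesgue_on S. norm ((h x)\<^sup>2) \<le> norm ((f x)\<^sup>2)"
      using assms(3) by eventually_elim (simp add: abs_le_square_iff)
  qed (use assms in simp)
  then show ?thesis using assms by (simp add: L2_on_def)
qed

lemma L2_on_subset:
  fixes f :: "'a::euclidean_space \<Rightarrow> real"
  assumes "f \<in> L2_on S" "S \<in> sets lebesgue" "T \<in> sets lebesgue" "T \<subseteq> S"
  shows "f \<in> L2_on T"
proof -
  have "(\<lambda>x. indicator T x * (indicator S x * f x)) \<in> L2_on UNIV"
    by (rule L2_on_bound[OF assms(1)[unfolded L2_on_iff[OF assms(2)]]])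
      (use assms(1)[unfolded L2_on_iff[OF assms(2)]] assms(3) in \<open>auto simp: L2_on_def indicator_def\<close>)
  also have "(\<lambda>x. indicator T x * (indicator S x * f x)) = (\<lambda>x. indicator T x * f x)"
    using assms(4) by (auto simp: indicator_def fun_eq_iff)
  finally show ?thesis by (simp add: L2_on_iff[OF assms(3)])
qed

lemma L2_on_extend:
  fixes f :: "'a::euclidean_space \<Rightarrow> real"
  assumes "f \<in> L2_on K" "K \<in> sets lebesgue" "S \<in> sets lebesgue" "K \<subseteq> S" "AE x in lebesgue_on (S - K). f x = 0"
  shows "f \<in> L2_on S"
  unfolding L2_on_iff[OF assms(3)]
proof (rule L2_on_UNIV_cong_AE[OF assms(1)[unfolded L2_on_iff[OF assms(2)]]])
  have "AE x in lebesgue. x \<in> S - K \<longrightarrow> f x = 0"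
    using assms(5) AE_lebesgue_on_iff[OF sets.Diff[OF assms(3,2)], of "\<lambda>x. f x = 0"] by simp
  then show "AE x in lebesgue. indicator K x * f x = indicator S x * f x"
    by eventually_elim (use assms(4) in \<open>auto simp: indicator_def\<close>)
qed

lemma L2_on_cong: "(\<And>x. x \<in> S \<Longrightarrow> f x = g x) \<Longrightarrow> f \<in> L2_on S \<longleftrightarrow> g \<in> L2_on S"
  using measurable_cong[of "lebesgue_on S" f g borel]
    Bochner_Integration.integrable_cong[OF refl, of "lebesgue_on S" "\<lambda>x. (f x)\<^sup>2" "\<lambda>x. (g x)\<^sup>2"]
  by (auto simp: L2_on_def)

lemma L2_on_add:
  fixes f g :: "'a::euclidean_space \<Rightarrow> real"
  assumes "f \<in> L2_on S" "g \<in> L2_on S"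
  shows "(\<lambda>x. f x + g x) \<in> L2_on S"
proof -
  have "integrable (lebesgue_on S) (\<lambda>x. (f x + g x)\<^sup>2)"
  proof (rule Bochner_Integration.integrable_bound)
    show "integrable (lebesgue_on S) (\<lambda>x. 2 * (f x)\<^sup>2 + 2 * (g x)\<^sup>2)"
      using assms by (auto simp: L2_on_def)
    show "AE x in lebesgue_on S. norm ((f x + g x)\<^sup>2) \<le> norm (2 * (f x)\<^sup>2 + 2 * (g x)\<^sup>2)"
    proof (rule AE_I2)
      show "norm ((f x + g x)\<^sup>2) \<le> norm (2 * (f x)\<^sup>2 + 2 * (g x)\<^sup>2)" for x
        using zero_le_power2[of "f x - g x"] zero_le_power2[of "f x + g x"] by (simp add: power2_sum power2_diff)
    qed
  qed (use assms in \<open>auto simp: L2_on_def\<close>)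
  then show ?thesis using assms by (auto simp: L2_on_def)
qed

lemma L2_on_mult_continuous:
  fixes f h :: "'a::euclidean_space \<Rightarrow> real"
  assumes "f \<in> L2_on K" "compact K" "continuous_on K h"
  shows "(\<lambda>x. h x * f x) \<in> L2_on K"
proof -
  have "bounded (h ` K)" using assms compact_continuous_image compact_imp_bounded by blast
  then obtain C where C: "\<And>x. x \<in> K \<Longrightarrow> \<bar>h x\<bar> \<le> C" by (auto simp: bounded_iff)
  have hm: "h \<in> borel_measurable (lebesgue_on K)"
    using assms by (intro continuous_imp_measurable_on_sets_lebesgue compact_lebesgue)
  have f: "f \<in> borel_measurable (lebesgue_on K)" "integrable (lebesgue_on K) (\<lambda>x. (f x)\<^sup>2)"
    using assms by (auto simp: L2_on_def)
  show ?thesis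
  proof (rule L2_on_bound)
    show "(\<lambda>x. C * f x) \<in> L2_on K" using f by (simp add: L2_on_def power_mult_distrib)
    show "AE x in lebesgue_on K. \<bar>h x * f x\<bar> \<le> \<bar>C * f x\<bar>"
      using C by (intro AE_I2) (fastforce simp: abs_mult intro!: mult_right_mono)
  qed (use f hm in auto)
qed

lemma continuous_on_norm_powr: "0 \<notin> S \<Longrightarrow> continuous_on S (\<lambda>x::'a::euclidean_space. norm x powr a)"
  by (intro continuous_intros) auto

text \<open>On a compact set without the origin both a power of the norm and its reciprocal are
  bounded, so every weight defines the same space.\<close>

lemma L2_on_weight_iff:
  fixes f :: "'a::euclidean_space \<Rightarrow> real"
  assumes "compact K" "0 \<notin> K"
  shows "(\<lambda>x. norm x powr a * f x) \<in> L2_on K \<longleftrightarrow> f \<in> L2_on K"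
proof
  assume "(\<lambda>x. norm x powr a * f x) \<in> L2_on K"
  then have "(\<lambda>x. norm x powr (- a) * (norm x powr a * f x)) \<in> L2_on K"
    by (rule L2_on_mult_continuous[OF _ assms(1) continuous_on_norm_powr[OF assms(2)]])
  moreover have "norm x powr (- a) * (norm x powr a * f x) = f x" if "x \<in> K" for x
  proof -
    have "x \<noteq> 0" using that assms(2) by auto
    then show ?thesis by (simp add: powr_minus)
  qed
  ultimately show "f \<in> L2_on K" by (simp cong: L2_on_cong)
qed (rule L2_on_mult_continuous[OF _ assms(1) continuous_on_norm_powr[OF assms(2)]])

lemma L2_on_inversion:
  fixes f :: "real ^ 'n::{finite,wellorder} \<Rightarrow> real"
  assumes K: "compact K" "0 \<notin> K" and f: "f \<in> L2_on K"
  shows "(\<lambda>y. f (inversion y)) \<in> L2_on (inversion ` K)"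
proof -
  \<comment> \<open>The square of this weight is the Jacobian of the inversion.\<close>
  have "(\<lambda>x. norm x powr (- real CARD('n)) * f x) \<in> L2_on K"
    using L2_on_weight_iff[OF K] f by blast
  then have "integrable (lebesgue_on K) (\<lambda>x. (norm x powr (- real CARD('n)) * f x)\<^sup>2)"
    by (simp add: L2_on_def)
  also have "(\<lambda>x. (norm x powr (- real CARD('n)) * f x)\<^sup>2) = (\<lambda>x. norm x powr (- 2 * real CARD('n)) * (f x)\<^sup>2)"
    by (simp add: fun_eq_iff power_mult_distrib power2_eq_square flip: powr_add)
  finally show ?thesis
    using measurable_inversion[OF compact_lebesgue[OF K(1)] K(2), of f] f
    by (simp add: L2_on_def integrable_inversion[OF compact_lebesgue[OF K(1)] K(2)])
qed

section \<open>Function spaces under the Kelvin transform\<close>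

lemma weakly_differentiable_iff: "weakly_differentiable \<Omega> \<phi> \<longleftrightarrow> has_weak_gradient \<Omega> \<phi> (weak_gradient \<Omega> \<phi>)"
  unfolding weakly_differentiable_def weak_gradient_def by (metis someI_ex)

lemma zero_notin_inversion_image: "0 \<notin> S \<Longrightarrow> 0 \<notin> inversion ` S"
  by (auto simp: mem_inversion_image inversion_def)

lemma H1_loc_iff:
  fixes \<Omega> :: "'a::euclidean_space set"
  assumes "0 \<notin> \<Omega>"
  shows "\<phi> \<in> H1_loc \<theta> \<Omega> \<longleftrightarrow> weakly_differentiable \<Omega> \<phi> \<and>
    (\<forall>K. compact K \<and> K \<subseteq> \<Omega> \<longrightarrow> \<phi> \<in> L2_on K \<and> (\<lambda>x. norm (weak_gradient \<Omega> \<phi> x)) \<in> L2_on K)"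
proof -
  have "(\<lambda>x. norm x powr (\<theta> / 2) * f x) \<in> L2_on K \<longleftrightarrow> f \<in> L2_on K" if "compact K" "K \<subseteq> \<Omega>" for f K
    using assms that by (intro L2_on_weight_iff) auto
  then show ?thesis unfolding H1_loc_def by auto
qed

lemma H1_c_support:
  fixes \<Omega> :: "'a::euclidean_space set"
  assumes \<Omega>: "open \<Omega>" "0 \<notin> \<Omega>" and "\<phi> \<in> H1_c \<theta> \<Omega>"
  obtains K where "compact K" "K \<subseteq> \<Omega>" "AE x in lebesgue_on (\<Omega> - K). \<phi> x = 0"
    "weakly_differentiable \<Omega> \<phi>" "\<phi> \<in> L2_on K" "(\<lambda>x. norm (weak_gradient \<Omega> \<phi> x)) \<in> L2_on K"
proof -
  obtain K where K: "compact K" "K \<subseteq> \<Omega>" "AE x in lebesgue_on (\<Omega> - K). \<phi> x = 0"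
    using assms by (auto simp: H1_c_def)
  have "f \<in> L2_on K" if "(\<lambda>x. norm x powr (\<theta> / 2) * f x) \<in> L2_on \<Omega>" for f
    using L2_on_subset[OF that _ compact_lebesgue[OF K(1)] K(2)] L2_on_weight_iff[OF K(1), of "\<theta> / 2" f] \<Omega> K(2) by auto
  then show thesis
    using that[OF K] assms(3) by (auto simp: H1_c_def H1_def)
qed

text \<open>The gradient vanishes almost everywhere off \<open>K\<close> together with the function,
  so the weighted norms over \<open>\<Omega>\<close> are norms over \<open>K\<close>, where the
  weight is harmless.\<close>

lemma H1_cI:
  fixes \<Omega> :: "'a::euclidean_space set"
  assumes \<Omega>: "open \<Omega>" "0 \<notin> \<Omega>" and K: "compact K" "K \<subseteq> \<Omega>" "AE x in lebesgue_on (\<Omega> - K). \<phi> x = 0"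
    and \<phi>: "weakly_differentiable \<Omega> \<phi>" "\<phi> \<in> L2_on K" "(\<lambda>x. norm (weak_gradient \<Omega> \<phi> x)) \<in> L2_on K"
  shows "\<phi> \<in> H1_c \<theta> \<Omega>"
proof -
  have o: "open (\<Omega> - K)" using \<Omega>(1) K(1) by (intro open_Diff compact_imp_closed)
  have g0: "AE x in lebesgue_on (\<Omega> - K). weak_gradient \<Omega> \<phi> x = 0"
    using weak_gradient_vanishes[OF \<Omega>(1) o Diff_subset _ K(3)] \<phi>(1) by (simp add: weakly_differentiable_iff)
  have *: "(\<lambda>x. norm x powr (\<theta> / 2) * f x) \<in> L2_on \<Omega>"
    if "f \<in> L2_on K" "AE x in lebesgue_on (\<Omega> - K). f x = 0" for f
  proof (rule L2_on_extend[OF _ compact_lebesgue[OF K(1)] _ K(2)])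
    show "(\<lambda>x. norm x powr (\<theta> / 2) * f x) \<in> L2_on K"
      using L2_on_weight_iff[OF K(1)] that(1) \<Omega>(2) K(2) by blast
    show "AE x in lebesgue_on (\<Omega> - K). norm x powr (\<theta> / 2) * f x = 0"
      using that(2) by eventually_elim simp
  qed (use \<Omega> in auto)
  have "AE x in lebesgue_on (\<Omega> - K). norm (weak_gradient \<Omega> \<phi> x) = 0"
    using g0 by eventually_elim simp
  then show ?thesis
    using * \<phi> K unfolding H1_c_def H1_def by blast
qed

text \<open>\<open>G\<close> is an arbitrary weak gradient of the transform because
  \<open>weak_gradient\<close> is merely some choice. Uniqueness identifies it almost everywhere
  with \<open>kelvin_gradient\<close>, and since the reflection is isometric, the norm of the latter
  is bounded by weighted copies of the norm of \<open>g\<close> and of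
  \<open>\<phi>\<close>.\<close>

lemma kelvin_L2_on:
  fixes \<phi> :: "real ^ 'n::{finite,wellorder} \<Rightarrow> real"
  assumes \<Omega>: "open \<Omega>" "0 \<notin> \<Omega>" and g: "has_weak_gradient \<Omega> \<phi> g"
    and G: "has_weak_gradient (inversion ` \<Omega>) (kelvin m \<phi>) G"
    and K: "compact K" "K \<subseteq> \<Omega>" and L2: "\<phi> \<in> L2_on K" "(\<lambda>x. norm (g x)) \<in> L2_on K"
  shows "kelvin m \<phi> \<in> L2_on (inversion ` K)" "(\<lambda>y. norm (G y)) \<in> L2_on (inversion ` K)"
proof -
  have K0: "0 \<notin> K" using K \<Omega> by auto
  have IK: "compact (inversion ` K)" "0 \<notin> inversion ` K" "inversion ` K \<subseteq> inversion ` \<Omega>"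
    using compact_inversion_image[OF K(1) K0] zero_notin_inversion_image[OF K0] K by auto
  note I = L2_on_inversion[OF K(1) K0 L2(1)] L2_on_inversion[OF K(1) K0 L2(2)]
  note W = L2_on_mult_continuous[OF _ IK(1) continuous_on_norm_powr[OF IK(2)]]
  show "kelvin m \<phi> \<in> L2_on (inversion ` K)"
    unfolding kelvin_def[abs_def] by (rule W[OF I(1)])
  have "(\<lambda>y. norm y powr (- m - 2) * norm (g (inversion y)) + \<bar>m\<bar> * (norm y powr (- m - 1) * \<bar>\<phi> (inversion y)\<bar>))
      \<in> L2_on (inversion ` K)" (is "?b \<in> _")
  proof (rule L2_on_add[OF W[OF I(2)]])
    have "(\<lambda>y. \<bar>\<phi> (inversion y)\<bar>) \<in> L2_on (inversion ` K)"
      by (rule L2_on_bound[OF I(1)]) (use I(1) in \<open>auto simp: L2_on_def\<close>)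
    from L2_on_mult_continuous[OF W[OF this, of "- m - 1"] IK(1) continuous_on_const]
    show "(\<lambda>y. \<bar>m\<bar> * (norm y powr (- m - 1) * \<bar>\<phi> (inversion y)\<bar>)) \<in> L2_on (inversion ` K)" .
  qed
  then show "(\<lambda>y. norm (G y)) \<in> L2_on (inversion ` K)"
  proof (rule L2_on_bound)
    show "(\<lambda>y. norm (G y)) \<in> borel_measurable (lebesgue_on (inversion ` K))"
      using has_weak_gradient_measurable_on[OF G IK(1,3)] by simp
    have "AE y in lebesgue_on (inversion ` \<Omega>). G y = kelvin_gradient m \<phi> g y"
      by (rule has_weak_gradient_unique[OF open_inversion_image[OF \<Omega>] G has_weak_gradient_kelvin[OF \<Omega> g]]) simp
    then have "AE y in lebesgue_on (inversion ` K). G y = kelvin_gradient m \<phi> g y"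
      by (rule AE_lebesgue_on_subset) (use open_inversion_image[OF \<Omega>] compact_lebesgue[OF IK(1)] IK(3) in auto)
    then show "AE y in lebesgue_on (inversion ` K). \<bar>norm (G y)\<bar> \<le> \<bar>?b y\<bar>"
    proof eventually_elim
      case (elim y)
      have "norm (kelvin_gradient m \<phi> g y) \<le> ?b y"
      proof (cases "y = 0")
        case False
        have "- m - 1 = (- m - 2) + 1" by simp
        then have e: "norm y powr (- m) * norm y powr (- 2) = norm y powr (- m - 2)"
          "norm y powr (- m - 2) * norm y = norm y powr (- m - 1)"
          by (simp flip: powr_add, simp only: powr_add) simp
        have "norm (kelvin_gradient m \<phi> g y) \<le> norm (norm y powr (- m) *\<^sub>R (norm y powr (- 2) *\<^sub>R reflect y (g (inversion y))))
           + norm (\<phi> (inversion y) *\<^sub>R ((- m * norm y powr (- m - 2)) *\<^sub>R y))"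
          unfolding kelvin_gradient_def by (rule norm_triangle_ineq)
        also have "\<dots> = (norm y powr (- m) * norm y powr (- 2)) * norm (g (inversion y))
            + \<bar>m\<bar> * ((norm y powr (- m - 2) * norm y) * \<bar>\<phi> (inversion y)\<bar>)"
          by (simp add: norm_reflect abs_mult)
        finally show ?thesis unfolding e .
      qed (simp add: kelvin_gradient_def)
      then show ?case using elim by (simp add: abs_of_nonneg)
    qed
  qed
qed

lemma weakly_differentiable_kelvin:
  fixes \<phi> :: "real ^ 'n::{finite,wellorder} \<Rightarrow> real"
  assumes "open \<Omega>" "0 \<notin> \<Omega>" "weakly_differentiable \<Omega> \<phi>"
  shows "weakly_differentiable (inversion ` \<Omega>) (kelvin m \<phi>)"
  using has_weak_gradient_kelvin[OF assms(1,2)] assms(3) unfolding weakly_differentiable_def by blast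

lemma H1_loc_kelvin:
  fixes \<phi> :: "real ^ 'n::{finite,wellorder} \<Rightarrow> real"
  assumes \<Omega>: "open \<Omega>" "0 \<notin> \<Omega>" and \<phi>: "\<phi> \<in> H1_loc \<theta> \<Omega>"
  shows "kelvin m \<phi> \<in> H1_loc \<theta> (inversion ` \<Omega>)"
  unfolding H1_loc_iff[OF zero_notin_inversion_image[OF \<Omega>(2)]]
proof (intro conjI allI impI)
  have wd: "weakly_differentiable \<Omega> \<phi>" using \<phi> by (simp add: H1_loc_def)
  then show W: "weakly_differentiable (inversion ` \<Omega>) (kelvin m \<phi>)"
    by (rule weakly_differentiable_kelvin[OF \<Omega>])
  fix K :: "(real, 'n) vec set" assume "compact K \<and> K \<subseteq> inversion ` \<Omega>"
  then have K: "compact K" "K \<subseteq> inversion ` \<Omega>" by auto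
  have "0 \<notin> K" using K zero_notin_inversion_image[OF \<Omega>(2)] by auto
  then have L: "compact (inversion ` K)" "inversion ` K \<subseteq> \<Omega>"
    using compact_inversion_image[OF K(1)] K(2) by (auto simp: mem_inversion_image)
  note * = kelvin_L2_on[OF \<Omega> wd[unfolded weakly_differentiable_iff] W[unfolded weakly_differentiable_iff] L,
      unfolded inversion_image_image]
  have "\<phi> \<in> L2_on (inversion ` K)" "(\<lambda>x. norm (weak_gradient \<Omega> \<phi> x)) \<in> L2_on (inversion ` K)"
    using \<phi> L unfolding H1_loc_iff[OF \<Omega>(2)] by auto
  then show "kelvin m \<phi> \<in> L2_on K" "(\<lambda>y. norm (weak_gradient (inversion ` \<Omega>) (kelvin m \<phi>) y)) \<in> L2_on K"
    using * by auto
qed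

lemma H1_c_kelvin:
  fixes \<phi> :: "real ^ 'n::{finite,wellorder} \<Rightarrow> real"
  assumes \<Omega>: "open \<Omega>" "0 \<notin> \<Omega>" and \<phi>: "\<phi> \<in> H1_c \<theta> \<Omega>"
  shows "kelvin m \<phi> \<in> H1_c \<theta> (inversion ` \<Omega>)"
proof -
  obtain K where K: "compact K" "K \<subseteq> \<Omega>" "AE x in lebesgue_on (\<Omega> - K). \<phi> x = 0"
    "weakly_differentiable \<Omega> \<phi>" "\<phi> \<in> L2_on K" "(\<lambda>x. norm (weak_gradient \<Omega> \<phi> x)) \<in> L2_on K"
    using H1_c_support[OF \<Omega> \<phi>] by metis
  note W = weakly_differentiable_kelvin[OF \<Omega> K(4), of m]
  note wg = K(4)[unfolded weakly_differentiable_iff] W[unfolded weakly_differentiable_iff]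
  show ?thesis
  proof (rule H1_cI[of _ "inversion ` K"])
    show "open (inversion ` \<Omega>)" "0 \<notin> inversion ` \<Omega>"
      by (rule open_inversion_image[OF \<Omega>], rule zero_notin_inversion_image[OF \<Omega>(2)])
    show "compact (inversion ` K)" "inversion ` K \<subseteq> inversion ` \<Omega>"
      using compact_inversion_image[OF K(1)] K(2) \<Omega>(2) by auto
    show "weakly_differentiable (inversion ` \<Omega>) (kelvin m \<phi>)" by (rule W)
    show "kelvin m \<phi> \<in> L2_on (inversion ` K)"
      "(\<lambda>y. norm (weak_gradient (inversion ` \<Omega>) (kelvin m \<phi>) y)) \<in> L2_on (inversion ` K)"
      using kelvin_L2_on[OF \<Omega> wg K(1,2,5,6)] by auto
    have "AE y in lebesgue_on (inversion ` (\<Omega> - K)). \<phi> (inversion y) = 0"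
      by (rule AE_inversion[OF _ _ K(3)]) (use \<Omega> compact_lebesgue[OF K(1)] in auto)
    then have "AE y in lebesgue_on (inversion ` (\<Omega> - K)). kelvin m \<phi> y = 0"
      by eventually_elim (simp add: kelvin_def)
    then show "AE y in lebesgue_on (inversion ` \<Omega> - inversion ` K). kelvin m \<phi> y = 0"
      unfolding image_set_diff[OF inj_inversion] .
  qed
qed

lemma Linf_loc_smooth_mult:
  fixes h :: "'a::euclidean_space \<Rightarrow> real"
  assumes \<Omega>: "open \<Omega>" and h: "continuous_on \<Omega> h" and f: "f \<in> Linf_loc \<Omega>"
  shows "(\<lambda>x. h x * f x) \<in> Linf_loc \<Omega>"
  unfolding Linf_loc_def
proof (intro CollectI conjI allI impI)
  have "h \<in> borel_measurable (lebesgue_on \<Omega>)"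
    using h \<Omega> by (intro continuous_imp_measurable_on_sets_lebesgue) auto
  then show "(\<lambda>x. h x * f x) \<in> borel_measurable (lebesgue_on \<Omega>)"
    using f by (auto simp: Linf_loc_def)
  fix K assume K: "compact K \<and> K \<subseteq> \<Omega>"
  then obtain C where C: "AE x in lebesgue_on K. \<bar>f x\<bar> \<le> C" using f by (auto simp: Linf_loc_def)
  have "bounded (h ` K)"
    using K h compact_continuous_image compact_imp_bounded continuous_on_subset by metis
  then obtain D where D: "\<And>x. x \<in> K \<Longrightarrow> \<bar>h x\<bar> \<le> D" by (auto simp: bounded_iff)
  have "AE x in lebesgue_on K. x \<in> K" by (rule AE_I2) simp
  with C have "AE x in lebesgue_on K. \<bar>h x * f x\<bar> \<le> D * C"
  proof eventually_elim
    case (elim x)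
    then show ?case using D[OF elim(2)] unfolding abs_mult by (intro mult_mono) auto
  qed
  then show "\<exists>C. AE x in lebesgue_on K. \<bar>h x * f x\<bar> \<le> C" by blast
qed

lemma Linf_loc_kelvin:
  fixes \<phi> :: "'a::euclidean_space \<Rightarrow> real"
  assumes \<Omega>: "open \<Omega>" "0 \<notin> \<Omega>" and \<phi>: "\<phi> \<in> Linf_loc \<Omega>"
  shows "kelvin m \<phi> \<in> Linf_loc (inversion ` \<Omega>)"
  unfolding kelvin_def[abs_def]
proof (rule Linf_loc_smooth_mult[OF open_inversion_image[OF \<Omega>]])
  have 0: "0 \<notin> inversion ` \<Omega>" by (rule zero_notin_inversion_image[OF \<Omega>(2)])
  then show "continuous_on (inversion ` \<Omega>) (\<lambda>y. norm y powr (- m))" by (rule continuous_on_norm_powr)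
  show "(\<lambda>y. \<phi> (inversion y)) \<in> Linf_loc (inversion ` \<Omega>)"
    unfolding Linf_loc_def
  proof (intro CollectI conjI allI impI)
    show "(\<lambda>y. \<phi> (inversion y)) \<in> borel_measurable (lebesgue_on (inversion ` \<Omega>))"
      using \<Omega> \<phi> by (intro measurable_inversion) (auto simp: Linf_loc_def)
    fix K assume "compact K \<and> K \<subseteq> inversion ` \<Omega>"
    then have K: "compact K" "K \<subseteq> inversion ` \<Omega>" by auto
    have "0 \<notin> K" using K 0 by auto
    then have L: "compact (inversion ` K)" "inversion ` K \<subseteq> \<Omega>" "0 \<notin> inversion ` K"
      using compact_inversion_image[OF K(1)] K(2) zero_notin_inversion_image by (auto simp: mem_inversion_image)
    then obtain C where "AE x in lebesgue_on (inversion ` K). \<bar>\<phi> x\<bar> \<le> C"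
      using \<phi> by (auto simp: Linf_loc_def)
    from AE_inversion[OF compact_lebesgue[OF L(1)] L(3) this]
    show "\<exists>C. AE y in lebesgue_on K. \<bar>\<phi> (inversion y)\<bar> \<le> C"
      unfolding inversion_image_image by blast
  qed
qed

text \<open>No measurability is needed: Lebesgue measure is complete, and non-measurable functions have
  integral zero.\<close>

lemma integral_cong_AE_lebesgue_on:
  fixes f g :: "'a::euclidean_space \<Rightarrow> real"
  assumes S: "S \<in> sets lebesgue" and ae: "AE x in lebesgue_on S. f x = g x"
  shows "integral\<^sup>L (lebesgue_on S) f = integral\<^sup>L (lebesgue_on S) g"
proof -
  let ?i = "\<lambda>f x. indicator S x *\<^sub>R (f x :: real)"
  have ae': "AE x in lebesgue. ?i f x = ?i g x"
    using ae unfolding AE_lebesgue_on_iff[OF S] by eventually_elim (auto simp: indicator_def)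
  then have ae'': "AE x in lebesgue. ?i g x = ?i f x" by eventually_elim (rule sym)
  show ?thesis
    unfolding integral_lebesgue_on_eq[OF S]
  proof (cases "?i f \<in> borel_measurable lebesgue")
    case True
    then show "integral\<^sup>L lebesgue (?i f) = integral\<^sup>L lebesgue (?i g)"
      using borel_measurable_AE[OF True ae'] ae' by (intro integral_cong_AE)
  next
    case False
    then have "?i g \<notin> borel_measurable lebesgue"
      using borel_measurable_AE[OF _ ae''] by blast
    then show "integral\<^sup>L lebesgue (?i f) = integral\<^sup>L lebesgue (?i g)"
      using False by (metis borel_measurable_integrable not_integrable_integral_eq)
  qed
qed

section \<open>The bilinear form under the Kelvin transform\<close>

lemma radial_integration_by_parts:
  fixes \<Omega> :: "'a::euclidean_space set" and \<theta> :: real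
  assumes \<Omega>: "open \<Omega>" "0 \<notin> \<Omega>" and u: "has_weak_gradient \<Omega> u gu" "u \<in> Linf_loc \<Omega>"
    and p: "has_weak_gradient \<Omega> \<phi> gp" "\<phi> \<in> Linf_loc \<Omega>"
    and K: "compact K" "K \<subseteq> \<Omega>" "AE x in lebesgue_on (\<Omega> - K). \<phi> x = 0"
  defines "W \<equiv> \<lambda>x. norm x powr (\<theta> - 2) * (\<phi> x * (gu x \<bullet> x) + u x * (gp x \<bullet> x) + (real DIM('a) - 2 + \<theta>) * (u x * \<phi> x))"
  shows "integrable (lebesgue_on \<Omega>) W" "integral\<^sup>L (lebesgue_on \<Omega>) W = 0"
proof -
  \<comment> \<open>\<open>F i\<close> are the components of the field
    \<open>|x|^(theta-2) x\<close> and \<open>F'\<close> are their gradients. The smooth factor is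
    absorbed into \<open>\<phi>\<close>, so that integration by parts in direction \<open>i\<close>
    gives the \<open>i\<close>-th term of the divergence of \<open>|x|^(theta-2) u phi x\<close>;
    \<open>W\<close> is that divergence.\<close>
  define F where "F i x = norm x powr (\<theta> - 2) * (x \<bullet> i)" for i x :: 'a
  define F' where "F' i x = norm x powr (\<theta> - 2) *\<^sub>R i + ((\<theta> - 2) * norm x powr (\<theta> - 4) * (x \<bullet> i)) *\<^sub>R x" for i x :: 'a
  define W' where "W' i x = (F i x * \<phi> x) * (gu x \<bullet> i) + u x * ((F i x *\<^sub>R gp x + \<phi> x *\<^sub>R F' i x) \<bullet> i)" for i x
  have sF: "smooth_on \<Omega> (F i)" for i
    unfolding F_def[abs_def] by (intro smooth_on_mult smooth_on_norm_powr smooth_on_inner \<Omega>)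
  have F': "F' i x \<bullet> j = frechet_derivative (F i) (at x) j" if "x \<in> \<Omega>" for i j x
  proof -
    have "x \<noteq> 0" using that \<Omega> by auto
    note d = has_derivative_mult[OF has_derivative_norm_powr[OF this, of "\<theta> - 2"]
        bounded_linear.has_derivative[OF bounded_linear_inner_left has_derivative_ident], of i]
    show ?thesis
      using frechet_derivative_at[OF d, symmetric] unfolding F_def[abs_def] F'_def
      by (simp add: inner_add_left inner_commute algebra_simps)
  qed
  have W': "integrable (lebesgue_on \<Omega>) (W' i)" "integral\<^sup>L (lebesgue_on \<Omega>) (W' i) = 0" if i: "i \<in> Basis" for i
  proof -
    have "has_weak_gradient \<Omega> (\<lambda>x. F i x * \<phi> x) (\<lambda>x. F i x *\<^sub>R gp x + \<phi> x *\<^sub>R F' i x)"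
      by (rule has_weak_gradient_smooth_mult[OF \<Omega>(1) p(1) sF F'])
    moreover have "(\<lambda>x. F i x * \<phi> x) \<in> Linf_loc \<Omega>"
      by (rule Linf_loc_smooth_mult[OF \<Omega>(1) smooth_on_continuous_on[OF sF] p(2)])
    moreover have "AE x in lebesgue_on (\<Omega> - K). F i x * \<phi> x = 0"
      using K(3) by eventually_elim simp
    ultimately show "integrable (lebesgue_on \<Omega>) (W' i)" "integral\<^sup>L (lebesgue_on \<Omega>) (W' i) = 0"
      unfolding W'_def[abs_def]
      using weak_integration_by_parts[OF \<Omega>(1) u _ _ K(1,2) _ i] by blast+
  qed
  have WW': "W x = (\<Sum>i\<in>Basis. W' i x)" if "x \<in> \<Omega>" for x
  proof -
    define P Q where "P = norm x powr (\<theta> - 2)" and "Q = norm x powr (\<theta> - 4)"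
    have "x \<noteq> 0" using that \<Omega> by auto
    \<comment> \<open>The divergence of the field is N times \<open>P\<close> plus
      \<open>(\<theta> - 2) * Q * (x \<bullet> x)\<close>; with this identity it becomes
      \<open>P\<close> times \<open>N - 2 + \<theta>\<close>.\<close>
    then have P: "Q * (x \<bullet> x) = P"
      using powr_add[of "norm x" "\<theta> - 4" 2] by (simp add: P_def Q_def dot_square_norm)
    have s: "(\<Sum>i\<in>Basis. (x \<bullet> i) * (g \<bullet> i)) = g \<bullet> x" for g :: 'a
      by (simp only: inner_commute[of g x] euclidean_inner[of x g])
    have "(\<Sum>i\<in>Basis. W' i x) = (\<Sum>i\<in>Basis. P * \<phi> x * ((x \<bullet> i) * (gu x \<bullet> i)) + P * u x * ((x \<bullet> i) * (gp x \<bullet> i))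
       + (u x * \<phi> x * P + u x * \<phi> x * (\<theta> - 2) * Q * ((x \<bullet> i) * (x \<bullet> i))))"
    proof (rule sum.cong[OF refl])
      fix i :: 'a assume "i \<in> Basis"
      then have "i \<bullet> i = 1" by simp
      then show "W' i x = P * \<phi> x * ((x \<bullet> i) * (gu x \<bullet> i)) + P * u x * ((x \<bullet> i) * (gp x \<bullet> i))
         + (u x * \<phi> x * P + u x * \<phi> x * (\<theta> - 2) * Q * ((x \<bullet> i) * (x \<bullet> i)))"
        unfolding W'_def F_def F'_def P_def[symmetric] Q_def[symmetric] inner_add_left inner_scaleR_left
        by algebra
    qed
    also have "\<dots> = P * \<phi> x * (gu x \<bullet> x) + P * u x * (gp x \<bullet> x)
       + (real DIM('a) * (u x * \<phi> x * P) + u x * \<phi> x * (\<theta> - 2) * Q * (x \<bullet> x))"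
      by (simp only: sum.distrib sum_distrib_left[symmetric] s sum_constant) simp
    also have "\<dots> = P * \<phi> x * (gu x \<bullet> x) + P * u x * (gp x \<bullet> x)
       + (real DIM('a) * (u x * \<phi> x * P) + u x * \<phi> x * (\<theta> - 2) * (Q * (x \<bullet> x)))"
      by simp
    also have "\<dots> = W x"
      unfolding P by (simp add: W_def P_def algebra_simps)
    finally show ?thesis by simp
  qed
  have "integrable (lebesgue_on \<Omega>) W \<longleftrightarrow> integrable (lebesgue_on \<Omega>) (\<lambda>x. \<Sum>i\<in>Basis. W' i x)"
    by (rule Bochner_Integration.integrable_cong) (auto simp: WW')
  then show "integrable (lebesgue_on \<Omega>) W" using W' by simp
  have "integral\<^sup>L (lebesgue_on \<Omega>) W = (LINT x|lebesgue_on \<Omega>. (\<Sum>i\<in>Basis. W' i x))"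
    by (rule Bochner_Integration.integral_cong) (auto simp: WW')
  then show "integral\<^sup>L (lebesgue_on \<Omega>) W = 0" using W' by simp
qed

text \<open>Two properties of the reflection are used. It is isometric, which gives the leading
  term; and it maps \<open>x\<close> to \<open>- x\<close>, which makes the cross terms radial
  derivatives and cancels the minus sign of the exponent \<open>- m\<close>.\<close>

lemma kelvin_gradient_inner:
  fixes x :: "'a::euclidean_space"
  assumes "x \<noteq> 0"
  shows "kelvin_gradient m u gu (inversion x) \<bullet> kelvin_gradient m \<phi> gp (inversion x)
    = norm x powr (2 * m + 4) * (gu x \<bullet> gp x)
      + m * norm x powr (2 * m + 2) * (\<phi> x * (gu x \<bullet> x) + u x * (gp x \<bullet> x) + m * (u x * \<phi> x))"
proof -
  have n: "norm x > 0" using assms by simp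
  have k: "kelvin_gradient m f g (inversion x)
      = norm x powr (m + 2) *\<^sub>R reflect x (g x) - (m * f x * norm x powr m) *\<^sub>R x" for f g
  proof -
    define a b where "a = norm x powr m" and "b = norm x powr (m + 2)"
    have "b = a * (norm x)\<^sup>2" "norm (inversion x) powr (- m) = a" "norm (inversion x) powr (- m - 2) = b"
      "norm (inversion x) powr (- 2) = (norm x)\<^sup>2"
      using n by (simp_all add: a_def b_def norm_inversion_powr powr_add add.commute[of 2])
    moreover from this have "kelvin_gradient m f g (inversion x)
        = a *\<^sub>R ((norm x)\<^sup>2 *\<^sub>R reflect x (g x)) + f x *\<^sub>R ((- m * b) *\<^sub>R inversion x)"
      by (simp only: kelvin_gradient_def reflect_inversion inversion_inversion)
    ultimately show ?thesis
      using n unfolding a_def[symmetric] b_def[symmetric] by (simp add: inversion_def)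
  qed
  have r: "reflect x g \<bullet> x = - (g \<bullet> x)" "x \<bullet> reflect x g = - (g \<bullet> x)" for g
    using reflect_self[OF assms] by (simp_all add: reflect_adjoint inner_commute[of x])
  have e: "norm x powr (2 * m + 4) = norm x powr (m + 2) * norm x powr (m + 2)"
    "norm x powr (2 * m + 2) = norm x powr (m + 2) * norm x powr m"
    "norm x powr (2 * m + 2) = norm x powr m * norm x powr m * (x \<bullet> x)"
    using n by (simp_all add: dot_square_norm algebra_simps flip: powr_add powr_numeral)
  have "kelvin_gradient m u gu (inversion x) \<bullet> kelvin_gradient m \<phi> gp (inversion x)
    = (norm x powr (m + 2) * norm x powr (m + 2)) * (gu x \<bullet> gp x)
      + m * (norm x powr (m + 2) * norm x powr m) * (\<phi> x * (gu x \<bullet> x) + u x * (gp x \<bullet> x))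
      + m * (norm x powr m * norm x powr m * (x \<bullet> x)) * (m * (u x * \<phi> x))"
    unfolding k by (simp add: inner_diff_left inner_diff_right reflect_isometry r algebra_simps)
  then show ?thesis
    unfolding e(1) e(2,3)[symmetric] by (simp add: algebra_simps)
qed

text \<open>Makes the choice hidden in \<open>weak_gradient\<close> explicit almost everywhere.
  Agreement of \<open>\<psi>\<close> with the transform is asked for on the image domain only: a
  function and its twofold transform may differ at the origin.\<close>

lemma kelvin_weak_gradient:
  fixes \<phi> :: "real ^ 'n::{finite,wellorder} \<Rightarrow> real"
  assumes \<Omega>: "open \<Omega>" "0 \<notin> \<Omega>" and wd: "weakly_differentiable \<Omega> \<phi>"
    and eq: "\<And>y. y \<in> inversion ` \<Omega> \<Longrightarrow> \<psi> y = kelvin m \<phi> y"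
  shows "AE y in lebesgue_on (inversion ` \<Omega>). weak_gradient (inversion ` \<Omega>) \<psi> y = kelvin_gradient m \<phi> (weak_gradient \<Omega> \<phi>) y"
proof (rule has_weak_gradient_unique[OF open_inversion_image[OF \<Omega>] _ has_weak_gradient_kelvin[OF \<Omega>]])
  show "has_weak_gradient \<Omega> \<phi> (weak_gradient \<Omega> \<phi>)" using wd by (simp add: weakly_differentiable_iff)
  then have "has_weak_gradient (inversion ` \<Omega>) \<psi> (kelvin_gradient m \<phi> (weak_gradient \<Omega> \<phi>))"
    using has_weak_gradient_kelvin[OF \<Omega>] has_weak_gradient_cong[of "inversion ` \<Omega>" \<psi> "kelvin m \<phi>"] eq by blast
  then show "has_weak_gradient (inversion ` \<Omega>) \<psi> (weak_gradient (inversion ` \<Omega>) \<psi>)"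
    using weakly_differentiable_iff unfolding weakly_differentiable_def by blast
  show "AE y in lebesgue_on (inversion ` \<Omega>). \<psi> y = kelvin m \<phi> y"
    using eq by (intro AE_I2) simp
qed

text \<open>The zero-order terms enter only through the pointwise relation \<open>XY\<close>, so the
  same identity serves the weak equation, where \<open>u\<close> is the solution, and the stability
  form, where \<open>u\<close> and \<open>\<phi>\<close> are the same test function.\<close>

lemma kelvin_bilinear_form:
  fixes \<Omega> :: "(real ^ 'n::{finite,wellorder}) set"
  assumes \<Omega>: "open \<Omega>" "0 \<notin> \<Omega>"
    and u: "weakly_differentiable \<Omega> u" "u \<in> Linf_loc \<Omega>"
    and p: "\<phi> \<in> H1_c \<theta> \<Omega>" "\<phi> \<in> Linf_loc \<Omega>"
  defines "m \<equiv> real CARD('n) - 2 + \<theta>"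
  assumes U: "\<And>y. y \<in> inversion ` \<Omega> \<Longrightarrow> U y = kelvin m u y"
    and \<psi>: "\<And>y. y \<in> inversion ` \<Omega> \<Longrightarrow> \<psi> y = kelvin m \<phi> y"
    and XY: "\<And>x. x \<in> \<Omega> \<Longrightarrow> norm x powr (- 2 * real CARD('n)) * X (inversion x) = Y x"
  shows "(LINT y|lebesgue_on (inversion ` \<Omega>). norm y powr \<theta> *
        (weak_gradient (inversion ` \<Omega>) U y \<bullet> weak_gradient (inversion ` \<Omega>) \<psi> y) - X y)
    = (LINT x|lebesgue_on \<Omega>. norm x powr \<theta> * (weak_gradient \<Omega> u x \<bullet> weak_gradient \<Omega> \<phi> x) - Y x)"
proof -
  obtain K where K: "compact K" "K \<subseteq> \<Omega>" "AE x in lebesgue_on (\<Omega> - K). \<phi> x = 0" and wp: "weakly_differentiable \<Omega> \<phi>"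
    using H1_c_support[OF \<Omega> p(1)] by metis
  define gu gp where "gu = weak_gradient \<Omega> u" and "gp = weak_gradient \<Omega> \<phi>"
  define W where "W x = norm x powr (\<theta> - 2) * (\<phi> x * (gu x \<bullet> x) + u x * (gp x \<bullet> x) + m * (u x * \<phi> x))" for x
  have g: "has_weak_gradient \<Omega> u gu" "has_weak_gradient \<Omega> \<phi> gp"
    using u wp by (auto simp: weakly_differentiable_iff gu_def gp_def)
  have S: "\<Omega> \<in> sets lebesgue" "inversion ` \<Omega> \<in> sets lebesgue"
    using \<Omega> open_inversion_image[OF \<Omega>] by auto
  have W: "integrable (lebesgue_on \<Omega>) W" "integral\<^sup>L (lebesgue_on \<Omega>) W = 0"
    using radial_integration_by_parts[OF \<Omega> g(1) u(2) g(2) p(2) K, of \<theta>] unfolding W_def[abs_def] m_def by simp_all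
  let ?F = "\<lambda>x. norm x powr \<theta> * (gu x \<bullet> gp x) - Y x"
  have AE_U: "AE y in lebesgue_on (inversion ` \<Omega>). weak_gradient (inversion ` \<Omega>) U y = kelvin_gradient m u gu y"
    unfolding gu_def by (rule kelvin_weak_gradient[OF \<Omega> u(1)]) (rule U)
  have AE_\<psi>: "AE y in lebesgue_on (inversion ` \<Omega>). weak_gradient (inversion ` \<Omega>) \<psi> y = kelvin_gradient m \<phi> gp y"
    unfolding gp_def by (rule kelvin_weak_gradient[OF \<Omega> wp]) (rule \<psi>)
  have "(LINT y|lebesgue_on (inversion ` \<Omega>). norm y powr \<theta> *
        (weak_gradient (inversion ` \<Omega>) U y \<bullet> weak_gradient (inversion ` \<Omega>) \<psi> y) - X y)
    = (LINT y|lebesgue_on (inversion ` \<Omega>). norm y powr \<theta> *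
        (kelvin_gradient m u gu y \<bullet> kelvin_gradient m \<phi> gp y) - X y)"
  proof (rule integral_cong_AE_lebesgue_on[OF S(2)])
    show "AE y in lebesgue_on (inversion ` \<Omega>). norm y powr \<theta> *
        (weak_gradient (inversion ` \<Omega>) U y \<bullet> weak_gradient (inversion ` \<Omega>) \<psi> y) - X y
      = norm y powr \<theta> * (kelvin_gradient m u gu y \<bullet> kelvin_gradient m \<phi> gp y) - X y"
      using AE_U AE_\<psi> by eventually_elim simp
  qed
  also have "\<dots> = (LINT x|lebesgue_on \<Omega>. norm x powr (- 2 * real CARD('n)) * (norm (inversion x) powr \<theta> *
        (kelvin_gradient m u gu (inversion x) \<bullet> kelvin_gradient m \<phi> gp (inversion x)) - X (inversion x)))"
    by (rule integral_inversion[OF S(1) \<Omega>(2)])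
  also have "\<dots> = (LINT x|lebesgue_on \<Omega>. ?F x + m * W x)"
  proof (rule Bochner_Integration.integral_cong[OF refl])
    fix x assume "x \<in> space (lebesgue_on \<Omega>)"
    then have x: "x \<in> \<Omega>" by simp
    then have x0: "x \<noteq> 0" using \<Omega> by auto
    \<comment> \<open>The value of \<open>m\<close> makes the exponents match:
      \<open>- 2N - \<theta> + 2m + 4 = \<theta>\<close>, and the second one is smaller by
      2.\<close>
    have e: "norm x powr (- 2 * real CARD('n)) * (norm x powr (- \<theta>) * norm x powr (2 * m + 4)) = norm x powr \<theta>"
      "norm x powr (- 2 * real CARD('n)) * (norm x powr (- \<theta>) * norm x powr (2 * m + 2)) = norm x powr (\<theta> - 2)"
      by (simp_all add: m_def flip: powr_add)
    have "norm x powr (- 2 * real CARD('n)) * (norm (inversion x) powr \<theta> *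
        (kelvin_gradient m u gu (inversion x) \<bullet> kelvin_gradient m \<phi> gp (inversion x)) - X (inversion x))
     = norm x powr (- 2 * real CARD('n)) * (norm x powr (- \<theta>) * norm x powr (2 * m + 4)) * (gu x \<bullet> gp x)
      + m * (norm x powr (- 2 * real CARD('n)) * (norm x powr (- \<theta>) * norm x powr (2 * m + 2))
        * (\<phi> x * (gu x \<bullet> x) + u x * (gp x \<bullet> x) + m * (u x * \<phi> x)))
      - norm x powr (- 2 * real CARD('n)) * X (inversion x)"
      unfolding kelvin_gradient_inner[OF x0] norm_inversion_powr by (simp only: right_diff_distrib distrib_left mult_ac)
    then show "norm x powr (- 2 * real CARD('n)) * (norm (inversion x) powr \<theta> *
        (kelvin_gradient m u gu (inversion x) \<bullet> kelvin_gradient m \<phi> gp (inversion x)) - X (inversion x))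
       = ?F x + m * W x"
      unfolding e XY[OF x] W_def by simp
  qed
  also have "\<dots> = (LINT x|lebesgue_on \<Omega>. ?F x)"
  \<comment> \<open>Adding the integrable function \<open>m * W\<close> does not change
    integrability, so in the degenerate case both integrals are 0 by convention.\<close>
  proof (cases "integrable (lebesgue_on \<Omega>) ?F")
    case True
    then show ?thesis using W by simp
  next
    case False
    have "\<not> integrable (lebesgue_on \<Omega>) (\<lambda>x. ?F x + m * W x)"
    proof
      assume "integrable (lebesgue_on \<Omega>) (\<lambda>x. ?F x + m * W x)"
      from Bochner_Integration.integrable_diff[OF this integrable_mult_right[OF W(1), of m]]
      show False using False by simp
    qed
    then show ?thesis using False by (simp add: not_integrable_integral_eq)
  qed
  finally show ?thesis by (simp add: gu_def gp_def)
qed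

section \<open>Transfer of stability and of the equation\<close>

lemma kelvin_admissible:
  fixes \<Omega> :: "(real ^ 'n::{finite,wellorder}) set"
  assumes \<Omega>: "open \<Omega>" "0 \<notin> \<Omega>" and \<psi>: "\<psi> \<in> H1_c \<theta> (inversion ` \<Omega>) \<inter> Linf_loc (inversion ` \<Omega>)"
  shows "kelvin m \<psi> \<in> H1_c \<theta> \<Omega>" "kelvin m \<psi> \<in> Linf_loc \<Omega>"
    "\<And>y. y \<in> inversion ` \<Omega> \<Longrightarrow> \<psi> y = kelvin m (kelvin m \<psi>) y"
proof -
  note \<Omega>' = open_inversion_image[OF \<Omega>] zero_notin_inversion_image[OF \<Omega>(2)]
  show "kelvin m \<psi> \<in> H1_c \<theta> \<Omega>" "kelvin m \<psi> \<in> Linf_loc \<Omega>"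
    using H1_c_kelvin[OF \<Omega>', of \<psi>] Linf_loc_kelvin[OF \<Omega>', of \<psi>] \<psi> by (auto simp: inversion_image_image)
  show "\<psi> y = kelvin m (kelvin m \<psi>) y" if "y \<in> inversion ` \<Omega>" for y
  proof -
    have "y \<noteq> 0" using that \<Omega>'(2) by metis
    then show ?thesis by (simp add: kelvin_kelvin)
  qed
qed

text \<open>The potentials are arbitrary so that the lemma can be applied with
  \<open>\<Omega>\<close> and its image exchanged, which yields the converse implication.\<close>

lemma kelvin_quadratic_form_nonneg:
  fixes \<Omega> :: "(real ^ 'n::{finite,wellorder}) set"
  assumes \<Omega>: "open \<Omega>" "0 \<notin> \<Omega>"
    and nonneg: "\<And>\<phi>. \<phi> \<in> H1_c \<theta> \<Omega> \<inter> Linf_loc \<Omega> \<Longrightarrow>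
        0 \<le> (LINT x|lebesgue_on \<Omega>. norm x powr \<theta> * (norm (weak_gradient \<Omega> \<phi> x))\<^sup>2 - V x * (\<phi> x)\<^sup>2)"
    and VV': "\<And>x. x \<in> \<Omega> \<Longrightarrow> V' (inversion x) = norm x powr (4 - 2 * \<theta>) * V x"
    and \<psi>: "\<psi> \<in> H1_c \<theta> (inversion ` \<Omega>) \<inter> Linf_loc (inversion ` \<Omega>)"
  shows "0 \<le> (LINT y|lebesgue_on (inversion ` \<Omega>).
      norm y powr \<theta> * (norm (weak_gradient (inversion ` \<Omega>) \<psi> y))\<^sup>2 - V' y * (\<psi> y)\<^sup>2)"
proof -
  define m where "m = real CARD('n) - 2 + \<theta>"
  \<comment> \<open>Each test function on the image is, on the image, the transform of an admissible
    function on \<open>\<Omega>\<close>, so nonnegativity on \<open>\<Omega>\<close> reaches all of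
    them.\<close>
  note K = kelvin_admissible[OF \<Omega> \<psi>, where m = m]
  have wd: "weakly_differentiable \<Omega> (kelvin m \<psi>)" using K(1) by (simp add: H1_c_def H1_def)
  have "(LINT y|lebesgue_on (inversion ` \<Omega>). norm y powr \<theta> *
        (weak_gradient (inversion ` \<Omega>) \<psi> y \<bullet> weak_gradient (inversion ` \<Omega>) \<psi> y) - V' y * (\<psi> y)\<^sup>2)
    = (LINT x|lebesgue_on \<Omega>. norm x powr \<theta> *
        (weak_gradient \<Omega> (kelvin m \<psi>) x \<bullet> weak_gradient \<Omega> (kelvin m \<psi>) x) - V x * (kelvin m \<psi> x)\<^sup>2)"
  proof (rule kelvin_bilinear_form[OF \<Omega> wd K(2,1,2)])
    fix x assume x: "x \<in> \<Omega>"
    then have x0: "x \<noteq> 0" using \<Omega> by auto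
    \<comment> \<open>Since \<open>- 2N + 4 - 2\<theta> = - 2m\<close>, the Jacobian and the ratio
      of the potentials combine to the square of the weight in
      \<open>kelvin m \<psi>\<close>.\<close>
    have "norm x powr (- 2 * real CARD('n)) * norm x powr (4 - 2 * \<theta>) = (norm x powr (- m))\<^sup>2"
      by (simp add: m_def power2_eq_square algebra_simps flip: powr_add)
    then show "norm x powr (- 2 * real CARD('n)) * (V' (inversion x) * (\<psi> (inversion x))\<^sup>2) = V x * (kelvin m \<psi> x)\<^sup>2"
      unfolding VV'[OF x] kelvin_def power_mult_distrib by (simp add: mult_ac)
  qed (use K(3) in \<open>simp_all add: m_def\<close>)
  moreover have "0 \<le> (LINT x|lebesgue_on \<Omega>. norm x powr \<theta> *
      (norm (weak_gradient \<Omega> (kelvin m \<psi>) x))\<^sup>2 - V x * (kelvin m \<psi> x)\<^sup>2)"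
    using nonneg K(1,2) by blast
  ultimately show ?thesis by (simp add: dot_square_norm)
qed

lemma weak_gradient_cong:
  "(\<And>x. x \<in> \<Omega> \<Longrightarrow> v x = w x) \<Longrightarrow> weak_gradient \<Omega> v = weak_gradient \<Omega> w"
  unfolding weak_gradient_def by (intro arg_cong[where f = Eps] ext has_weak_gradient_cong)

text \<open>Serves to pass from \<open>kelvin m v\<close> to the given \<open>w\<close>, which is
  prescribed on the exterior domain only.\<close>

lemma is_solution_cong:
  fixes v w :: "'a::euclidean_space \<Rightarrow> real"
  assumes eq: "\<And>x. x \<in> \<Omega> \<Longrightarrow> v x = w x" and "is_solution \<theta> \<mu> p \<Omega> v"
  shows "is_solution \<theta> \<mu> p \<Omega> w"
proof -
  have wg: "weak_gradient \<Omega> w = weak_gradient \<Omega> v"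
    using weak_gradient_cong[of \<Omega> v w] eq by simp
  have "weakly_differentiable \<Omega> w \<longleftrightarrow> weakly_differentiable \<Omega> v"
    unfolding weakly_differentiable_def using has_weak_gradient_cong[of \<Omega> v w] eq by blast
  moreover have "(\<lambda>x. norm x powr (\<theta> / 2) * v x) \<in> L2_on K \<longleftrightarrow> (\<lambda>x. norm x powr (\<theta> / 2) * w x) \<in> L2_on K" if "K \<subseteq> \<Omega>" for K
    using eq that by (intro L2_on_cong) auto
  ultimately have "w \<in> H1_loc \<theta> \<Omega>"
    using assms(2) unfolding is_solution_def H1_loc_def by (auto simp: wg)
  moreover have "w \<in> Linf_loc \<Omega>"
  proof -
    have "w \<in> borel_measurable (lebesgue_on \<Omega>) \<longleftrightarrow> v \<in> borel_measurable (lebesgue_on \<Omega>)"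
      using eq by (intro measurable_cong) simp
    moreover have "AE x in lebesgue_on K. \<bar>w x\<bar> \<le> C" if "K \<subseteq> \<Omega>" "AE x in lebesgue_on K. \<bar>v x\<bar> \<le> C" for K C
      using that(2) AE_space[of "lebesgue_on K"] by eventually_elim (use eq that(1) in auto)
    ultimately show ?thesis
      using assms(2) unfolding is_solution_def Linf_loc_def by blast
  qed
  moreover have "(LINT x|lebesgue_on \<Omega>. norm x powr \<theta> * (weak_gradient \<Omega> w x \<bullet> weak_gradient \<Omega> \<phi> x)
            - norm x powr \<mu> * \<bar>w x\<bar> powr (p - 1) * w x * \<phi> x) =
      (LINT x|lebesgue_on \<Omega>. norm x powr \<theta> * (weak_gradient \<Omega> v x \<bullet> weak_gradient \<Omega> \<phi> x)
            - norm x powr \<mu> * \<bar>v x\<bar> powr (p - 1) * v x * \<phi> x)" for \<phi>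
    unfolding wg using eq by (intro Bochner_Integration.integral_cong) auto
  ultimately show ?thesis
    using assms(2) unfolding is_solution_def by auto
qed

lemma is_solution_kelvin:
  fixes v :: "real ^ 'n::{finite,wellorder} \<Rightarrow> real"
  assumes \<Omega>: "open \<Omega>" "0 \<notin> \<Omega>" and v: "is_solution \<theta> l p \<Omega> v"
  defines "m \<equiv> real CARD('n) - 2 + \<theta>"
  shows "is_solution \<theta> (m * (p - 1) - (4 + l - 2 * \<theta>)) p (inversion ` \<Omega>) (kelvin m v)"
  unfolding is_solution_def
proof (intro conjI ballI)
  let ?\<beta> = "m * (p - 1) - (4 + l - 2 * \<theta>)"
  have v': "v \<in> H1_loc \<theta> \<Omega>" "v \<in> Linf_loc \<Omega>" using v by (auto simp: is_solution_def)
  then show "kelvin m v \<in> H1_loc \<theta> (inversion ` \<Omega>) \<inter> Linf_loc (inversion ` \<Omega>)"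
    using H1_loc_kelvin[OF \<Omega>] Linf_loc_kelvin[OF \<Omega>] by blast
  have wd: "weakly_differentiable \<Omega> v" using v'(1) by (simp add: H1_loc_def)
  fix \<psi> :: "(real, 'n) vec \<Rightarrow> real" assume \<psi>: "\<psi> \<in> H1_c \<theta> (inversion ` \<Omega>) \<inter> Linf_loc (inversion ` \<Omega>)"
  note K = kelvin_admissible[OF \<Omega> \<psi>, where m = m]
  have "(LINT y|lebesgue_on (inversion ` \<Omega>). norm y powr \<theta> *
        (weak_gradient (inversion ` \<Omega>) (kelvin m v) y \<bullet> weak_gradient (inversion ` \<Omega>) \<psi> y)
        - norm y powr ?\<beta> * \<bar>kelvin m v y\<bar> powr (p - 1) * kelvin m v y * \<psi> y)
    = (LINT x|lebesgue_on \<Omega>. norm x powr \<theta> *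
        (weak_gradient \<Omega> v x \<bullet> weak_gradient \<Omega> (kelvin m \<psi>) x)
        - norm x powr l * \<bar>v x\<bar> powr (p - 1) * v x * kelvin m \<psi> x)"
  proof (rule kelvin_bilinear_form[OF \<Omega> wd v'(2) K(1,2)])
    fix x assume x: "x \<in> \<Omega>"
    then have x0: "x \<noteq> 0" using \<Omega> by auto
    have k: "kelvin m v (inversion x) = norm x powr m * v x"
      by (simp add: kelvin_def norm_inversion_powr)
    have a: "\<bar>norm x powr m * v x\<bar> powr (p - 1) = norm x powr (m * (p - 1)) * \<bar>v x\<bar> powr (p - 1)"
      by (simp add: abs_mult powr_mult powr_powr)
    \<comment> \<open>The balance of exponents \<open>- 2N - \<beta> + m(p - 1) + m = l - m\<close>
      is what determines \<open>\<beta>\<close>.\<close>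
    have "norm x powr (- 2 * real CARD('n)) * norm x powr (- ?\<beta>) * norm x powr (m * (p - 1)) * norm x powr m
        = norm x powr l * norm x powr (- m)"
      by (simp add: m_def algebra_simps flip: powr_add)
    from arg_cong[OF this, of "\<lambda>t. t * (\<bar>v x\<bar> powr (p - 1) * v x * \<psi> (inversion x))"]
    show "norm x powr (- 2 * real CARD('n)) * (norm (inversion x) powr ?\<beta> *
        \<bar>kelvin m v (inversion x)\<bar> powr (p - 1) * kelvin m v (inversion x) * \<psi> (inversion x))
      = norm x powr l * \<bar>v x\<bar> powr (p - 1) * v x * kelvin m \<psi> x"
      unfolding k a norm_inversion_powr kelvin_def[of m \<psi>] by (simp only: mult_ac)
  qed (use K(3) in \<open>simp_all add: m_def\<close>)
  also have "\<dots> = 0"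
    using v K(1,2) unfolding is_solution_def by blast
  finally show "(LINT y|lebesgue_on (inversion ` \<Omega>). norm y powr \<theta> *
        (weak_gradient (inversion ` \<Omega>) (kelvin m v) y \<bullet> weak_gradient (inversion ` \<Omega>) \<psi> y)
        - norm y powr ?\<beta> * \<bar>kelvin m v y\<bar> powr (p - 1) * kelvin m v y * \<psi> y) = 0" .
qed

lemma inversion_image_punctured_ball:
  assumes "R > 0"
  shows "inversion ` (ball 0 R - {0}) = UNIV - cball (0::'a::euclidean_space) (1 / R)"
proof (rule set_eqI)
  fix y :: 'a
  show "y \<in> inversion ` (ball 0 R - {0}) \<longleftrightarrow> y \<in> UNIV - cball 0 (1 / R)"
  proof (cases "y = 0")
    case False
    then have "inverse (norm y) < R \<longleftrightarrow> 1 / R < norm y"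
      using assms by (simp add: field_simps)
    then show ?thesis using False by (auto simp: mem_inversion_image norm_inversion not_le)
  qed (use assms in \<open>auto simp: mem_inversion_image inversion_def\<close>)
qed

theorem proposition1p6:
  fixes v w :: "real ^ 'n::{finite,wellorder} \<Rightarrow> real"
    and p \<theta> l \<beta> R :: real
  assumes "CARD('n) \<ge> 2" and "p > 1" and "R > 0"
    and "is_solution \<theta> l p (ball 0 R - {0}) v"
    and "\<And>x. x \<in> ball 0 R - {0} \<Longrightarrow>
           w (x /\<^sub>R (norm x)\<^sup>2) = norm x powr (real CARD('n) - 2 + \<theta>) * v x"
    and "\<beta> = (real CARD('n) - 2 + \<theta>) * (p - 1) - (4 + l - 2 * \<theta>)"
  shows "is_stable \<theta> l p (ball 0 R - {0}) v \<longleftrightarrow>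
         is_solution \<theta> \<beta> p (UNIV - cball 0 (1 / R)) w \<and>
         is_stable \<theta> \<beta> p (UNIV - cball 0 (1 / R)) w"
proof -
  define m where "m = real CARD('n) - 2 + \<theta>"
  define \<Omega> where "\<Omega> = ball (0 :: (real, 'n) vec) R - {0}"
  have \<Omega>: "open \<Omega>" "0 \<notin> \<Omega>" by (auto simp: \<Omega>_def)
  note \<Omega>' = open_inversion_image[OF \<Omega>] zero_notin_inversion_image[OF \<Omega>(2)]
  have img: "UNIV - cball 0 (1 / R) = inversion ` \<Omega>"
    unfolding \<Omega>_def by (rule inversion_image_punctured_ball[OF assms(3), symmetric])
  have w: "w (inversion x) = norm x powr m * v x" if "x \<in> \<Omega>" for x
    using assms(5)[of x] that by (simp add: \<Omega>_def m_def inversion_def)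
  \<comment> \<open>\<open>w\<close> solves its equation whether or not \<open>v\<close> is stable,
    so only the two stability conditions remain to be compared.\<close>
  have sol: "is_solution \<theta> \<beta> p (inversion ` \<Omega>) w"
  proof (rule is_solution_cong)
    show "is_solution \<theta> \<beta> p (inversion ` \<Omega>) (kelvin m v)"
      using is_solution_kelvin[OF \<Omega>, of \<theta> l p v] assms(4,6) by (simp add: \<Omega>_def m_def)
    show "kelvin m v y = w y" if "y \<in> inversion ` \<Omega>" for y
      using that w[of "inversion y"] by (simp add: mem_inversion_image kelvin_def norm_inversion_powr)
  qed
  define V where "V x = p * norm x powr l * \<bar>v x\<bar> powr (p - 1)" for x
  define V' where "V' y = p * norm y powr \<beta> * \<bar>w y\<bar> powr (p - 1)" for y
  have VV': "V' (inversion x) = norm x powr (4 - 2 * \<theta>) * V x" if x: "x \<in> \<Omega>" for x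
  proof -
    have "norm x powr (- \<beta>) * norm x powr (m * (p - 1)) = norm x powr (4 - 2 * \<theta>) * norm x powr l"
      by (simp add: assms(6) m_def algebra_simps flip: powr_add)
    then show ?thesis
      unfolding V'_def V_def w[OF x] norm_inversion_powr
      by (simp add: abs_mult powr_mult powr_powr)
  qed
  \<comment> \<open>The norm of \<open>inversion y\<close> is the reciprocal of the norm of
    \<open>y\<close>, so solving the relation for the other potential reproduces the same
    exponent.\<close>
  have V'V: "V (inversion y) = norm y powr (4 - 2 * \<theta>) * V' y" if y: "y \<in> inversion ` \<Omega>" for y
  proof -
    have "y \<noteq> 0" using y \<Omega>'(2) by auto
    then show ?thesis
      using VV'[of "inversion y"] y by (simp add: mem_inversion_image norm_inversion_powr flip: powr_add mult.assoc)
  qed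
  have "is_stable \<theta> l p \<Omega> v \<longleftrightarrow> is_stable \<theta> \<beta> p (inversion ` \<Omega>) w"
    unfolding is_stable_def V_def[symmetric] V'_def[symmetric]
  proof (intro iffI ballI)
    fix \<psi> assume "\<forall>\<psi>\<in>H1_c \<theta> \<Omega> \<inter> Linf_loc \<Omega>. 0 \<le> (LINT x|lebesgue_on \<Omega>.
        norm x powr \<theta> * (norm (weak_gradient \<Omega> \<psi> x))\<^sup>2 - V x * (\<psi> x)\<^sup>2)"
      and "\<psi> \<in> H1_c \<theta> (inversion ` \<Omega>) \<inter> Linf_loc (inversion ` \<Omega>)"
    then show "0 \<le> (LINT x|lebesgue_on (inversion ` \<Omega>).
        norm x powr \<theta> * (norm (weak_gradient (inversion ` \<Omega>) \<psi> x))\<^sup>2 - V' x * (\<psi> x)\<^sup>2)"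
      using kelvin_quadratic_form_nonneg[OF \<Omega> _ VV'] by blast
  next
    fix \<psi> assume "\<forall>\<psi>\<in>H1_c \<theta> (inversion ` \<Omega>) \<inter> Linf_loc (inversion ` \<Omega>). 0 \<le> (LINT x|lebesgue_on (inversion ` \<Omega>).
        norm x powr \<theta> * (norm (weak_gradient (inversion ` \<Omega>) \<psi> x))\<^sup>2 - V' x * (\<psi> x)\<^sup>2)"
      and "\<psi> \<in> H1_c \<theta> \<Omega> \<inter> Linf_loc \<Omega>"
    then show "0 \<le> (LINT x|lebesgue_on \<Omega>. norm x powr \<theta> * (norm (weak_gradient \<Omega> \<psi> x))\<^sup>2 - V x * (\<psi> x)\<^sup>2)"
      \<comment> \<open>The converse is the same implication started from the image domain, whose
        own image under the inversion is \<open>\<Omega>\<close>.\<close>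
      using kelvin_quadratic_form_nonneg[OF \<Omega>' _ V'V] unfolding inversion_image_image by blast
  qed
  then show ?thesis
    unfolding img using sol by (simp add: \<Omega>_def)
qed

end
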